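(* Let $\sigma$ be a smooth function and $h^{(2)}_{ab}$ a smooth symmetric tensor on the unit hyperboloid $\mathcal H$ satisfying the asymptotic vacuum Einstein equations $$(\Box+3)\sigma=0,\qquad h^{(2)a}{}_a=12\sigma^2+\sigma_c\sigma^c,\qquad \mathcal D^bh^{(2)}_{ab}=\mathcal D_a\left(\sigma_c\sigma^c+8\sigma^2\right),$$ $$(\Box-2)h^{(2)}_{ab}=\mathcal D_a\mathcal D_b\left(5\sigma^2+\sigma_c\sigma^c\right)+h^{(0)}_{ab}\left(-18\sigma^2+4\sigma_c\sigma^c\right)+4\sigma\sigma_{ab}.$$ Define $$E^{(1)}_{ab}=-\sigma_{ab}-\sigma h^{(0)}_{ab},\qquad E^{(2)}_{ab}=-h^{(2)}_{ab}+5\sigma^2h^{(0)}_{ab}+\sigma\sigma_{ab}-2\sigma_a\sigma_b+\sigma_c\sigma^ch^{(0)}_{ab},$$ $$B^{(2)}_{ab}=\epsilon_a{}^{cd}\mathcal D_c\left(h^{(2)}_{db}-2\sigma^2h^{(0)}_{db}\right).$$ Then for $i=1,2,3$ the Lorentz charges can be expressed equivalently with the electric or the magnetic part of the Weyl tensor: $$\frac1{8\pi G}\oint_Sd^2S\,(E^{(2)}_{ab}-\sigma E^{(1)}_{ab})\,\xi^a_{\mathrm{rot}(i)}n^b=-\frac1{8\pi G}\oint_Sd^2S\,B^{(2)}_{ab}\,\xi^a_{\mathrm{boost}(i)}n^b,$$ $$\frac1{8\pi G}\oint_Sd^2S\,(E^{(2)}_{ab}-\sigma E^{(1)}_{ab})\,\xi^a_{\mathrm{boost}(i)}n^b=\frac1{8\pi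 G}\oint_Sd^2S\,B^{(2)}_{ab}\,\xi^a_{\mathrm{rot}(i)}n^b .$$
   Context: $\mathcal H$ is three-dimensional de Sitter space $\mathbb R\times S^2$ with metric $h^{(0)}_{ab}dx^adx^b=-d\tau^2+\cosh^2\tau(d\theta^2+\sin^2\theta\,d\phi^2)$; $\mathcal D_a$ is its Levi-Civita covariant derivative, $\Box=\mathcal D^a\mathcal D_a$, indices are moved with $h^{(0)}$, and $\epsilon_{abc}$ is the volume form with $\epsilon_{\tau\theta\phi}=+\cosh^2\tau\sin\theta$. Notation: $\sigma_a=\mathcal D_a\sigma$, $\sigma_{ab}=\mathcal D_b\mathcal D_a\sigma$. $G>0$ is a constant. (The fields arise from asymptotically flat metrics $ds^2=(1+\sigma/\rho)^2d\rho^2+\rho^2\big(h^{(0)}_{ab}-2\sigma h^{(0)}_{ab}/\rho+h^{(2)}_{ab}/\rho^2+\dots\big)dx^adx^b$; $E^{(1)},E^{(2)}$ and $B^{(2)}$ are then the first/second order electric and second order magnetic parts of the Weyl tensor. The claim only uses the definitions given.) $S$ is a Cauchy surface (a two-sphere cut) of $\mathcal H$, $n^a$ its unit future-directed normal ($\partial_\tau$ on constant $\tau$ cuts), $d^2S$ the induced area element. With $f_{(1)}=\cos\theta$, $f_{(2)}=\sin\theta\cos\phi$, $f_{(3)}=\sin\theta\sin\phi$, the Killing vectors are the rotations, tangent to the spheres, $\xi^m_{\mathrm{rot}(i)}=\epsilon_{(S^2)}^{mn}\partial_nf_{(i)}$ (unit-sphere $\epsilon_{(S^2)}^{\theta\phi}=1/\sin\theta$),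 and the boosts $\xi^a_{\mathrm{boost}(i)}=f_{(i)}(\partial_\tau)^a+\cosh\tau\sinh\tau\,h^{(0)ab}\partial_bf_{(i)}$. *)

theory Defs
  imports "HOL-Analysis.Analysis"
begin

subsection \<open>Smooth functions\<close>

primrec C_on :: "nat \<Rightarrow> 'a::euclidean_space set \<Rightarrow> ('a \<Rightarrow> 'b::real_normed_vector) \<Rightarrow> bool" where
  "C_on 0 U f \<longleftrightarrow> continuous_on U f"
| "C_on (Suc k) U f \<longleftrightarrow>
     (\<forall>x\<in>U. f differentiable (at x)) \<and> (\<forall>v. C_on k U (\<lambda>x. frechet_derivative f (at x) v))"

text \<open>Smoothness on a subset \<open>M\<close> of a Euclidean space, in the usual sense of local
  smooth extensions; used below only for the submanifolds \<open>S\<^sup>2\<close> and \<open>\<real> \<times> S\<^sup>2\<close>.\<close>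

definition smooth_on :: "'a::euclidean_space set \<Rightarrow> ('a \<Rightarrow> 'b::real_normed_vector) \<Rightarrow> bool" where
  "smooth_on M f \<longleftrightarrow>
     (\<forall>p\<in>M. \<exists>U F. open U \<and> p \<in> U \<and> (\<forall>k. C_on k U F) \<and> (\<forall>q\<in>U \<inter> M. F q = f q))"


subsection \<open>The hyperboloid \<open>\<real> \<times> S\<^sup>2\<close> and its fields\<close>

definition hyp :: "(real \<times> (real^3)) set" where
  "hyp = UNIV \<times> sphere 0 1"

text \<open>A covariant 2-tensor at \<open>p \<in> hyp\<close> is given by a bilinear form on the ambient space
  \<open>\<real> \<times> \<real>\<^sup>3\<close>. Only its values on vectors tangent to \<open>hyp\<close> are used (see \<open>pull2\<close>),
  and every smooth symmetric tensor field on \<open>hyp\<close> is the restriction of such a field.\<close>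

definition smooth_sym_tensor ::
    "(real \<times> (real^3) \<Rightarrow> real \<times> (real^3) \<Rightarrow> real \<times> (real^3) \<Rightarrow> real) \<Rightarrow> bool" where
  "smooth_sym_tensor h \<longleftrightarrow>
     (\<forall>p\<in>hyp. bilinear (h p) \<and> (\<forall>u v. h p u v = h p v u)) \<and>
     (\<forall>u v. smooth_on hyp (\<lambda>p. h p u v))"

text \<open>Coordinates are \<open>x = (\<tau>, \<theta>, \<phi>)\<close>, i.e. \<open>x$1 = \<tau>\<close>, \<open>x$2 = \<theta>\<close>, \<open>x$3 = \<phi>\<close>. On \<open>chart\<close> the angle
  \<open>\<phi>\<close> is unrestricted, so \<open>emb\<close> covers everything except the two poles \<open>\<theta> = 0, \<pi>\<close>
  of the spheres. As all fields are smooth on the whole of \<open>hyp\<close>, a tensor equation that holds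
  on \<open>chart\<close> holds everywhere.\<close>

definition chart :: "(real^3) set" where
  "chart = {x. 0 < x$2 \<and> x$2 < pi}"

definition harm :: "3 \<Rightarrow> real^3 \<Rightarrow> real" where
  "harm i x = (vector [cos (x$2), sin (x$2) * cos (x$3), sin (x$2) * sin (x$3)] :: real^3) $ i"

definition emb :: "real^3 \<Rightarrow> real \<times> (real^3)" where
  "emb x = (x$1, \<chi> i. harm i x)"

definition pd :: "3 \<Rightarrow> (real^3 \<Rightarrow> 'b::real_normed_vector) \<Rightarrow> real^3 \<Rightarrow> 'b" where
  "pd a f x = frechet_derivative f (at x) (axis a 1)"

type_synonym scal = "real^3 \<Rightarrow> real"
type_synonym tens1 = "3 \<Rightarrow> scal"
type_synonym tens2 = "3 \<Rightarrow> 3 \<Rightarrow> scal"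
type_synonym tens3 = "3 \<Rightarrow> 3 \<Rightarrow> 3 \<Rightarrow> scal"

definition pull0 :: "(real \<times> (real^3) \<Rightarrow> real) \<Rightarrow> scal" where
  "pull0 f x = f (emb x)"

definition pull2 :: "(real \<times> (real^3) \<Rightarrow> real \<times> (real^3) \<Rightarrow> real \<times> (real^3) \<Rightarrow> real) \<Rightarrow> tens2" where
  "pull2 h a b x = h (emb x) (pd a emb x) (pd b emb x)"


subsection \<open>De Sitter metric, Levi-Civita derivative, volume form\<close>

definition h0 :: tens2 where
  "h0 a b x =
     (if a \<noteq> b then 0
      else (vector [-1, (cosh (x$1))\<^sup>2, (cosh (x$1))\<^sup>2 * (sin (x$2))\<^sup>2] :: real^3) $ a)"

definition h0inv :: tens2 where
  "h0inv a b x = matrix_inv (\<chi> i j. h0 i j x) $ a $ b"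

definition christoffel :: tens3 where
  "christoffel c a b x =
     (1/2) * (\<Sum>d\<in>UNIV. h0inv c d x * (pd a (h0 d b) x + pd b (h0 d a) x - pd d (h0 a b) x))"

text \<open>The index of the derivative comes first: \<open>cov2 c t a b\<close> is \<open>D\<^sub>c t\<^sub>a\<^sub>b\<close>.\<close>

definition cov1 :: "3 \<Rightarrow> tens1 \<Rightarrow> tens1" where
  "cov1 c w a x = pd c (w a) x - (\<Sum>d\<in>UNIV. christoffel d c a x * w d x)"

definition cov2 :: "3 \<Rightarrow> tens2 \<Rightarrow> tens2" where
  "cov2 c t a b x = pd c (t a b) x
     - (\<Sum>d\<in>UNIV. christoffel d c a x * t d b x)
     - (\<Sum>d\<in>UNIV. christoffel d c b x * t a d x)"

definition cov3 :: "3 \<Rightarrow> tens3 \<Rightarrow> tens3" where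
  "cov3 c t e a b x = pd c (t e a b) x
     - (\<Sum>d\<in>UNIV. christoffel d c e x * t d a b x)
     - (\<Sum>d\<in>UNIV. christoffel d c a x * t e d b x)
     - (\<Sum>d\<in>UNIV. christoffel d c b x * t e a d x)"

definition grad :: "scal \<Rightarrow> tens1" where
  "grad f a x = pd a f x"

definition hess :: "scal \<Rightarrow> tens2" where
  "hess f a b x = cov1 b (grad f) a x"

definition trace2 :: "tens2 \<Rightarrow> scal" where
  "trace2 t x = (\<Sum>a\<in>UNIV. \<Sum>b\<in>UNIV. h0inv a b x * t a b x)"

definition grad_sq :: "scal \<Rightarrow> scal" where
  "grad_sq f x = trace2 (\<lambda>a b y. grad f a y * grad f b y) x"

definition div2 :: "tens2 \<Rightarrow> tens1" where
  "div2 t a x = (\<Sum>b\<in>UNIV. \<Sum>c\<in>UNIV. h0inv b c x * cov2 c t a b x)"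

definition box0 :: "scal \<Rightarrow> scal" where
  "box0 f x = trace2 (hess f) x"

definition box2 :: "tens2 \<Rightarrow> tens2" where
  "box2 t a b x =
     (\<Sum>c\<in>UNIV. \<Sum>d\<in>UNIV. h0inv c d x * cov3 c (\<lambda>e. cov2 e t) d a b x)"

text \<open>The determinant is the permutation symbol \<open>[abc]\<close> with \<open>[123] = 1\<close>.\<close>

definition eps :: tens3 where
  "eps a b c x =
     (cosh (x$1))\<^sup>2 * sin (x$2) * det (vector [axis a 1, axis b 1, axis c 1] :: real^3^3)"

text \<open>\<open>curl t a b\<close> is \<open>\<epsilon>\<^sub>a\<^sup>c\<^sup>d D\<^sub>c t\<^sub>d\<^sub>b\<close>.\<close>

definition curl :: "tens2 \<Rightarrow> tens2" where
  "curl t a b x =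
     (\<Sum>c\<in>UNIV. \<Sum>d\<in>UNIV. \<Sum>e\<in>UNIV. \<Sum>f\<in>UNIV.
        h0inv c e x * h0inv d f x * eps a e f x * cov2 c t d b x)"


subsection \<open>Field equations and Weyl tensor parts\<close>

definition asymptotic_vacuum :: "scal \<Rightarrow> tens2 \<Rightarrow> bool" where
  "asymptotic_vacuum s h \<longleftrightarrow> (\<forall>x\<in>chart.
     box0 s x + 3 * s x = 0 \<and>
     trace2 h x = 12 * (s x)\<^sup>2 + grad_sq s x \<and>
     (\<forall>a. div2 h a x = grad (\<lambda>y. grad_sq s y + 8 * (s y)\<^sup>2) a x) \<and>
     (\<forall>a b. box2 h a b x - 2 * h a b x =
        cov1 a (grad (\<lambda>y. 5 * (s y)\<^sup>2 + grad_sq s y)) b x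
        + h0 a b x * (- 18 * (s x)\<^sup>2 + 4 * grad_sq s x)
        + 4 * s x * hess s a b x))"

definition E1 :: "scal \<Rightarrow> tens2" where
  "E1 s a b x = - hess s a b x - s x * h0 a b x"

definition E2 :: "scal \<Rightarrow> tens2 \<Rightarrow> tens2" where
  "E2 s h a b x = - h a b x + 5 * (s x)\<^sup>2 * h0 a b x + s x * hess s a b x
     - 2 * grad s a x * grad s b x + grad_sq s x * h0 a b x"

definition B2 :: "scal \<Rightarrow> tens2 \<Rightarrow> tens2" where
  "B2 s h = curl (\<lambda>a b y. h a b y - 2 * (s y)\<^sup>2 * h0 a b y)"


subsection \<open>Killing vectors (contravariant components)\<close>

definition rot :: "3 \<Rightarrow> real^3 \<Rightarrow> real^3" where
  "rot i x = vector [0, (1 / sin (x$2)) * pd 3 (harm i) x, - (1 / sin (x$2)) * pd 2 (harm i) x]"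

definition boost :: "3 \<Rightarrow> real^3 \<Rightarrow> real^3" where
  "boost i x = harm i x *\<^sub>R axis 1 1 +
     (\<chi> a. cosh (x$1) * sinh (x$1) * (\<Sum>b\<in>UNIV. h0inv a b x * pd b (harm i) x))"


subsection \<open>Cuts and flux integrals\<close>

definition metric :: "real^3 \<Rightarrow> real^3 \<Rightarrow> real^3 \<Rightarrow> real" where
  "metric x u v = (\<Sum>a\<in>UNIV. \<Sum>b\<in>UNIV. h0 a b x * u$a * v$b)"

text \<open>A smooth spacelike Cauchy surface of \<open>\<real> \<times> S\<^sup>2\<close> is the graph \<open>\<tau> = T(\<omega>)\<close> of a smooth
  function on the sphere (the lines of constant \<open>\<omega>\<close> are inextendible timelike curves) whose
  tangent vectors \<open>(dT(v), v)\<close> are spacelike, and conversely. The differential of \<open>T\<close> at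
  \<open>\<omega> \<in> S\<^sup>2\<close> is taken through the radial extension \<open>x \<mapsto> T (x / |x|)\<close>.\<close>

definition cauchy_cut :: "(real^3 \<Rightarrow> real) \<Rightarrow> bool" where
  "cauchy_cut T \<longleftrightarrow> smooth_on (sphere 0 1) T \<and>
     (\<forall>w\<in>sphere 0 1. \<forall>v. v \<bullet> w = 0 \<and> v \<noteq> 0 \<longrightarrow>
        - (frechet_derivative (\<lambda>x. T (sgn x)) (at w) v)\<^sup>2 + (cosh (T w))\<^sup>2 * (v \<bullet> v) > 0)"

text \<open>Parametrization of the cut by \<open>y = (\<theta>, \<phi>)\<close>.\<close>

definition angles :: "(real \<times> real) set" where
  "angles = {0<..<pi} \<times> {0<..<2*pi}"

definition cut_pt :: "(real^3 \<Rightarrow> real) \<Rightarrow> real \<times> real \<Rightarrow> real^3" where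
  "cut_pt T y = vector [T (\<chi> i. harm i (vector [0, fst y, snd y])), fst y, snd y]"

definition cut_tan :: "(real^3 \<Rightarrow> real) \<Rightarrow> real \<times> real \<Rightarrow> real \<times> real \<Rightarrow> real^3" where
  "cut_tan T y w = frechet_derivative (cut_pt T) (at y) w"

definition unit_future_normal :: "(real^3 \<Rightarrow> real) \<Rightarrow> (real \<times> real \<Rightarrow> real^3) \<Rightarrow> bool" where
  "unit_future_normal T n \<longleftrightarrow> (\<forall>y\<in>angles.
     metric (cut_pt T y) (n y) (n y) = -1 \<and>
     (\<forall>w. metric (cut_pt T y) (n y) (cut_tan T y w) = 0) \<and>
     n y $ 1 > 0)"

text \<open>Square root of the determinant of the induced metric.\<close>

definition area_density :: "(real^3 \<Rightarrow> real) \<Rightarrow> real \<times> real \<Rightarrow> real" where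
  "area_density T y =
     (let q = (\<lambda>u v. metric (cut_pt T y) (cut_tan T y u) (cut_tan T y v))
      in sqrt (q (1,0) (1,0) * q (0,1) (0,1) - (q (1,0) (0,1))\<^sup>2))"

text \<open>The integral of \<open>t\<^sub>a\<^sub>b \<xi>\<^sup>a n\<^sup>b\<close> over the cut; the complement of \<open>angles\<close> in the sphere is a null set.\<close>

definition flux ::
    "(real^3 \<Rightarrow> real) \<Rightarrow> (real \<times> real \<Rightarrow> real^3) \<Rightarrow> tens2 \<Rightarrow> (real^3 \<Rightarrow> real^3) \<Rightarrow> real" where
  "flux T n t \<xi> = (LINT y:angles|lborel. area_density T y *
     (\<Sum>a\<in>UNIV. \<Sum>b\<in>UNIV. t a b (cut_pt T y) * \<xi> (cut_pt T y) $ a * n y $ b))"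

end

theory Submission
  imports Defs
begin

text \<open>
  Put \<open>k = h\<^sup>(\<^sup>2\<^sup>) - 2 \<sigma>\<^sup>2 h\<^sup>(\<^sup>0\<^sup>)\<close>, so that \<open>B = curl k\<close>. The field equations give
  \<open>D\<^sup>b k\<^sub>a\<^sub>b = D\<^sub>a (tr k)\<close>, which makes \<open>B\<close> symmetric (it is traceless because \<open>k\<close> is symmetric), and
  the Ricci identity on the hyperboloid gives
  \<open>(curl curl k)\<^sub>a\<^sub>b = \<box>k\<^sub>a\<^sub>b - D\<^sub>a D\<^sub>b (tr k) - 3 k\<^sub>a\<^sub>b + h\<^sup>(\<^sup>0\<^sup>)\<^sub>a\<^sub>b tr k\<close>, which the equation for
  \<open>\<box>h\<^sup>(\<^sup>2\<^sup>)\<close> turns into the local identity \<open>curl B = E\<^sup>(\<^sup>2\<^sup>) - \<sigma> E\<^sup>(\<^sup>1\<^sup>)\<close>.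

  The rotation and the boost with the same index are dual to each other:
  \<open>D\<^sub>a X\<^sub>b = \<epsilon>\<^sub>a\<^sub>b\<^sub>c Y\<^sup>c\<close> for \<open>(X, Y) = (rot, boost)\<close> and for \<open>(X, Y) = (boost, - rot)\<close>. For such a pair,
  \<open>(curl B)\<^sub>a\<^sub>b X\<^sup>b + B\<^sub>a\<^sub>b Y\<^sup>b\<close> is the curl of the one-form \<open>B\<^sub>a\<^sub>b X\<^sup>b\<close>, so its flux through a closed
  surface vanishes. The coordinate singularity at the poles is harmless because
  \<open>B\<^sub>a\<^sub>b X\<^sup>b\<close> is itself the dual of \<open>d (k\<^sub>a\<^sub>b X\<^sup>b)\<close> up to terms without derivatives of \<open>k\<close>, and
  \<open>k\<^sub>a\<^sub>b X\<^sup>b\<close> is the pullback of a smooth one-form on the ambient space.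
\<close>

subsection \<open>Calculus of \<open>C_on\<close>\<close>

text \<open>The coefficient \<open>2\<close> in \<open>k\<close> is forced. With
  \<open>r \<sigma>^2 h0\<close> subtracted instead, the trace would contain
  \<open>(12 - 3 r) \<sigma>^2\<close> and the potential of the divergence
  \<open>(8 - r) \<sigma>^2\<close>; the symmetry argument for the curl needs both to agree, which
  happens at \<open>r = 2\<close>. The obstacle that shapes the proof is the chart. The given fields
  are smooth on the sphere, but Christoffel symbols, curls and Killing components carry
  \<open>1 / sin \<theta>\<close>, so nothing shows directly that \<open>B X\<close> extends to
  \<theta> = 0 and \<theta> = \<pi>, as integration over the coordinate rectangle requires. Passing
  to \<open>k X\<close> puts all derivatives of \<open>k\<close> into an exterior derivative, which
  involves no connection and commutes with pullback from the ambient space; each remaining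
  \<open>1 / sin \<theta>\<close> then meets the \<open>sin \<theta>\<close> contained in the
  \<phi>-derivative of the embedding. A general cut costs little more than a round sphere: in the
  product of area density and unit normal the square root cancels, and the flux becomes the integral
  of a pulled-back two-form.\<close>

lemma C_on_cong_imp:
  assumes "open U" "\<And>x. x \<in> U \<Longrightarrow> f x = g x" "C_on k U f"
  shows "C_on k U g"
  using assms
proof (induction k arbitrary: f g)
  case 0 then show ?case by (simp cong: continuous_on_cong)
next
  case (Suc k)
  have fg: "(f has_derivative f') (at x) \<longleftrightarrow> (g has_derivative f') (at x)" if "x \<in> U" for x f'
    using has_derivative_transform_within_open[OF _ \<open>open U\<close> that]
      Suc.prems(2) by metis
  have "frechet_derivative f (at x) = frechet_derivative g (at x)" if "x \<in> U" for x
    using fg[OF that] unfolding frechet_derivative_def by presburger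
  then show ?case
    using Suc.prems Suc.IH[of "\<lambda>x. frechet_derivative f (at x) _" "\<lambda>x. frechet_derivative g (at x) _"] fg
    by (auto simp: differentiable_def)
qed

text \<open>\<open>smooth_on\<close> supplies a different extension around each point, so composites
  with such functions are first known to be smooth only near each point; this glues them.\<close>

lemma C_on_local:
  assumes "\<And>x. x \<in> U \<Longrightarrow> \<exists>V g. open V \<and> x \<in> V \<and> C_on k V g \<and> (\<forall>y\<in>V. g y = f y)"
  shows "C_on k U f"
  using assms
proof (induction k arbitrary: f)
  case 0
  have "isCont f x" if x: "x \<in> U" for x
  proof -
    obtain V g where V: "open V" "x \<in> V" "continuous_on V g" "\<forall>y\<in>V. g y = f y"
      using 0[OF x] by auto
    then have "continuous_on V f" by (simp cong: continuous_on_cong)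
    with V show ?thesis by (simp add: continuous_on_eq_continuous_at)
  qed
  then show ?case by (simp add: continuous_at_imp_continuous_on)
next
  case (Suc k)
  have loc: "\<exists>V. open V \<and> x \<in> V \<and> C_on (Suc k) V f" if x: "x \<in> U" for x
    using Suc.prems[OF x] C_on_cong_imp[of _ _ f "Suc k"] by blast
  have "f differentiable (at x)" if x: "x \<in> U" for x
    using loc[OF x] by auto
  moreover have "C_on k U (\<lambda>x. frechet_derivative f (at x) v)" for v
    using loc by (intro Suc.IH) fastforce
  ultimately show ?case by simp
qed

lemma C_on_subset: "C_on k U f \<Longrightarrow> V \<subseteq> U \<Longrightarrow> C_on k V f"
  by (induction k arbitrary: f) (auto intro: continuous_on_subset)

lemma C_on_Suc_imp: "C_on (Suc k) U f \<Longrightarrow> C_on k U f"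
proof (induction k arbitrary: f)
  case 0
  then show ?case
    by (auto intro!: continuous_at_imp_continuous_on differentiable_imp_continuous_within)
next
  case (Suc k)
  then show ?case by (metis C_on.simps(2))
qed

lemma C_on_continuous: "C_on k U f \<Longrightarrow> continuous_on U f"
  by (induction k) (simp, metis C_on_Suc_imp)

text \<open>Any explicit derivative may be used: by uniqueness it agrees on \<open>U\<close> with
  \<open>frechet_derivative\<close>, and openness carries the agreement over to higher
  derivatives.\<close>

lemma C_on_SucI:
  assumes "open U" "\<And>x. x \<in> U \<Longrightarrow> (f has_derivative D x) (at x)"
    and "\<And>v. C_on k U (\<lambda>x. D x v)"
  shows "C_on (Suc k) U f"
proof -
  have "D x v = frechet_derivative f (at x) v" if "x \<in> U" for x v
    using assms(2)[OF that] frechet_derivative_at by metis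
  then have "C_on k U (\<lambda>x. frechet_derivative f (at x) v)" for v
    by (intro C_on_cong_imp[OF assms(1) _ assms(3)[of v]])
  then show ?thesis using assms(2) by (auto simp: differentiable_def)
qed

lemma C_on_SucD:
  assumes "C_on (Suc k) U f" "x \<in> U"
  shows "(f has_derivative frechet_derivative f (at x)) (at x)"
  using assms by (simp add: frechet_derivative_works)

lemma C_on_const: "open U \<Longrightarrow> C_on k U (\<lambda>x. c)"
  by (induction k arbitrary: c) simp_all

lemma C_on_blinear:
  assumes "bounded_linear L" "open U" "C_on k U f"
  shows "C_on k U (\<lambda>x. L (f x))"
  using assms(3)
proof (induction k arbitrary: f)
  case 0 then show ?case by (simp add: bounded_linear.continuous_on[OF assms(1)])
next
  case (Suc k)
  show ?case
    by (rule C_on_SucI[where D = "\<lambda>x v. L (frechet_derivative f (at x) v)"])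
      (use Suc.prems in \<open>auto intro!: Suc.IH assms bounded_linear.has_derivative[OF assms(1)] C_on_SucD\<close>)
qed

lemma C_on_ident: "open U \<Longrightarrow> C_on k U (\<lambda>x. x)"
  by (cases k) (auto simp: C_on_const intro!: C_on_SucI[where D = "\<lambda>x v. v"])

lemma C_on_linear: "bounded_linear L \<Longrightarrow> open U \<Longrightarrow> C_on k U L"
  by (rule C_on_blinear[OF _ _ C_on_ident])

lemma C_on_add:
  assumes "open U" "C_on k U f" "C_on k U g"
  shows "C_on k U (\<lambda>x. f x + g x)"
  using assms(2,3)
proof (induction k arbitrary: f g)
  case 0 then show ?case by (simp add: continuous_on_add)
next
  case (Suc k)
  show ?case
    by (rule C_on_SucI[where D = "\<lambda>x v. frechet_derivative f (at x) v + frechet_derivative g (at x) v"])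
      (use Suc.prems in \<open>auto intro!: Suc.IH assms has_derivative_add C_on_SucD\<close>)
qed

lemma C_on_mult:
  fixes f g :: "_ \<Rightarrow> real"
  assumes "open U" "C_on k U f" "C_on k U g"
  shows "C_on k U (\<lambda>x. f x * g x)"
  using assms(2,3)
proof (induction k arbitrary: f g)
  case 0 then show ?case by (simp add: continuous_on_mult)
next
  case (Suc k)
  show ?case
    by (rule C_on_SucI[where D = "\<lambda>x v. f x * frechet_derivative g (at x) v + frechet_derivative f (at x) v * g x"])
      (use Suc.prems C_on_Suc_imp[OF Suc.prems(1)] C_on_Suc_imp[OF Suc.prems(2)] in
        \<open>auto intro!: Suc.IH C_on_add assms has_derivative_mult C_on_SucD\<close>)
qed

lemma C_on_sum:
  assumes "open U" "\<And>i. i \<in> I \<Longrightarrow> C_on k U (f i)"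
  shows "C_on k U (\<lambda>x. \<Sum>i\<in>I. f i x)"
  using assms(2)
  by (induction I rule: infinite_finite_induct) (auto intro!: C_on_const C_on_add assms(1))

lemma C_on_componentwise:
  fixes f :: "'a::euclidean_space \<Rightarrow> 'b::euclidean_space"
  assumes "open U" "\<And>b. b \<in> Basis \<Longrightarrow> C_on k U (\<lambda>x. f x \<bullet> b)"
  shows "C_on k U f"
proof -
  have "C_on k U (\<lambda>x. \<Sum>b\<in>Basis. (f x \<bullet> b) *\<^sub>R b)"
    using assms by (auto intro!: C_on_sum C_on_blinear[OF bounded_linear_scaleR_left])
  then show ?thesis by (simp add: euclidean_representation)
qed

lemma C_on_compose:
  fixes f :: "'b::euclidean_space \<Rightarrow> real" and g :: "'a::euclidean_space \<Rightarrow> 'b"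
  assumes "open U" "C_on k V f" "C_on k U g" "\<And>x. x \<in> U \<Longrightarrow> g x \<in> V"
  shows "C_on k U (\<lambda>x. f (g x))"
  using assms(2,3)
proof (induction k arbitrary: f)
  case 0 then show ?case using assms(4) by (auto intro!: continuous_on_compose2[of V f])
next
  case (Suc k)
  \<comment> \<open>The direction \<open>frechet_derivative g (at x) v\<close> moves with
    \<open>x\<close>. Expanded in \<open>Basis\<close> it leaves only derivatives of
    \<open>f\<close> in fixed directions, composed with the same \<open>g\<close>, and these are
    covered by the induction hypothesis.\<close>
  let ?D = "\<lambda>x v. \<Sum>b\<in>Basis. (frechet_derivative g (at x) v \<bullet> b) * frechet_derivative f (at (g x)) b"
  have "((\<lambda>x. f (g x)) has_derivative ?D x) (at x)" if x: "x \<in> U" for x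
  proof -
    have f: "(f has_derivative frechet_derivative f (at (g x))) (at (g x))"
      using C_on_SucD[OF Suc.prems(1)] assms(4) x by blast
    have 1: "((\<lambda>x. f (g x)) has_derivative (\<lambda>v. frechet_derivative f (at (g x)) (frechet_derivative g (at x) v))) (at x)"
      using has_derivative_compose[OF C_on_SucD[OF Suc.prems(2) x] f] .
    have D: "frechet_derivative f (at (g x)) w = (\<Sum>b\<in>Basis. (w \<bullet> b) * frechet_derivative f (at (g x)) b)" for w
      using Linear_Algebra.linear_componentwise[OF has_derivative_linear[OF f], of w 1] by simp
    have "(\<lambda>v. frechet_derivative f (at (g x)) (frechet_derivative g (at x) v)) = ?D x"
      by (rule ext) (rule D)
    then show ?thesis using 1 by metis
  qed
  moreover have "C_on k U (\<lambda>x. ?D x v)" for v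
  proof (intro C_on_sum C_on_mult assms(1))
    show "C_on k U (\<lambda>x. frechet_derivative g (at x) v \<bullet> b)" for b
      using Suc.prems(2) by (intro C_on_blinear[OF bounded_linear_inner_left assms(1)]) simp
    show "C_on k U (\<lambda>x. frechet_derivative f (at (g x)) b)" for b
      using Suc.prems(1) by (intro Suc.IH C_on_Suc_imp[OF Suc.prems(2)]) simp
  qed
  ultimately show ?case by (intro C_on_SucI assms(1)) auto
qed

section \<open>Smoothness of elementary functions\<close>

lemma C_on_trig:
  "C_on k UNIV (sin :: real \<Rightarrow> real)" "C_on k UNIV (cos :: real \<Rightarrow> real)"
  "C_on k UNIV (sinh :: real \<Rightarrow> real)" "C_on k UNIV (cosh :: real \<Rightarrow> real)"
proof -
  \<comment> \<open>A joint induction, since the derivative of each function is, up to sign, another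
    one in the list.\<close>
  have A: "C_on k UNIV (sin :: real \<Rightarrow> real) \<and> C_on k UNIV (cos :: real \<Rightarrow> real) \<and>
     C_on k UNIV (sinh :: real \<Rightarrow> real) \<and> C_on k UNIV (cosh :: real \<Rightarrow> real)"
  proof (induction k)
    case 0 then show ?case by (auto intro!: continuous_intros)
  next
    case (Suc k)
    have "C_on (Suc k) UNIV (sin :: real \<Rightarrow> real)"
      by (rule C_on_SucI[where D="\<lambda>x v. v * cos x"])
        (use Suc in \<open>auto intro!: derivative_eq_intros C_on_mult C_on_const\<close>)
    moreover have "C_on (Suc k) UNIV (cos :: real \<Rightarrow> real)"
      by (rule C_on_SucI[where D="\<lambda>x v. (-v) * sin x"], simp,
          force intro!: derivative_eq_intros, intro C_on_mult C_on_const, use Suc in auto)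
    moreover have "C_on (Suc k) UNIV (sinh :: real \<Rightarrow> real)"
      by (rule C_on_SucI[where D="\<lambda>x v. v * cosh x"])
        (use Suc in \<open>auto intro!: derivative_eq_intros C_on_mult C_on_const\<close>)
    moreover have "C_on (Suc k) UNIV (cosh :: real \<Rightarrow> real)"
      by (rule C_on_SucI[where D="\<lambda>x v. v * sinh x"])
        (use Suc in \<open>auto intro!: derivative_eq_intros C_on_mult C_on_const\<close>)
    ultimately show ?case by blast
  qed
  then show "C_on k UNIV (sin :: real \<Rightarrow> real)" "C_on k UNIV (cos :: real \<Rightarrow> real)"
  "C_on k UNIV (sinh :: real \<Rightarrow> real)" "C_on k UNIV (cosh :: real \<Rightarrow> real)" by auto
qed

lemma C_on_inverse_real: "C_on k {x::real. x \<noteq> 0} inverse"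
proof (induction k)
  case 0 then show ?case by (auto intro!: continuous_intros)
next
  case (Suc k)
  have o: "open {x::real. x \<noteq> 0}" by (rule open_delete[of UNIV 0, simplified, unfolded Compl_eq[symmetric]] open_Collect_neq continuous_intros)+
  show ?case
    by (rule C_on_SucI[OF o, where D="\<lambda>x v. -(inverse x * v * inverse x)"])
      (auto intro!: has_derivative_inverse' C_on_blinear[OF bounded_linear_minus[OF bounded_linear_ident] o] C_on_mult o Suc C_on_const)
qed

text \<open>The derivative is half of \<open>inverse\<close> after \<open>sqrt\<close>, so the next
  order follows from the order already reached and the smoothness of \<open>inverse\<close> away
  from zero.\<close>

lemma C_on_sqrt: "C_on k {0<..} (sqrt :: real \<Rightarrow> real)"
proof (induction k)
  case 0 then show ?case by (auto intro!: continuous_intros)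
next
  case (Suc k)
  have "C_on k {0<..} (\<lambda>x. inverse (sqrt x))"
    by (rule C_on_compose[OF _ C_on_inverse_real Suc]) auto
  then show ?case
    by (intro C_on_SucI[where D="\<lambda>x v. (v/2) * inverse (sqrt x)"] C_on_mult C_on_const)
      (auto intro!: derivative_eq_intros simp: field_simps)
qed

lemma C_on_inverse:
  fixes f :: "'a::euclidean_space \<Rightarrow> real"
  shows "open U \<Longrightarrow> C_on k U f \<Longrightarrow> (\<And>x. x \<in> U \<Longrightarrow> f x \<noteq> 0) \<Longrightarrow> C_on k U (\<lambda>x. inverse (f x))"
  by (rule C_on_compose[OF _ C_on_inverse_real]) auto

lemma C_on_minus: "open U \<Longrightarrow> C_on k U f \<Longrightarrow> C_on k U (\<lambda>x. - f x)"
  by (rule C_on_blinear[OF bounded_linear_minus[OF bounded_linear_ident]])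

lemma C_on_diff: "open U \<Longrightarrow> C_on k U f \<Longrightarrow> C_on k U g \<Longrightarrow> C_on k U (\<lambda>x. f x - g x)"
  using C_on_add[of U k f "\<lambda>x. - g x"] C_on_minus[of U k g] by simp

lemma C_on_power:
  fixes f :: "'a::euclidean_space \<Rightarrow> real"
  shows "open U \<Longrightarrow> C_on k U f \<Longrightarrow> C_on k U (\<lambda>x. f x ^ n)"
  by (induction n) (auto intro: C_on_const C_on_mult)

lemma C_on_divide:
  fixes f g :: "'a::euclidean_space \<Rightarrow> real"
  shows "open U \<Longrightarrow> C_on k U f \<Longrightarrow> C_on k U g \<Longrightarrow> (\<And>x. x \<in> U \<Longrightarrow> g x \<noteq> 0) \<Longrightarrow> C_on k U (\<lambda>x. f x / g x)"
  unfolding divide_inverse by (intro C_on_mult C_on_inverse)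

lemma C_on_trig_comp:
  fixes f :: "'a::euclidean_space \<Rightarrow> real"
  assumes "open U" "C_on k U f"
  shows "C_on k U (\<lambda>x. sin (f x))" "C_on k U (\<lambda>x. cos (f x))"
    "C_on k U (\<lambda>x. sinh (f x))" "C_on k U (\<lambda>x. cosh (f x))"
  by (rule C_on_compose[OF assms(1) C_on_trig(1) assms(2)] C_on_compose[OF assms(1) C_on_trig(2) assms(2)]
    C_on_compose[OF assms(1) C_on_trig(3) assms(2)] C_on_compose[OF assms(1) C_on_trig(4) assms(2)]; simp)+

lemma C_on_tanh:
  fixes f :: "'a::euclidean_space \<Rightarrow> real"
  assumes "open U" "C_on k U f"
  shows "C_on k U (\<lambda>x. tanh (f x))"
  unfolding tanh_def divide_inverse scaleR_conv_of_real
  by (intro C_on_mult C_on_inverse C_on_trig_comp assms) auto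

lemma C_on_nth:
  fixes f :: "'a::euclidean_space \<Rightarrow> real^'n"
  shows "open U \<Longrightarrow> C_on k U f \<Longrightarrow> C_on k U (\<lambda>x. f x $ i)"
  by (rule C_on_blinear[OF bounded_linear_vec_nth])

lemma C_on_vec:
  fixes f :: "'a::euclidean_space \<Rightarrow> real^'n"
  assumes "open U" "\<And>i. C_on k U (\<lambda>x. f x $ i)"
  shows "C_on k U f"
proof (rule C_on_componentwise[OF assms(1)])
  fix b :: "real^'n" assume "b \<in> Basis"
  then obtain i where "b = axis i 1" by (auto simp: Basis_vec_def)
  then show "C_on k U (\<lambda>x. f x \<bullet> b)" using assms(2)[of i] by (simp add: inner_axis)
qed

lemma C_on_fst: "open U \<Longrightarrow> C_on k U f \<Longrightarrow> C_on k U (\<lambda>x. fst (f x))"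
  by (rule C_on_blinear[OF bounded_linear_fst])

lemma C_on_snd: "open U \<Longrightarrow> C_on k U f \<Longrightarrow> C_on k U (\<lambda>x. snd (f x))"
  by (rule C_on_blinear[OF bounded_linear_snd])

lemma C_on_Pair:
  fixes f :: "'a::euclidean_space \<Rightarrow> 'b::euclidean_space" and g :: "'a \<Rightarrow> 'c::euclidean_space"
  assumes "open U" "C_on k U f" "C_on k U g"
  shows "C_on k U (\<lambda>x. (f x, g x))"
proof (rule C_on_componentwise[OF assms(1)])
  fix b :: "'b \<times> 'c"
  have "C_on k U (\<lambda>x. f x \<bullet> fst b + g x \<bullet> snd b)"
    by (intro C_on_add assms C_on_blinear[OF bounded_linear_inner_left])
  then show "C_on k U (\<lambda>x. (f x, g x) \<bullet> b)" by (cases b) simp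
qed

text \<open>Serves the radial retraction onto the unit sphere. The norm is the square root of a
  positive inner product, where \<open>sqrt\<close> is smooth.\<close>

lemma C_on_sgn:
  fixes f :: "'a::euclidean_space \<Rightarrow> 'b::euclidean_space"
  assumes "open U" "C_on k U f" "\<And>x. x \<in> U \<Longrightarrow> f x \<noteq> 0"
  shows "C_on k U (\<lambda>x. sgn (f x))"
proof (rule C_on_componentwise[OF assms(1)])
  fix b :: 'b assume b: "b \<in> Basis"
  have "C_on k U (\<lambda>x. \<Sum>b\<in>Basis. (f x \<bullet> b) * (f x \<bullet> b))"
    by (intro C_on_sum C_on_mult assms C_on_blinear[OF bounded_linear_inner_left])
  then have i: "C_on k U (\<lambda>x. f x \<bullet> f x)"
    by (simp add: euclidean_inner[symmetric])
  have "C_on k U (\<lambda>x. sqrt (f x \<bullet> f x))"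
    by (rule C_on_compose[OF assms(1) C_on_sqrt i]) (use assms(3) in auto)
  then have n: "C_on k U (\<lambda>x. norm (f x))" by (simp add: norm_eq_sqrt_inner)
  have "C_on k U (\<lambda>x. inverse (norm (f x)) * (f x \<bullet> b))"
    by (intro C_on_mult C_on_inverse n assms C_on_blinear[OF bounded_linear_inner_left]) (use assms(3) in auto)
  then show "C_on k U (\<lambda>x. sgn (f x) \<bullet> b)" by (simp add: sgn_div_norm)
qed

lemmas C_on_intros = C_on_const C_on_add C_on_diff C_on_minus C_on_mult C_on_sum C_on_power
  C_on_trig_comp C_on_tanh C_on_nth C_on_fst C_on_snd C_on_Pair C_on_ident

text \<open>Schwarz's theorem. The second difference over a parallelogram with sides
  \<open>h u\<close> and \<open>h v\<close> does not depend on the order of the sides; two mean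
  value theorems write it as \<open>h * h\<close> times either mixed derivative at a nearby point,
  and continuity at \<open>x\<close> identifies the limits.\<close>

lemma frechet_derivative_symmetric:
  fixes f :: "'a::euclidean_space \<Rightarrow> real"
  assumes U: "open U" "x \<in> U" and f: "C_on 2 U f"
  shows "frechet_derivative (\<lambda>y. frechet_derivative f (at y) u) (at x) v
       = frechet_derivative (\<lambda>y. frechet_derivative f (at y) v) (at x) u"
proof -
  define F where "F u y = frechet_derivative f (at y) u" for u y
  define FF where "FF u v y = frechet_derivative (F u) (at y) v" for u v y
  obtain e0 where e0: "e0 > 0" "ball x e0 \<subseteq> U"
    using U openE by blast
  have f1: "(f has_derivative (\<lambda>u. F u y)) (at y)" if "y \<in> U" for y
    unfolding F_def using C_on_SucD[of 1 U f y] f that by (simp add: numeral_2_eq_2)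
  have CF: "C_on (Suc 0) U (F u)" for u
    using f by (simp add: numeral_2_eq_2 F_def[abs_def])
  have f2: "(F u has_derivative (\<lambda>v. FF u v y)) (at y)" if "y \<in> U" for u y
    unfolding FF_def using C_on_SucD[OF CF that] .
  have cF: "continuous_on U (FF u v)" for u v
    using CF[of u] by (simp add: FF_def[abs_def])
  \<comment> \<open>The bound on \<open>h\<close> keeps the whole parallelogram in a ball inside
    \<open>U\<close>.\<close>
  have mv: "\<exists>s t. 0 < s \<and> s < h \<and> 0 < t \<and> t < h \<and>
     f (x + h *\<^sub>R u + h *\<^sub>R v) - f (x + h *\<^sub>R u) - f (x + h *\<^sub>R v) + f x = h * h * FF u v (x + s *\<^sub>R u + t *\<^sub>R v)"
    if h: "0 < h" "h * (norm u + norm v) < e0" for h u v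
  proof -
    have inU: "x + s *\<^sub>R u + t *\<^sub>R v \<in> U" if "0 \<le> s" "s \<le> h" "0 \<le> t" "t \<le> h" for s t
    proof -
      have "norm (s *\<^sub>R u + t *\<^sub>R v) \<le> s * norm u + t * norm v"
        using that by (intro norm_triangle_le) auto
      also have "\<dots> \<le> h * norm u + h * norm v"
        using that by (intro add_mono mult_right_mono) auto
      also have "\<dots> < e0" using h by (simp add: algebra_simps)
      finally have "dist x (x + s *\<^sub>R u + t *\<^sub>R v) < e0"
        by (simp add: dist_norm norm_minus_commute algebra_simps)
      then show ?thesis using e0 by auto
    qed
    \<comment> \<open>The increment of \<phi> from \<open>0\<close> to \<open>h\<close> is the
      second difference. Its derivative is itself an increment of \<open>F u\<close> along
      \<open>v\<close>, to which the mean value theorem is applied once more through \<psi>.\<close>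
    define \<phi> where "\<phi> s = f (x + s *\<^sub>R u + h *\<^sub>R v) - f (x + s *\<^sub>R u + 0 *\<^sub>R v)" for s
    have d\<phi>: "DERIV \<phi> s :> F u (x + s *\<^sub>R u + h *\<^sub>R v) - F u (x + s *\<^sub>R u + 0 *\<^sub>R v)" if "0 \<le> s" "s \<le> h" for s
    proof -
      have g: "((\<lambda>s. x + s *\<^sub>R u + t *\<^sub>R v) has_derivative (\<lambda>d. d *\<^sub>R u)) (at s)" for t
        by (auto intro!: derivative_eq_intros)
      have "((\<lambda>s. f (x + s *\<^sub>R u + t *\<^sub>R v)) has_derivative (\<lambda>d. F (d *\<^sub>R u) (x + s *\<^sub>R u + t *\<^sub>R v))) (at s)"
        if "0 \<le> t" "t \<le> h" for t
        using has_derivative_compose[OF g f1] inU that \<open>0 \<le> s\<close> \<open>s \<le> h\<close> by blast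
      moreover have "F (d *\<^sub>R u) (x + s *\<^sub>R u + t *\<^sub>R v) = d * F u (x + s *\<^sub>R u + t *\<^sub>R v)" if "0 \<le> t" "t \<le> h" for t d
        using linear_scale[OF has_derivative_linear[OF f1[OF inU]]] that \<open>0 \<le> s\<close> \<open>s \<le> h\<close> by simp
      ultimately have "((\<lambda>s. f (x + s *\<^sub>R u + t *\<^sub>R v)) has_derivative (\<lambda>d. d * F u (x + s *\<^sub>R u + t *\<^sub>R v))) (at s)"
        if "0 \<le> t" "t \<le> h" for t using that by auto
      from this[of h] this[of 0] h show ?thesis
        unfolding \<phi>_def has_field_derivative_def
        by (intro has_derivative_eq_rhs[OF has_derivative_diff]) (auto simp: fun_eq_iff algebra_simps)
    qed
    obtain s where s: "0 < s" "s < h" "\<phi> h - \<phi> 0 = h * (F u (x + s *\<^sub>R u + h *\<^sub>R v) - F u (x + s *\<^sub>R u + 0 *\<^sub>R v))"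
      using MVT2[OF h(1) d\<phi>] by auto
    define \<psi> where "\<psi> t = F u (x + s *\<^sub>R u + t *\<^sub>R v)" for t
    have d\<psi>: "DERIV \<psi> t :> FF u v (x + s *\<^sub>R u + t *\<^sub>R v)" if "0 \<le> t" "t \<le> h" for t
    proof -
      have g: "((\<lambda>t. x + s *\<^sub>R u + t *\<^sub>R v) has_derivative (\<lambda>d. d *\<^sub>R v)) (at t)"
        by (auto intro!: derivative_eq_intros)
      have y: "x + s *\<^sub>R u + t *\<^sub>R v \<in> U" using inU s that by simp
      have "(\<psi> has_derivative (\<lambda>d. FF u (d *\<^sub>R v) (x + s *\<^sub>R u + t *\<^sub>R v))) (at t)"
        unfolding \<psi>_def using has_derivative_compose[OF g f2[OF y]] .
      moreover have "FF u (d *\<^sub>R v) (x + s *\<^sub>R u + t *\<^sub>R v) = d * FF u v (x + s *\<^sub>R u + t *\<^sub>R v)" for d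
        using linear_scale[OF has_derivative_linear[OF f2[OF y]]] by simp
      ultimately show ?thesis unfolding has_field_derivative_def by (simp add: mult_commute_abs)
    qed
    obtain t where t: "0 < t" "t < h" "\<psi> h - \<psi> 0 = h * FF u v (x + s *\<^sub>R u + t *\<^sub>R v)"
      using MVT2[OF h(1) d\<psi>] by auto
    show ?thesis
      using s t unfolding \<phi>_def \<psi>_def by (intro exI[of _ s] exI[of _ t]) (simp add: algebra_simps)
  qed
  have lim: "(\<lambda>n. FF u v (x + s n *\<^sub>R u + t n *\<^sub>R v)) \<longlonglongrightarrow> FF u v x"
    if "\<And>n. 0 < s n \<and> s n < c / real (Suc n)" "\<And>n. 0 < t n \<and> t n < c / real (Suc n)" for s t u v c
  proof -
    have 0: "(\<lambda>n. c / real (Suc n)) \<longlonglongrightarrow> 0" using LIMSEQ_Suc[OF lim_const_over_n] by blast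
    have "s \<longlonglongrightarrow> 0" "t \<longlonglongrightarrow> 0"
      by (rule tendsto_sandwich[OF _ _ tendsto_const 0]; use that in \<open>auto intro!: always_eventually less_imp_le\<close>)+
    then have "(\<lambda>n. x + s n *\<^sub>R u + t n *\<^sub>R v) \<longlonglongrightarrow> x + 0 *\<^sub>R u + 0 *\<^sub>R v"
      by (intro tendsto_intros)
    moreover have "isCont (FF u v) x" using cF U continuous_on_eq_continuous_at by blast
    ultimately show ?thesis using isCont_tendsto_compose[of x "FF u v"] by simp
  qed
  \<comment> \<open>Largest size used: the parallelogram stays in the ball of radius
    \<open>e0\<close>, and the \<open>+ 1\<close> keeps the denominator positive when both
    directions vanish.\<close>
  define c where "c = e0 / (2 * (norm u + norm v + 1))"
  have c: "c > 0" "c * (norm u + norm v) < e0"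
  proof -
    have p: "norm u + norm v + 1 > 0" by (smt (verit) norm_ge_zero)
    then show "c > 0" using e0 by (simp add: c_def)
    have "c * (norm u + norm v) \<le> c * (norm u + norm v + 1)" using \<open>c > 0\<close> by simp
    also have "\<dots> = e0 / 2" using p by (simp add: c_def field_simps)
    finally show "c * (norm u + norm v) < e0" using e0 by simp
  qed
  have hn: "0 < c / real (Suc n)" "c / real (Suc n) * (norm u + norm v) < e0" "c / real (Suc n) * (norm v + norm u) < e0" for n
  proof -
    show "0 < c / real (Suc n)" using c by simp
    have "c / real (Suc n) \<le> c" using c by (simp add: field_simps)
    then have "c / real (Suc n) * (norm u + norm v) \<le> c * (norm u + norm v)" by (intro mult_right_mono) auto
    then show "c / real (Suc n) * (norm u + norm v) < e0" "c / real (Suc n) * (norm v + norm u) < e0"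
      using c by (auto simp: add.commute)
  qed
  have "\<exists>s t s' t'. 0 < s \<and> s < h \<and> 0 < t \<and> t < h \<and> 0 < s' \<and> s' < h \<and> 0 < t' \<and> t' < h \<and>
      FF u v (x + s *\<^sub>R u + t *\<^sub>R v) = FF v u (x + s' *\<^sub>R v + t' *\<^sub>R u)" if h: "h = c / real (Suc n)" for n h
  proof -
    obtain s t where st: "0 < s" "s < h" "0 < t" "t < h"
     "f (x + h *\<^sub>R u + h *\<^sub>R v) - f (x + h *\<^sub>R u) - f (x + h *\<^sub>R v) + f x = h * h * FF u v (x + s *\<^sub>R u + t *\<^sub>R v)"
      using mv[of h u v] hn[of n] h by auto
    obtain s' t' where st': "0 < s'" "s' < h" "0 < t'" "t' < h"
     "f (x + h *\<^sub>R v + h *\<^sub>R u) - f (x + h *\<^sub>R v) - f (x + h *\<^sub>R u) + f x = h * h * FF v u (x + s' *\<^sub>R v + t' *\<^sub>R u)"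
      using mv[of h v u] hn[of n] h by auto
    have "f (x + h *\<^sub>R v + h *\<^sub>R u) = f (x + h *\<^sub>R u + h *\<^sub>R v)" by (simp add: add_ac)
    then have "h * h * FF u v (x + s *\<^sub>R u + t *\<^sub>R v) = h * h * FF v u (x + s' *\<^sub>R v + t' *\<^sub>R u)"
      using st(5) st'(5) by linarith
    then show ?thesis using st st' by auto
  qed
  then have "\<forall>n. \<exists>s t s' t'. 0 < s \<and> s < c / real (Suc n) \<and> 0 < t \<and> t < c / real (Suc n)
      \<and> 0 < s' \<and> s' < c / real (Suc n) \<and> 0 < t' \<and> t' < c / real (Suc n) \<and>
      FF u v (x + s *\<^sub>R u + t *\<^sub>R v) = FF v u (x + s' *\<^sub>R v + t' *\<^sub>R u)" by blast
  then obtain s t s' t' where st: "\<And>n. 0 < s n \<and> s n < c / real (Suc n)" "\<And>n. 0 < t n \<and> t n < c / real (Suc n)"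
      "\<And>n. 0 < s' n \<and> s' n < c / real (Suc n)" "\<And>n. 0 < t' n \<and> t' n < c / real (Suc n)"
      "\<And>n. FF u v (x + s n *\<^sub>R u + t n *\<^sub>R v) = FF v u (x + s' n *\<^sub>R v + t' n *\<^sub>R u)"
    by metis
  have "FF u v x = FF v u x"
    using LIMSEQ_unique[OF lim[OF st(1,2), of u v]] lim[OF st(3,4), of v u] st(5) by simp
  then show ?thesis by (simp add: FF_def F_def[abs_def])
qed

subsection \<open>Partial derivatives\<close>

lemma pd_eqI: "(f has_derivative f') (at x) \<Longrightarrow> pd a f x = f' (axis a 1)"
  unfolding pd_def using frechet_derivative_at by metis

lemma pd_cong:
  assumes "open U" "x \<in> U" "\<And>y. y \<in> U \<Longrightarrow> f y = g y"
  shows "pd a f x = pd a g x"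
proof -
  have "(f has_derivative f') (at x) \<longleftrightarrow> (g has_derivative f') (at x)" for f'
    using has_derivative_transform_within_open[OF _ assms(1,2)] assms(3) by metis
  then show ?thesis by (simp add: pd_def frechet_derivative_def)
qed

lemma C_on_pd: "C_on (Suc k) U f \<Longrightarrow> C_on k U (pd a f)"
  unfolding pd_def[abs_def] by simp

lemma C_on_differentiable: "\<forall>k. C_on k U f \<Longrightarrow> x \<in> U \<Longrightarrow> f differentiable (at x)"
  using C_on.simps(2)[of 0 U f] by blast

lemma pd_const [simp]: "pd a (\<lambda>x. c) x = 0"
  unfolding pd_def by simp

lemma pd_add: "f differentiable (at x) \<Longrightarrow> g differentiable (at x) \<Longrightarrow> pd a (\<lambda>x. f x + g x) x = pd a f x + pd a g x"
  using pd_eqI[OF has_derivative_add[of f "frechet_derivative f (at x)" "at x" g "frechet_derivative g (at x)"], of a]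
  by (simp add: pd_def frechet_derivative_works[symmetric])

lemma pd_diff: "f differentiable (at x) \<Longrightarrow> g differentiable (at x) \<Longrightarrow> pd a (\<lambda>x. f x - g x) x = pd a f x - pd a g x"
  using pd_eqI[OF has_derivative_diff[of f "frechet_derivative f (at x)" "at x" g "frechet_derivative g (at x)"], of a]
  by (simp add: pd_def frechet_derivative_works[symmetric])

lemma pd_mult:
  fixes f g :: "real^3 \<Rightarrow> real"
  assumes "f differentiable (at x)" "g differentiable (at x)"
  shows "pd a (\<lambda>x. f x * g x) x = pd a f x * g x + f x * pd a g x"
  using pd_eqI[OF has_derivative_mult[OF assms[unfolded frechet_derivative_works]], of a]
  by (simp add: pd_def)

lemma pd_sum:
  assumes "\<And>i. i \<in> I \<Longrightarrow> f i differentiable (at x)"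
  shows "pd a (\<lambda>x. \<Sum>i\<in>I. f i x) x = (\<Sum>i\<in>I. pd a (f i) x)"
  using pd_eqI[OF has_derivative_sum[of I f "\<lambda>i. frechet_derivative (f i) (at x)" "at x"], of a] assms
  by (simp add: pd_def frechet_derivative_works[symmetric])

lemma pd_comm:
  fixes f :: "real^3 \<Rightarrow> real"
  assumes "open U" "x \<in> U" "C_on 2 U f"
  shows "pd a (pd b f) x = pd b (pd a f) x"
  unfolding pd_def[abs_def] using frechet_derivative_symmetric[OF assms] .

lemma pd_compose:
  assumes "(f has_derivative f') (at (g x))" "g differentiable (at x)"
  shows "pd a (\<lambda>x. f (g x)) x = f' (pd a g x)"
  using pd_eqI[OF has_derivative_compose[OF assms(2)[unfolded frechet_derivative_works] assms(1)], of a]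
  by (simp add: pd_def)

section \<open>Smooth functions on the coordinate chart\<close>

lemma open_chart: "open chart"
  unfolding chart_def
  by (intro open_Collect_conj open_Collect_less continuous_intros)

definition smooth_chart :: "scal \<Rightarrow> bool" where
  "smooth_chart f \<longleftrightarrow> (\<forall>k. C_on k chart f)"

lemma smooth_chart_differentiable: "smooth_chart f \<Longrightarrow> x \<in> chart \<Longrightarrow> f differentiable (at x)"
  unfolding smooth_chart_def by (rule C_on_differentiable)

lemma smooth_chart_pd: "smooth_chart f \<Longrightarrow> smooth_chart (pd a f)"
  unfolding smooth_chart_def using C_on_pd by blast

lemma smooth_chart_cong: "smooth_chart f \<Longrightarrow> (\<And>x. x \<in> chart \<Longrightarrow> f x = g x) \<Longrightarrow> smooth_chart g"
  unfolding smooth_chart_def using C_on_cong_imp[OF open_chart] by blast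

lemma smooth_chart_intros:
  "smooth_chart (\<lambda>x. c)"
  "smooth_chart f \<Longrightarrow> smooth_chart g \<Longrightarrow> smooth_chart (\<lambda>x. f x + g x)"
  "smooth_chart f \<Longrightarrow> smooth_chart g \<Longrightarrow> smooth_chart (\<lambda>x. f x - g x)"
  "smooth_chart f \<Longrightarrow> smooth_chart (\<lambda>x. - f x)"
  "smooth_chart f \<Longrightarrow> smooth_chart g \<Longrightarrow> smooth_chart (\<lambda>x. f x * g x)"
  "smooth_chart f \<Longrightarrow> smooth_chart g \<Longrightarrow> (\<And>x. x \<in> chart \<Longrightarrow> g x \<noteq> 0) \<Longrightarrow> smooth_chart (\<lambda>x. f x / g x)"
  "smooth_chart f \<Longrightarrow> smooth_chart (\<lambda>x. f x ^ n)"
  "(\<And>i. i \<in> I \<Longrightarrow> smooth_chart (F i)) \<Longrightarrow> smooth_chart (\<lambda>x. \<Sum>i\<in>I. F i x)"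
  "smooth_chart f \<Longrightarrow> smooth_chart (\<lambda>x. sin (f x))"
  "smooth_chart f \<Longrightarrow> smooth_chart (\<lambda>x. cos (f x))"
  "smooth_chart f \<Longrightarrow> smooth_chart (\<lambda>x. sinh (f x))"
  "smooth_chart f \<Longrightarrow> smooth_chart (\<lambda>x. cosh (f x))"
  "smooth_chart (\<lambda>x. x $ i)"
  unfolding smooth_chart_def
  by (auto intro!: C_on_intros C_on_divide open_chart)

lemma smooth_chart_pd_comm: "smooth_chart f \<Longrightarrow> x \<in> chart \<Longrightarrow> pd a (pd b f) x = pd b (pd a f) x"
  unfolding smooth_chart_def using pd_comm[OF open_chart] by blast

lemma chart_sin: "x \<in> chart \<Longrightarrow> sin (x$2) > 0"
  unfolding chart_def by (auto intro: sin_gt_zero)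

subsection \<open>The Levi-Civita connection\<close>

lemma h0_simps [simp]:
  "h0 1 1 x = - 1" "h0 2 2 x = (cosh (x$1))^2" "h0 3 3 x = (cosh (x$1))^2 * (sin (x$2))^2"
  "a \<noteq> b \<Longrightarrow> h0 a b x = 0"
  by (simp_all add: h0_def)

lemma smooth_chart_h0: "smooth_chart (h0 a b)"
proof -
  have "a \<noteq> b \<Longrightarrow> h0 a b = (\<lambda>x. 0)" "h0 1 1 = (\<lambda>x. -1)" "h0 2 2 = (\<lambda>x. (cosh (x$1))^2)"
    "h0 3 3 = (\<lambda>x. (cosh (x$1))^2 * (sin (x$2))^2)"
    by (simp_all add: fun_eq_iff)
  then show ?thesis
    using exhaust_3[of a] by (cases "a = b") (auto intro!: smooth_chart_intros)
qed

text \<open>\<open>matrix_inv\<close> is a choice among two-sided inverses. On \<open>chart\<close>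
  the diagonal entries are nonzero because \<open>sin \<theta>\<close> is positive, so the diagonal
  candidate is an inverse, and inverses are unique.\<close>

lemma h0inv_eq:
  assumes "x \<in> chart"
  shows "h0inv a b x = (if a = b then 1 / h0 a a x else 0)"
proof -
  let ?A = "(\<chi> i j. h0 i j x) :: real^3^3"
  let ?B = "(\<chi> i j. if i = j then 1 / h0 i i x else 0) :: real^3^3"
  have nz: "h0 i i x \<noteq> 0" for i
    using exhaust_3[of i] chart_sin[OF assms] by auto
  have "?A $ i $ j = (if i = j then h0 i i x else 0)" for i j by simp
  then have "?A = (\<chi> i j. if i = j then h0 i i x else 0)" by (simp add: vec_eq_iff)
  then have AB: "?A ** ?B = mat 1" "?B ** ?A = mat 1"
    using nz by (auto simp: matrix_matrix_mult_def mat_def vec_eq_iff if_distrib if_distribR cong: if_cong)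
  have "matrix_inv ?A = ?B"
    using someI_ex[of "\<lambda>A'. ?A ** A' = mat 1 \<and> A' ** ?A = mat 1"] AB
    unfolding matrix_inv_def by (metis (no_types, lifting) matrix_mul_assoc matrix_mul_lid matrix_mul_rid)
  then show ?thesis by (simp add: h0inv_def)
qed

lemma h0inv_simps:
  assumes "x \<in> chart"
  shows "h0inv 1 1 x = - 1" "h0inv 2 2 x = 1 / (cosh (x$1))^2" "h0inv 3 3 x = 1 / ((cosh (x$1))^2 * (sin (x$2))^2)"
    "a \<noteq> b \<Longrightarrow> h0inv a b x = 0"
  by (simp_all add: h0inv_eq[OF assms])

text \<open>Because the metric is diagonal, every contraction with \<open>h0inv\<close> collapses on
  \<open>chart\<close> to a single sum weighted by these entries.\<close>

definition diag_inv :: "3 \<Rightarrow> scal" where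
  "diag_inv a x = 1 / h0 a a x"

lemma diag_inv_simps [simp]:
  "diag_inv 1 x = - 1" "diag_inv 2 x = 1 / (cosh (x$1))^2" "diag_inv 3 x = 1 / ((cosh (x$1))^2 * (sin (x$2))^2)"
  by (simp_all add: diag_inv_def)

lemma sum_h0inv:
  assumes "x \<in> chart"
  shows "(\<Sum>a\<in>UNIV. \<Sum>b\<in>UNIV. h0inv a b x * f a b) = (\<Sum>a\<in>UNIV. diag_inv a x * f a a)"
  by (simp add: h0inv_eq[OF assms] diag_inv_def if_distrib if_distribR cong: if_cong)

lemma has_derivative_cosh [derivative_intros]:
  fixes g :: "'a::real_normed_vector \<Rightarrow> real"
  shows "(g has_derivative g') (at x within s) \<Longrightarrow> ((\<lambda>x. cosh (g x)) has_derivative (\<lambda>v. g' v * sinh (g x))) (at x within s)"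
  using DERIV_compose_FDERIV[OF has_field_derivative_cosh[OF DERIV_ident]] by simp

lemma has_derivative_sinh [derivative_intros]:
  fixes g :: "'a::real_normed_vector \<Rightarrow> real"
  shows "(g has_derivative g') (at x within s) \<Longrightarrow> ((\<lambda>x. sinh (g x)) has_derivative (\<lambda>v. g' v * cosh (g x))) (at x within s)"
  using DERIV_compose_FDERIV[OF has_field_derivative_sinh[OF DERIV_ident]] by simp

lemma has_derivative_coord: "((\<lambda>x::real^3. x $ i) has_derivative (\<lambda>v. v $ i)) (at x)"
  by (rule bounded_linear.has_derivative[OF bounded_linear_vec_nth has_derivative_ident])

lemma axis_3_simps [simp]:
  "axis 1 1 $ (1::3) = (1::real)" "axis 2 1 $ (2::3) = (1::real)" "axis 3 1 $ (3::3) = (1::real)"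
  "axis 1 1 $ (2::3) = (0::real)" "axis 1 1 $ (3::3) = (0::real)" "axis 2 1 $ (1::3) = (0::real)"
  "axis 2 1 $ (3::3) = (0::real)" "axis 3 1 $ (1::3) = (0::real)" "axis 3 1 $ (2::3) = (0::real)"
  by (simp_all add: axis_def)

lemma pd_h0:
  "pd a (h0 b c) x = (if b \<noteq> c then 0
     else if b = 2 \<and> a = 1 then 2 * cosh (x$1) * sinh (x$1)
     else if b = 3 \<and> a = 1 then 2 * cosh (x$1) * sinh (x$1) * (sin (x$2))^2
     else if b = 3 \<and> a = 2 then 2 * (cosh (x$1))^2 * sin (x$2) * cos (x$2) else 0)"
proof -
  have 1: "pd a (h0 1 1) x = 0" for a unfolding h0_def[abs_def] by simp
  have 2: "pd a (h0 2 2) x = 2 * cosh (x$1) * sinh (x$1) * axis a 1 $ 1" for a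
    unfolding h0_def[abs_def]
    by (rule trans, rule pd_eqI) (auto intro!: derivative_eq_intros has_derivative_coord simp: mult_ac)
  have 3: "pd a (h0 3 3) x = 2 * cosh (x$1) * sinh (x$1) * (sin (x$2))^2 * axis a 1 $ 1
      + 2 * (cosh (x$1))^2 * sin (x$2) * cos (x$2) * axis a 1 $ 2" for a
    unfolding h0_def[abs_def]
    by (rule trans, rule pd_eqI) (auto intro!: derivative_eq_intros has_derivative_coord simp: algebra_simps)
  have 4: "b \<noteq> c \<Longrightarrow> pd a (h0 b c) x = 0" unfolding h0_def[abs_def] by simp
  show ?thesis
  proof (cases "b = c")
    case True
    show ?thesis unfolding True[symmetric]
      using exhaust_3[of a] exhaust_3[of b] by (elim disjE; hypsubst) (simp_all add: 1 2 3)
  next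
    case False
    then show ?thesis using 4 by simp
  qed
qed

lemma christoffel_eq:
  assumes "x \<in> chart"
  shows "christoffel c a b x =
   (if c = 1 then (if a = 2 \<and> b = 2 then cosh (x$1) * sinh (x$1)
       else if a = 3 \<and> b = 3 then cosh (x$1) * sinh (x$1) * (sin (x$2))^2 else 0)
    else if c = 2 then (if a = 1 \<and> b = 2 \<or> a = 2 \<and> b = 1 then sinh (x$1) / cosh (x$1)
       else if a = 3 \<and> b = 3 then - (sin (x$2) * cos (x$2)) else 0)
    else (if a = 1 \<and> b = 3 \<or> a = 3 \<and> b = 1 then sinh (x$1) / cosh (x$1)
       else if a = 2 \<and> b = 3 \<or> a = 3 \<and> b = 2 then cos (x$2) / sin (x$2) else 0))"
proof -
  have s: "sin (x$2) \<noteq> 0" using chart_sin[OF assms] by simp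
  show ?thesis
    unfolding christoffel_def sum_3 pd_h0
    using exhaust_3[of c] exhaust_3[of a] exhaust_3[of b] s
    by (elim disjE; simp add: h0inv_simps[OF assms] power2_eq_square field_simps)
qed

lemma christoffel_sym: "x \<in> chart \<Longrightarrow> christoffel c a b x = christoffel c b a x"
  by (simp add: christoffel_eq conj_commute disj_commute)

lemma smooth_chart_christoffel: "smooth_chart (christoffel c a b)"
proof (rule smooth_chart_cong[OF _ christoffel_eq[symmetric]])
  have if_rule: "smooth_chart f \<Longrightarrow> smooth_chart g \<Longrightarrow> smooth_chart (\<lambda>x. if P then f x else g x)" for f g P
    by (cases P) auto
  show "smooth_chart (\<lambda>x. if c = 1 then (if a = 2 \<and> b = 2 then cosh (x$1) * sinh (x$1)
       else if a = 3 \<and> b = 3 then cosh (x$1) * sinh (x$1) * (sin (x$2))^2 else 0)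
    else if c = 2 then (if a = 1 \<and> b = 2 \<or> a = 2 \<and> b = 1 then sinh (x$1) / cosh (x$1)
       else if a = 3 \<and> b = 3 then - (sin (x$2) * cos (x$2)) else 0)
    else (if a = 1 \<and> b = 3 \<or> a = 3 \<and> b = 1 then sinh (x$1) / cosh (x$1)
       else if a = 2 \<and> b = 3 \<or> a = 3 \<and> b = 2 then cos (x$2) / sin (x$2) else 0))"
    by (intro if_rule smooth_chart_intros)
      (use chart_sin in force)+
qed

section \<open>Curvature of de Sitter space\<close>

lemma pd_if: "pd d (\<lambda>x. if P then f x else g x) x = (if P then pd d f x else pd d g x)"
  by (cases P) auto

lemma pd_christoffel:
  assumes x: "x \<in> chart"
  shows "pd d (christoffel c a b) x =
   (if c = 1 then (if a = 2 \<and> b = 2 then (if d = 1 then (cosh (x$1))^2 + (sinh (x$1))^2 else 0)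
       else if a = 3 \<and> b = 3 then (if d = 1 then ((cosh (x$1))^2 + (sinh (x$1))^2) * (sin (x$2))^2
           else if d = 2 then 2 * cosh (x$1) * sinh (x$1) * sin (x$2) * cos (x$2) else 0) else 0)
    else if c = 2 then (if a = 1 \<and> b = 2 \<or> a = 2 \<and> b = 1 then (if d = 1 then 1 / (cosh (x$1))^2 else 0)
       else if a = 3 \<and> b = 3 then (if d = 2 then (sin (x$2))^2 - (cos (x$2))^2 else 0) else 0)
    else (if a = 1 \<and> b = 3 \<or> a = 3 \<and> b = 1 then (if d = 1 then 1 / (cosh (x$1))^2 else 0)
       else if a = 2 \<and> b = 3 \<or> a = 3 \<and> b = 2 then (if d = 2 then - 1 / (sin (x$2))^2 else 0) else 0))"
proof -
  have s: "sin (x$2) \<noteq> 0" using chart_sin[OF x] by simp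
  have eq: "pd d (christoffel c a b) x = pd d (\<lambda>x. (if c = 1 then (if a = 2 \<and> b = 2 then cosh (x$1) * sinh (x$1)
       else if a = 3 \<and> b = 3 then cosh (x$1) * sinh (x$1) * (sin (x$2))^2 else 0)
    else if c = 2 then (if a = 1 \<and> b = 2 \<or> a = 2 \<and> b = 1 then sinh (x$1) / cosh (x$1)
       else if a = 3 \<and> b = 3 then - (sin (x$2) * cos (x$2)) else 0)
    else (if a = 1 \<and> b = 3 \<or> a = 3 \<and> b = 1 then sinh (x$1) / cosh (x$1)
       else if a = 2 \<and> b = 3 \<or> a = 3 \<and> b = 2 then cos (x$2) / sin (x$2) else 0))) x"
    by (rule pd_cong[OF open_chart x christoffel_eq])
  have 1: "pd d (\<lambda>x. cosh (x$1) * sinh (x$1)) x = ((cosh (x$1))^2 + (sinh (x$1))^2) * axis d 1 $ 1" for d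
    by (rule trans, rule pd_eqI) (auto intro!: derivative_eq_intros has_derivative_coord simp: algebra_simps power2_eq_square)
  have 2: "pd d (\<lambda>x. cosh (x$1) * sinh (x$1) * (sin (x$2))^2) x =
      ((cosh (x$1))^2 + (sinh (x$1))^2) * (sin (x$2))^2 * axis d 1 $ 1 + 2 * cosh (x$1) * sinh (x$1) * sin (x$2) * cos (x$2) * axis d 1 $ 2" for d
    by (rule trans, rule pd_eqI) (auto intro!: derivative_eq_intros has_derivative_coord simp: algebra_simps power2_eq_square)
  have 3: "pd d (\<lambda>x. sinh (x$1) / cosh (x$1)) x = 1 / (cosh (x$1))^2 * axis d 1 $ 1" for d
  proof (rule trans, rule pd_eqI)
    show "((\<lambda>x. sinh (x$1) / cosh (x$1)) has_derivative
      (\<lambda>v. (v $ 1 * cosh (x$1) * cosh (x$1) - sinh (x$1) * (v $ 1 * sinh (x$1))) / (cosh (x$1) * cosh (x$1)))) (at x)"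
      by (auto intro!: derivative_eq_intros has_derivative_coord simp: mult_ac)
    have "t * cosh (x$1) * cosh (x$1) - sinh (x$1) * (t * sinh (x$1)) = t * ((cosh (x$1))^2 - (sinh (x$1))^2)" for t
      by (simp add: algebra_simps power2_eq_square)
    then have "t * cosh (x$1) * cosh (x$1) - sinh (x$1) * (t * sinh (x$1)) = t" for t
      by (simp only: hyperbolic_pythagoras mult_1_right)
    then show "(axis d 1 $ 1 * cosh (x$1) * cosh (x$1) - sinh (x$1) * (axis d 1 $ 1 * sinh (x$1))) / (cosh (x$1) * cosh (x$1))
      = 1 / (cosh (x$1))^2 * axis d 1 $ 1"
      by (simp add: power2_eq_square)
  qed
  have 4: "pd d (\<lambda>x. - (sin (x$2) * cos (x$2))) x = ((sin (x$2))^2 - (cos (x$2))^2) * axis d 1 $ 2" for d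
    by (rule trans, rule pd_eqI) (auto intro!: derivative_eq_intros has_derivative_coord simp: algebra_simps power2_eq_square)
  have 5: "pd d (\<lambda>x. cos (x$2) / sin (x$2)) x = (- 1 / (sin (x$2))^2) * axis d 1 $ 2" for d
  proof (rule trans, rule pd_eqI)
    show "((\<lambda>x. cos (x$2) / sin (x$2)) has_derivative
      (\<lambda>v. (- sin (x$2) * v $ 2 * sin (x$2) - cos (x$2) * (cos (x$2) * v $ 2)) / (sin (x$2) * sin (x$2)))) (at x)"
      using s by (auto intro!: derivative_eq_intros has_derivative_coord simp: mult_ac)
    have "(- sin (x$2) * t * sin (x$2) - cos (x$2) * (cos (x$2) * t)) = - t" for t
    proof -
      have "(- sin (x$2) * t * sin (x$2) - cos (x$2) * (cos (x$2) * t)) = - t * ((sin (x$2))^2 + (cos (x$2))^2)"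
        by algebra
      then show ?thesis by (simp only: sin_cos_squared_add mult_1_right)
    qed
    then show "(- sin (x$2) * axis d 1 $ 2 * sin (x$2) - cos (x$2) * (cos (x$2) * axis d 1 $ 2)) / (sin (x$2) * sin (x$2))
      = (- 1 / (sin (x$2))^2) * axis d 1 $ 2" for d by (simp add: power2_eq_square)
  qed
  show ?thesis
    unfolding eq
    using exhaust_3[of d] by (elim disjE; hypsubst) (simp_all add: pd_if 1 2 3 4 5)
qed

text \<open>The left side is the Riemann tensor \<open>R^e_dca\<close> written out in Christoffel
  symbols; the right side expresses constant curvature one.\<close>

lemma riemann_de_sitter:
  assumes x: "x \<in> chart"
  shows "pd c (christoffel e a d) x - pd a (christoffel e c d) x
      + (\<Sum>f\<in>UNIV. christoffel e c f x * christoffel f a d x - christoffel e a f x * christoffel f c d x)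
    = (if e = c then h0 a d x else 0) - (if e = a then h0 c d x else 0)"
proof -
  define u where "u = x$2"
  define v where "v = x$1"
  have s: "sin u \<noteq> 0" using chart_sin[OF x] by (simp add: u_def)
  have c1: "cos u * cos u = 1 - sin u * sin u" using sin_cos_squared_add[of u] by (simp add: power2_eq_square)
  have c2: "sinh v * sinh v = cosh v * cosh v - 1" using hyperbolic_pythagoras[of v] by (simp add: power2_eq_square)
  \<comment> \<open>Variants that also rewrite inside right-nested products, the form in which
    \<open>algebra_simps\<close> leaves them.\<close>
  have c1': "cos u * (cos u * z) = z - sin u * (sin u * z)" for z using c1 by algebra
  have c2': "sinh v * (sinh v * z) = cosh v * (cosh v * z) - z" for z using c2 by algebra
  show ?thesis
    unfolding sum_3 pd_christoffel[OF x] christoffel_eq[OF x] u_def[symmetric] v_def[symmetric]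
    using exhaust_3[of c] exhaust_3[of a] exhaust_3[of d] exhaust_3[of e] s
    by (elim disjE; simp add: u_def[symmetric] v_def[symmetric] power2_eq_square divide_simps;
        (simp add: algebra_simps c1 c2 c1' c2')?)
qed

definition smooth_tens2 :: "tens2 \<Rightarrow> bool" where
  "smooth_tens2 t \<longleftrightarrow> (\<forall>a b. smooth_chart (t a b))"

lemma smooth_tens2_cov2:
  assumes "smooth_tens2 t"
  shows "smooth_chart (cov2 c t a b)"
  using assms unfolding cov2_def[abs_def] smooth_tens2_def
  by (auto intro!: smooth_chart_intros smooth_chart_pd smooth_chart_christoffel)

lemma pd_cov2:
  assumes t: "smooth_tens2 t" and x: "x \<in> chart"
  shows "pd c (cov2 a t d b) x = pd c (pd a (t d b)) x
     - (\<Sum>e\<in>UNIV. pd c (christoffel e a d) x * t e b x + christoffel e a d x * pd c (t e b) x)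
     - (\<Sum>e\<in>UNIV. pd c (christoffel e a b) x * t d e x + christoffel e a b x * pd c (t d e) x)"
proof -
  have s: "smooth_chart (t a b)" for a b using t by (simp add: smooth_tens2_def)
  note si = smooth_chart_intros smooth_chart_pd smooth_chart_christoffel s
  show ?thesis
    unfolding cov2_def[abs_def] sum_3
    by (simp add: pd_diff pd_add pd_mult smooth_chart_differentiable[OF _ x] si)
qed

lemma sum_delta_diff:
  fixes f :: "'a::finite \<Rightarrow> real"
  shows "(\<Sum>e\<in>UNIV. ((if e = c then p else 0) - (if e = a then q else 0)) * f e) = p * f c - q * f a"
proof -
  have "((if e = c then p else 0) - (if e = a then q else 0)) * f e
      = (if e = c then p * f c else 0) - (if e = a then q * f a else 0)" for e
    by (auto simp: algebra_simps)
  then show ?thesis by (simp add: sum_subtractf)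
qed

text \<open>Second partial derivatives commute, and the terms acting on the two derivative indices
  cancel because the connection is torsion free; one curvature term for each index of
  \<open>t\<close> remains.\<close>

lemma ricci_identity:
  assumes t: "smooth_tens2 t" and x: "x \<in> chart"
  shows "cov3 c (\<lambda>e. cov2 e t) a d b x - cov3 a (\<lambda>e. cov2 e t) c d b x =
    h0 c d x * t a b x - h0 a d x * t c b x + h0 c b x * t d a x - h0 a b x * t d c x"
proof -
  define R where "R e d c a = pd c (christoffel e a d) x - pd a (christoffel e c d) x
      + (\<Sum>f\<in>UNIV. christoffel e c f x * christoffel f a d x - christoffel e a f x * christoffel f c d x)" for e d c a
  have s: "smooth_chart (t a b)" for a b using t by (simp add: smooth_tens2_def)
  have "cov3 c (\<lambda>e. cov2 e t) a d b x - cov3 a (\<lambda>e. cov2 e t) c d b x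
     = - (\<Sum>e\<in>UNIV. R e d c a * t e b x) - (\<Sum>e\<in>UNIV. R e b c a * t d e x)"
    unfolding cov3_def pd_cov2[OF t x] R_def
    unfolding cov2_def sum_3 smooth_chart_pd_comm[OF s x, of a c] christoffel_sym[OF x, of _ a c]
    by (simp add: algebra_simps)
  also have "\<dots> = h0 c d x * t a b x - h0 a d x * t c b x + h0 c b x * t d a x - h0 a b x * t d c x"
    unfolding R_def riemann_de_sitter[OF x] sum_delta_diff by simp
  finally show ?thesis .
qed

subsection \<open>The curl of a symmetric tensor\<close>

text \<open>Cyclic successor: \<open>(a, cyc a, cyc (cyc a))\<close> is always an even permutation,
  so each component of a curl is one difference with a single factor.\<close>

definition cyc :: "3 \<Rightarrow> 3" where
  "cyc a = (if a = 1 then 2 else if a = 2 then 3 else 1)"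

lemma cyc_simps [simp]: "cyc 1 = 2" "cyc 2 = 3" "cyc 3 = 1"
  by (simp_all add: cyc_def)

text \<open>The factor is \<open>\<epsilon>\<^sub>a\<^sup>b\<^sup>c\<close> for cyclic \<open>(a, b, c)\<close>; only \<open>\<epsilon>\<^sub>\<tau>\<^sup>\<theta>\<^sup>\<phi>\<close> does not raise the
  timelike index, hence the different sign.\<close>

definition curl_fac :: "3 \<Rightarrow> scal" where
  "curl_fac a x = (if a = 1 then 1 / ((cosh (x$1))^2 * sin (x$2)) else if a = 2 then - (1 / sin (x$2)) else - sin (x$2))"

lemma curl_fac_simps [simp]:
  "curl_fac 1 x = 1 / ((cosh (x$1))^2 * sin (x$2))" "curl_fac 2 x = - (1 / sin (x$2))" "curl_fac 3 x = - sin (x$2)"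
  by (simp_all add: curl_fac_def)

lemma eps_eq:
  "eps a b c x = (cosh (x$1))^2 * sin (x$2) *
     (if b = cyc a \<and> c = cyc b then 1 else if a = cyc b \<and> b = cyc c then -1 else 0)"
  unfolding eps_def det_3
  using exhaust_3[of a] exhaust_3[of b] exhaust_3[of c] by (elim disjE; hypsubst) simp_all

lemma curl_eq:
  assumes x: "x \<in> chart"
  shows "curl t a b x = curl_fac a x * (cov2 (cyc a) t (cyc (cyc a)) b x - cov2 (cyc (cyc a)) t (cyc a) b x)"
proof -
  have s: "sin (x$2) \<noteq> 0" using chart_sin[OF x] by simp
  show ?thesis
    unfolding curl_def sum_3 eps_eq
    using exhaust_3[of a] s by (elim disjE; hypsubst) (simp_all add: h0inv_simps[OF x] power2_eq_square divide_simps, (simp_all add: algebra_simps)?)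
qed

lemma smooth_tens2_curl:
  assumes "smooth_tens2 t"
  shows "smooth_tens2 (curl t)"
  unfolding smooth_tens2_def
proof (intro allI)
  fix a b
  have "smooth_chart (curl_fac a)"
    unfolding curl_fac_def[abs_def] using exhaust_3[of a] chart_sin
    by (elim disjE; hypsubst; simp) (force intro!: smooth_chart_intros)+
  then have "smooth_chart (\<lambda>x. curl_fac a x * (cov2 (cyc a) t (cyc (cyc a)) b x - cov2 (cyc (cyc a)) t (cyc a) b x))"
    by (intro smooth_chart_intros smooth_tens2_cov2 assms)
  then show "smooth_chart (curl t a b)"
    by (rule smooth_chart_cong) (simp add: curl_eq)
qed

lemma pd_curl_fac:
  assumes x: "x \<in> chart"
  shows "pd c (curl_fac 1) x = (if c = 1 then - 2 * sinh (x$1) / ((cosh (x$1))^3 * sin (x$2))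
       else if c = 2 then - cos (x$2) / ((cosh (x$1))^2 * (sin (x$2))^2) else 0)"
    "pd c (curl_fac 2) x = (if c = 2 then cos (x$2) / (sin (x$2))^2 else 0)"
    "pd c (curl_fac 3) x = (if c = 2 then - cos (x$2) else 0)"
proof -
  have s: "sin (x$2) \<noteq> 0" using chart_sin[OF x] by simp
  have 1: "pd c (curl_fac 1) x = - (2 * cosh (x$1) * sinh (x$1) * sin (x$2) * axis c 1 $ 1 + (cosh (x$1))^2 * cos (x$2) * axis c 1 $ 2)
      / ((cosh (x$1))^2 * sin (x$2))^2"
    unfolding curl_fac_def[abs_def] using s
    by (rule_tac trans, rule_tac pd_eqI)
      (auto intro!: derivative_eq_intros has_derivative_coord simp: algebra_simps power2_eq_square divide_simps)
  have 2: "pd c (curl_fac 2) x = cos (x$2) * axis c 1 $ 2 / (sin (x$2))^2"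
    unfolding curl_fac_def[abs_def] using s
    by (rule_tac trans, rule_tac pd_eqI)
      (auto intro!: derivative_eq_intros has_derivative_coord simp: algebra_simps power2_eq_square divide_simps)
  have 3: "pd c (curl_fac 3) x = - cos (x$2) * axis c 1 $ 2"
    unfolding curl_fac_def[abs_def]
    by (rule trans, rule pd_eqI) (auto intro!: derivative_eq_intros has_derivative_coord simp: algebra_simps)
  show "pd c (curl_fac 1) x = (if c = 1 then - 2 * sinh (x$1) / ((cosh (x$1))^3 * sin (x$2))
       else if c = 2 then - cos (x$2) / ((cosh (x$1))^2 * (sin (x$2))^2) else 0)"
    unfolding 1 using exhaust_3[of c] s
    by (elim disjE; hypsubst) (simp_all add: power2_eq_square power3_eq_cube divide_simps)
  show "pd c (curl_fac 2) x = (if c = 2 then cos (x$2) / (sin (x$2))^2 else 0)"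
    unfolding 2 using exhaust_3[of c] by (elim disjE; hypsubst) simp_all
  show "pd c (curl_fac 3) x = (if c = 2 then - cos (x$2) else 0)"
    unfolding 3 using exhaust_3[of c] by (elim disjE; hypsubst) simp_all
qed

text \<open>The volume form is parallel. In components, the partial derivatives of
  \<open>curl_fac\<close> make up for the mismatch between the Christoffel terms of \<open>d\<close>
  on the left and those of the two skew indices on the right.\<close>

lemma cov2_curl:
  assumes t: "smooth_tens2 t" and x: "x \<in> chart"
  shows "cov2 c (curl t) d b x = curl_fac d x *
    (cov3 c (\<lambda>e. cov2 e t) (cyc d) (cyc (cyc d)) b x - cov3 c (\<lambda>e. cov2 e t) (cyc (cyc d)) (cyc d) b x)"
proof -
  have s: "sin (x$2) \<noteq> 0" using chart_sin[OF x] by simp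
  have w: "smooth_chart (curl_fac a)" for a
    unfolding curl_fac_def[abs_def] using exhaust_3[of a] chart_sin
    by (elim disjE; hypsubst; simp) (force intro!: smooth_chart_intros)+
  let ?X = "\<lambda>e f y. cov2 e t f b y"
  have "pd c (curl t d b) x = pd c (\<lambda>y. curl_fac d y * (?X (cyc d) (cyc (cyc d)) y - ?X (cyc (cyc d)) (cyc d) y)) x"
    by (rule pd_cong[OF open_chart x curl_eq])
  also have "\<dots> = pd c (curl_fac d) x * (?X (cyc d) (cyc (cyc d)) x - ?X (cyc (cyc d)) (cyc d) x)
     + curl_fac d x * (pd c (?X (cyc d) (cyc (cyc d))) x - pd c (?X (cyc (cyc d)) (cyc d)) x)"
    by (simp add: pd_mult pd_diff smooth_chart_differentiable[OF _ x] w smooth_tens2_cov2[OF t] smooth_chart_intros)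
  finally have 1: "pd c (curl t d b) x = \<dots>" .
  \<comment> \<open>The Christoffel terms of the second index \<open>b\<close> are the same on both
    sides; naming them as blocks restricts the case split to \<open>c\<close> and
    \<open>d\<close>.\<close>
  define S where "S d = (\<Sum>g\<in>UNIV. christoffel g c b x * (curl_fac d x * (cov2 (cyc d) t (cyc (cyc d)) g x - cov2 (cyc (cyc d)) t (cyc d) g x)))" for d
  define S' where "S' e f = (\<Sum>g\<in>UNIV. christoffel g c b x * cov2 e t f g x)" for e f
  have S: "S d = curl_fac d x * (S' (cyc d) (cyc (cyc d)) - S' (cyc (cyc d)) (cyc d))" for d
    by (simp add: S_def S'_def sum_distrib_left sum_subtractf[symmetric] algebra_simps)
  show ?thesis
    unfolding cov2_def[of c "curl t"] 1 cov3_def curl_eq[OF x] S_def[symmetric] S'_def[symmetric] S sum_3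
    using exhaust_3[of c] exhaust_3[of d] s
    by (elim disjE; hypsubst)
      (simp_all add: pd_curl_fac[OF x] christoffel_eq[OF x] power2_eq_square power3_eq_cube divide_simps, (simp_all add: algebra_simps)?)
qed

text \<open>Contraction of two volume forms. In Lorentzian signature their product has an extra
  minus sign, so up to the order of derivatives the result is the wave operator minus the derivative
  of the divergence, opposite to the Euclidean formula.\<close>

lemma curl_curl:
  assumes t: "smooth_tens2 t" and x: "x \<in> chart"
  shows "curl (curl t) a b x =
    (\<Sum>c\<in>UNIV. diag_inv c x * (cov3 c (\<lambda>e. cov2 e t) c a b x - cov3 c (\<lambda>e. cov2 e t) a c b x))"
proof -
  have s: "sin (x$2) \<noteq> 0" using chart_sin[OF x] by simp
  show ?thesis
    unfolding curl_eq[OF x, of "curl t"] cov2_curl[OF t x] sum_3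
    using exhaust_3[of a] s by (elim disjE; hypsubst) (simp_all add: power2_eq_square divide_simps, (simp_all add: algebra_simps)?)
qed

definition sym_tens2 :: "tens2 \<Rightarrow> bool" where
  "sym_tens2 t \<longleftrightarrow> (\<forall>a b. \<forall>x\<in>chart. t a b x = t b a x)"

lemma cov2_sym:
  assumes "sym_tens2 t" "x \<in> chart"
  shows "cov2 c t a b x = cov2 c t b a x"
proof -
  have "pd c (t a b) x = pd c (t b a) x"
    by (rule pd_cong[OF open_chart assms(2)]) (use assms(1) in \<open>auto simp: sym_tens2_def\<close>)
  moreover have "t a b x = t b a x" for a b using assms by (auto simp: sym_tens2_def)
  ultimately show ?thesis unfolding cov2_def by simp
qed

lemma div2_eq:
  assumes "x \<in> chart"
  shows "div2 t a x = (\<Sum>c\<in>UNIV. diag_inv c x * cov2 c t a c x)"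
  unfolding div2_def by (subst sum_h0inv[OF assms]) simp

lemma trace2_eq:
  assumes "x \<in> chart"
  shows "trace2 t x = (\<Sum>c\<in>UNIV. diag_inv c x * t c c x)"
  unfolding trace2_def by (rule sum_h0inv[OF assms])

lemma box2_eq:
  assumes "x \<in> chart"
  shows "box2 t a b x = (\<Sum>c\<in>UNIV. diag_inv c x * cov3 c (\<lambda>e. cov2 e t) c a b x)"
  unfolding box2_def by (rule sum_h0inv[OF assms])

lemma smooth_chart_diag_inv: "smooth_chart (diag_inv a)"
  unfolding diag_inv_def[abs_def] using exhaust_3[of a] chart_sin
  by (elim disjE; hypsubst; simp) (force intro!: smooth_chart_intros)+

lemma pd_diag_inv:
  assumes x: "x \<in> chart"
  shows "pd c (diag_inv a) x = - pd c (h0 a a) x / (h0 a a x)^2"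
proof -
  have nz: "h0 a a x \<noteq> 0" using exhaust_3[of a] chart_sin[OF x] by auto
  have "(h0 a a has_derivative frechet_derivative (h0 a a) (at x)) (at x)"
    using smooth_chart_differentiable[OF smooth_chart_h0 x] by (simp add: frechet_derivative_works)
  from has_derivative_divide'[OF has_derivative_const this nz, of 1]
  show ?thesis unfolding diag_inv_def[abs_def]
    using pd_eqI by (fastforce simp: pd_def power2_eq_square)
qed

text \<open>The inverse metric is parallel, so contraction commutes with the derivative. Symmetry of
  \<open>t\<close> moves the contracted index to the first slot, where \<open>curl_curl\<close> has
  it.\<close>

lemma cov1_div2:
  assumes t: "smooth_tens2 t" "sym_tens2 t" and x: "x \<in> chart"
  shows "cov1 a (div2 t) b x = (\<Sum>c\<in>UNIV. diag_inv c x * cov3 a (\<lambda>e. cov2 e t) c c b x)"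
proof -
  have s: "sin (x$2) \<noteq> 0" using chart_sin[OF x] by simp
  have D: "div2 t b y = (\<Sum>c\<in>UNIV. diag_inv c y * cov2 c t c b y)" if "y \<in> chart" for b y
    unfolding div2_eq[OF that] cov2_sym[OF t(2) that, of _ b] ..
  have "pd a (div2 t b) x = pd a (\<lambda>y. \<Sum>c\<in>UNIV. diag_inv c y * cov2 c t c b y) x"
    by (rule pd_cong[OF open_chart x D])
  also have "\<dots> = (\<Sum>c\<in>UNIV. pd a (diag_inv c) x * cov2 c t c b x + diag_inv c x * pd a (cov2 c t c b) x)"
    by (simp add: pd_sum pd_mult smooth_chart_differentiable[OF _ x] smooth_chart_intros smooth_chart_diag_inv smooth_tens2_cov2[OF t(1)])
  finally have 1: "pd a (div2 t b) x = \<dots>" .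
  define S where "S c = (\<Sum>d\<in>UNIV. christoffel d a b x * cov2 c t c d x)" for c
  have S: "(\<Sum>d\<in>UNIV. christoffel d a b x * div2 t d x) = (\<Sum>c\<in>UNIV. diag_inv c x * S c)"
    unfolding D[OF x] S_def sum_3 by (simp add: algebra_simps)
  show ?thesis
    unfolding cov1_def 1 S cov3_def S_def[symmetric] sum_3 pd_diag_inv[OF x] pd_h0
    using exhaust_3[of a] s
    by (elim disjE; hypsubst)
      (simp_all add: christoffel_eq[OF x] power2_eq_square power3_eq_cube divide_simps, (simp_all add: algebra_simps)?)
qed

text \<open>The derivatives in the second term of \<open>curl_curl\<close> are interchanged by the
  Ricci identity. Tracing its four curvature terms gives \<open>3 t\<close>, two terms that cancel
  because \<open>t\<close> is symmetric, and minus the trace part.\<close>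

lemma curl_curl_eq:
  assumes t: "smooth_tens2 t" "sym_tens2 t" and x: "x \<in> chart"
  shows "curl (curl t) a b x = box2 t a b x - cov1 a (div2 t) b x - 3 * t a b x + h0 a b x * trace2 t x"
proof -
  have s: "sin (x$2) \<noteq> 0" using chart_sin[OF x] by simp
  have ric: "cov3 c (\<lambda>e. cov2 e t) a c b x = cov3 a (\<lambda>e. cov2 e t) c c b x +
     (h0 c c x * t a b x - h0 a c x * t c b x + h0 c b x * t c a x - h0 a b x * t c c x)" for c
    using ricci_identity[OF t(1) x, of c a c b] t(2) x unfolding sym_tens2_def by (metis add_diff_cancel_left' diff_add_cancel)
  have "(\<Sum>c\<in>UNIV. diag_inv c x * (h0 c c x * t a b x - h0 a c x * t c b x + h0 c b x * t c a x - h0 a b x * t c c x))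
     = 3 * t a b x - h0 a b x * trace2 t x"
    unfolding trace2_eq[OF x] sum_3 using exhaust_3[of a] exhaust_3[of b] s t(2) x
    unfolding sym_tens2_def
    by (elim disjE; hypsubst) (simp_all add: divide_simps, (simp_all add: algebra_simps)?)
  then show ?thesis
    unfolding curl_curl[OF t(1) x] ric box2_eq[OF x] cov1_div2[OF t x]
    by (simp add: algebra_simps sum.distrib sum_subtractf)
qed

subsection \<open>The field equations\<close>

lemma hess_eq: "hess f a b = cov1 b (\<lambda>a. pd a f) a"
  by (simp add: hess_def[abs_def] grad_def[abs_def])

lemma hess_sym:
  assumes "smooth_chart f" "x \<in> chart"
  shows "hess f a b x = hess f b a x"
  using assms by (simp add: hess_eq cov1_def smooth_chart_pd_comm[of f x a b] christoffel_sym[of x _ a b])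

text \<open>The operators act on functions defined everywhere, while the field identities hold on
  \<open>chart\<close> only; openness of \<open>chart\<close> makes this enough.\<close>

lemma cov1_cong:
  assumes "x \<in> chart" "\<And>a y. y \<in> chart \<Longrightarrow> v a y = w a y"
  shows "cov1 c v a x = cov1 c w a x"
  using pd_cong[OF open_chart assms(1), of "v a" "w a" c] assms by (simp add: cov1_def)

lemma cov3_cong:
  assumes "x \<in> chart" "\<And>a b c y. y \<in> chart \<Longrightarrow> v a b c y = w a b c y"
  shows "cov3 e v a b c x = cov3 e w a b c x"
  using pd_cong[OF open_chart assms(1), of "v a b c" "w a b c" e] assms by (simp add: cov3_def)

lemma cov1_diff:
  assumes "smooth_chart (v a)" "smooth_chart (w a)" "x \<in> chart"
  shows "cov1 c (\<lambda>a y. v a y - w a y) a x = cov1 c v a x - cov1 c w a x"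
  using assms by (simp add: cov1_def pd_diff smooth_chart_differentiable right_diff_distrib sum_subtractf)

lemma cov2_diff:
  assumes "smooth_tens2 v" "smooth_tens2 w" "x \<in> chart"
  shows "cov2 c (\<lambda>a b y. v a b y - w a b y) a b x = cov2 c v a b x - cov2 c w a b x"
  using assms
  by (simp add: cov2_def smooth_tens2_def pd_diff smooth_chart_differentiable right_diff_distrib sum_subtractf)

lemma cov3_diff:
  assumes "\<And>a b c. smooth_chart (v a b c)" "\<And>a b c. smooth_chart (w a b c)" "x \<in> chart"
  shows "cov3 e (\<lambda>a b c y. v a b c y - w a b c y) a b c x = cov3 e v a b c x - cov3 e w a b c x"
  using assms by (simp add: cov3_def pd_diff smooth_chart_differentiable right_diff_distrib sum_subtractf)

lemma metric_compatible:
  assumes x: "x \<in> chart"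
  shows "pd c (h0 a b) x = (\<Sum>d\<in>UNIV. christoffel d c a x * h0 d b x) + (\<Sum>d\<in>UNIV. christoffel d c b x * h0 a d x)"
proof -
  have s: "sin (x$2) \<noteq> 0" using chart_sin[OF x] by simp
  show ?thesis unfolding pd_h0 sum_3
    using exhaust_3[of a] exhaust_3[of b] exhaust_3[of c] s
    by (elim disjE; hypsubst) (simp_all add: christoffel_eq[OF x] power2_eq_square)
qed

text \<open>The metric is parallel, so the derivative falls on the scalar factor alone.\<close>

lemma cov2_scaled_metric:
  assumes "smooth_chart f" "x \<in> chart"
  shows "cov2 c (\<lambda>a b y. f y * h0 a b y) a b x = pd c f x * h0 a b x"
  using assms
  by (simp add: cov2_def pd_mult smooth_chart_differentiable smooth_chart_h0 metric_compatible sum_distrib_left algebra_simps)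

lemma cov3_scaled_metric:
  assumes "\<And>a. smooth_chart (v a)" "x \<in> chart"
  shows "cov3 e (\<lambda>c a b y. v c y * h0 a b y) c a b x = cov1 e v c x * h0 a b x"
  using assms
  by (simp add: cov3_def cov1_def pd_mult smooth_chart_differentiable smooth_chart_h0 metric_compatible
      sum_distrib_left sum_distrib_right algebra_simps)

lemma smooth_chart_grad_sq:
  assumes "smooth_chart f"
  shows "smooth_chart (grad_sq f)"
proof (rule smooth_chart_cong)
  show "smooth_chart (\<lambda>x. \<Sum>a\<in>UNIV. diag_inv a x * (pd a f x * pd a f x))"
    by (intro smooth_chart_intros smooth_chart_pd smooth_chart_diag_inv assms)
qed (simp add: grad_sq_def trace2_eq grad_def)

lemma grad_diff:
  assumes "smooth_chart f" "smooth_chart g" "x \<in> chart"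
  shows "grad (\<lambda>y. f y - g y) a x = grad f a x - grad g a x"
  using assms by (simp add: grad_def pd_diff smooth_chart_differentiable)

lemma hess_diff:
  assumes "smooth_chart f" "smooth_chart g" "x \<in> chart"
  shows "hess (\<lambda>y. f y - g y) a b x = hess f a b x - hess g a b x"
proof -
  have "cov1 b (grad (\<lambda>y. f y - g y)) a x = cov1 b (\<lambda>a y. grad f a y - grad g a y) a x"
    by (rule cov1_cong[OF assms(3)]) (rule grad_diff[OF assms(1,2)])
  then show ?thesis
    using assms by (simp add: hess_def cov1_diff smooth_chart_pd grad_def[abs_def])
qed

lemma pd_cmult_square:
  assumes "smooth_chart f" "x \<in> chart"
  shows "pd a (\<lambda>y. r * (f y)^2) x = 2 * r * f x * pd a f x"
  using assms by (simp add: power2_eq_square pd_mult smooth_chart_differentiable smooth_chart_intros algebra_simps)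

lemma hess_cmult_square:
  assumes f: "smooth_chart f" and x: "x \<in> chart"
  shows "hess (\<lambda>y. r * (f y)^2) a b x = 2 * r * (pd a f x * pd b f x + f x * hess f a b x)"
proof -
  have "cov1 b (grad (\<lambda>y. r * (f y)^2)) a x = cov1 b (\<lambda>a y. 2 * r * f y * pd a f y) a x"
    by (rule cov1_cong[OF x]) (simp add: grad_def pd_cmult_square[OF f])
  also have "\<dots> = 2 * r * (pd a f x * pd b f x + f x * hess f a b x)"
    unfolding hess_eq cov1_def sum_3
    by (simp add: pd_mult smooth_chart_differentiable[OF _ x] smooth_chart_intros smooth_chart_pd f algebra_simps)
  finally show ?thesis by (simp add: hess_def)
qed

section \<open>The potential \<open>k\<close> and its curl\<close>

definition weyl_pot :: "scal \<Rightarrow> tens2 \<Rightarrow> tens2" where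
  "weyl_pot s h a b y = h a b y - 2 * (s y)\<^sup>2 * h0 a b y"

lemma B2_eq: "B2 s h = curl (weyl_pot s h)"
  by (simp add: B2_def weyl_pot_def[abs_def])

context
  fixes s :: scal and h :: tens2
  assumes s: "smooth_chart s" and h: "smooth_tens2 h" "sym_tens2 h"
begin

lemma smooth_two_square: "smooth_chart (\<lambda>y. 2 * (s y)\<^sup>2)"
  by (intro smooth_chart_intros s)

lemma smooth_tens2_scaled: "smooth_tens2 (\<lambda>a b y. 2 * (s y)\<^sup>2 * h0 a b y)"
  unfolding smooth_tens2_def by (intro allI smooth_chart_intros s smooth_chart_h0)

lemma smooth_tens2_weyl_pot: "smooth_tens2 (weyl_pot s h)"
  using h smooth_tens2_scaled unfolding smooth_tens2_def weyl_pot_def[abs_def] by (auto intro: smooth_chart_intros)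

lemma h0_sym: "h0 a b x = h0 b a x"
  by (simp add: h0_def)

lemma sym_tens2_weyl_pot: "sym_tens2 (weyl_pot s h)"
  using h unfolding sym_tens2_def weyl_pot_def by (auto simp: h0_sym)

lemma cov2_weyl_pot:
  assumes "x \<in> chart"
  shows "cov2 c (weyl_pot s h) a b x = cov2 c h a b x - pd c (\<lambda>y. 2 * (s y)\<^sup>2) x * h0 a b x"
  unfolding weyl_pot_def[abs_def] cov2_diff[OF h(1) smooth_tens2_scaled assms]
    cov2_scaled_metric[OF smooth_two_square assms] ..

lemma trace2_weyl_pot:
  assumes "x \<in> chart"
  shows "trace2 (weyl_pot s h) x = trace2 h x - 6 * (s x)\<^sup>2"
proof -
  have "sin (x$2) \<noteq> 0" using chart_sin[OF assms] by simp
  then show ?thesis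
    unfolding trace2_eq[OF assms] weyl_pot_def sum_3 by (simp add: divide_simps) (simp add: algebra_simps)
qed

lemma div2_weyl_pot:
  assumes "x \<in> chart"
  shows "div2 (weyl_pot s h) a x = div2 h a x - grad (\<lambda>y. 2 * (s y)\<^sup>2) a x"
proof -
  have "sin (x$2) \<noteq> 0" using chart_sin[OF assms] by simp
  then show ?thesis
    unfolding div2_eq[OF assms] cov2_weyl_pot[OF assms] sum_3 grad_def using exhaust_3[of a]
    by (elim disjE; hypsubst) (simp_all add: divide_simps, (simp_all add: algebra_simps)?)
qed

lemma box2_weyl_pot:
  assumes x: "x \<in> chart"
  shows "box2 (weyl_pot s h) a b x = box2 h a b x - box0 (\<lambda>y. 2 * (s y)\<^sup>2) x * h0 a b x"
proof -
  have "cov3 c (\<lambda>e. cov2 e (weyl_pot s h)) d a b x = cov3 c (\<lambda>e. cov2 e h) d a b x - hess (\<lambda>y. 2 * (s y)\<^sup>2) d c x * h0 a b x" for c d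
  proof -
    have "cov3 c (\<lambda>e. cov2 e (weyl_pot s h)) d a b x
        = cov3 c (\<lambda>e a b y. cov2 e h a b y - pd e (\<lambda>y. 2 * (s y)\<^sup>2) y * h0 a b y) d a b x"
      by (rule cov3_cong[OF x]) (rule cov2_weyl_pot)
    also have "\<dots> = cov3 c (\<lambda>e. cov2 e h) d a b x - cov3 c (\<lambda>e a b y. pd e (\<lambda>y. 2 * (s y)\<^sup>2) y * h0 a b y) d a b x"
      by (rule cov3_diff)
        (intro smooth_tens2_cov2 h smooth_chart_intros smooth_chart_pd smooth_two_square smooth_chart_h0 x)+
    also have "cov3 c (\<lambda>e a b y. pd e (\<lambda>y. 2 * (s y)\<^sup>2) y * h0 a b y) d a b x = hess (\<lambda>y. 2 * (s y)\<^sup>2) d c x * h0 a b x"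
      unfolding hess_eq by (rule cov3_scaled_metric) (intro smooth_chart_pd smooth_two_square x)+
    finally show ?thesis .
  qed
  then show ?thesis
    unfolding box2_eq[OF x] box0_def trace2_eq[OF x] by (simp add: right_diff_distrib sum_subtractf sum_distrib_right mult.assoc)
qed

lemma box0_two_square:
  assumes x: "x \<in> chart"
  shows "box0 (\<lambda>y. 2 * (s y)\<^sup>2) x = 4 * grad_sq s x + 4 * s x * box0 s x"
  unfolding box0_def grad_sq_def trace2_eq[OF x] hess_cmult_square[OF s x] grad_def sum_3
  by (simp add: algebra_simps)

lemma smooth_grad_sq: "smooth_chart (grad_sq s)"
  by (rule smooth_chart_grad_sq[OF s])

context
  assumes vac: "asymptotic_vacuum s h"
begin

text \<open>Both sides are the gradient of \<open>6 * (s y)^2 + grad_sq s y\<close>: the trace loses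
  \<open>3 * 2\<close> from its coefficient \<open>12\<close>, the divergence \<open>2\<close> from
  its coefficient \<open>8\<close>.\<close>

lemma div2_eq_grad_trace:
  assumes x: "x \<in> chart"
  shows "div2 (weyl_pot s h) a x = pd a (trace2 (weyl_pot s h)) x"
proof -
  note df = smooth_chart_differentiable[OF _ x] smooth_chart_intros s smooth_grad_sq
  have "pd a (trace2 (weyl_pot s h)) x = pd a (\<lambda>y. 12 * (s y)\<^sup>2 + grad_sq s y - 6 * (s y)\<^sup>2) x"
    by (rule pd_cong[OF open_chart x]) (use vac in \<open>simp add: trace2_weyl_pot asymptotic_vacuum_def\<close>)
  also have "\<dots> = 12 * s x * pd a s x + pd a (grad_sq s) x"
    by (simp add: pd_add pd_diff df pd_cmult_square[OF s x])
  also have "\<dots> = div2 (weyl_pot s h) a x"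
  proof -
    have "div2 h a x = grad (\<lambda>y. grad_sq s y + 8 * (s y)\<^sup>2) a x"
      using vac x by (auto simp: asymptotic_vacuum_def)
    then show ?thesis
      unfolding div2_weyl_pot[OF x] by (simp add: grad_def pd_add df pd_cmult_square[OF s x])
  qed
  finally show ?thesis ..
qed

text \<open>In \<open>curl_curl_eq\<close> the Hessian of \<open>5 s^2 + grad_sq s\<close> from the
  field equation cancels against part of the Hessian of the trace, leaving that of
  \<open>s^2\<close>. By \<open>box0 s = - 3 s\<close>, the wave operator on the subtracted
  \<open>2 s^2 h0\<close> removes the source \<open>4 grad_sq s\<close>.\<close>

lemma curl_B2:
  assumes x: "x \<in> chart"
  shows "curl (B2 s h) a b x = E2 s h a b x - s x * E1 s a b x"
proof -
  note df = smooth_chart_differentiable[OF _ x] smooth_chart_intros s smooth_grad_sq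
  have v: "box0 s x + 3 * s x = 0" "trace2 h x = 12 * (s x)\<^sup>2 + grad_sq s x"
    "box2 h a b x - 2 * h a b x =
        cov1 a (grad (\<lambda>y. 5 * (s y)\<^sup>2 + grad_sq s y)) b x
        + h0 a b x * (- 18 * (s x)\<^sup>2 + 4 * grad_sq s x)
        + 4 * s x * hess s a b x"
    using vac x by (auto simp: asymptotic_vacuum_def)
  \<comment> \<open>The function differentiated is \<open>6 s^2 + grad_sq s\<close>. Written as a
    difference with \<open>(-1) * s^2\<close>, it separates off the Hessian of the field equation
    and fits \<open>hess_diff\<close>.\<close>
  have "cov1 a (div2 (weyl_pot s h)) b x = cov1 a (grad (\<lambda>y. 5 * (s y)\<^sup>2 + grad_sq s y - (-1) * (s y)\<^sup>2)) b x"
  proof (rule cov1_cong[OF x])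
    fix c y assume y: "y \<in> chart"
    have "pd c (trace2 (weyl_pot s h)) y = pd c (\<lambda>y. 5 * (s y)\<^sup>2 + grad_sq s y - (-1) * (s y)\<^sup>2) y"
      by (rule pd_cong[OF open_chart y]) (use vac in \<open>simp add: trace2_weyl_pot asymptotic_vacuum_def\<close>)
    then show "div2 (weyl_pot s h) c y = grad (\<lambda>y. 5 * (s y)\<^sup>2 + grad_sq s y - (-1) * (s y)\<^sup>2) c y"
      using div2_eq_grad_trace[OF y] by (simp add: grad_def)
  qed
  also have "\<dots> = hess (\<lambda>y. 5 * (s y)\<^sup>2 + grad_sq s y - (-1) * (s y)\<^sup>2) b a x"
    by (simp only: hess_def)
  also have "\<dots> = hess (\<lambda>y. 5 * (s y)\<^sup>2 + grad_sq s y) b a x - hess (\<lambda>y. (-1) * (s y)\<^sup>2) b a x"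
    by (rule hess_diff) (intro smooth_chart_intros s smooth_grad_sq x)+
  also have "\<dots> = cov1 a (grad (\<lambda>y. 5 * (s y)\<^sup>2 + grad_sq s y)) b x + 2 * (pd a s x * pd b s x + s x * hess s a b x)"
    unfolding hess_cmult_square[OF s x] hess_sym[OF s x, of b a] by (simp add: hess_def algebra_simps)
  finally have d: "cov1 a (div2 (weyl_pot s h)) b x
     = cov1 a (grad (\<lambda>y. 5 * (s y)\<^sup>2 + grad_sq s y)) b x + 2 * (pd a s x * pd b s x + s x * hess s a b x)" .
  have bs: "box0 s x = - 3 * s x" using v(1) by simp
  have bh: "box2 h a b x = 2 * h a b x + cov1 a (grad (\<lambda>y. 5 * (s y)\<^sup>2 + grad_sq s y)) b x
        + h0 a b x * (- 18 * (s x)\<^sup>2 + 4 * grad_sq s x) + 4 * s x * hess s a b x"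
    using v(3) by simp
  show ?thesis
    unfolding B2_eq curl_curl_eq[OF smooth_tens2_weyl_pot sym_tens2_weyl_pot x] box2_weyl_pot[OF x] d
      box0_two_square[OF x] bs bh trace2_weyl_pot[OF x] v(2) E2_def E1_def grad_def weyl_pot_def
    by (simp add: algebra_simps power2_eq_square)
qed

text \<open>For symmetric \<open>k\<close> the skew part of the curl is dual to the divergence minus
  the gradient of the trace, which vanishes by \<open>div2_eq_grad_trace\<close>.\<close>

lemma B2_sym:
  assumes x: "x \<in> chart"
  shows "B2 s h a b x = B2 s h b a x"
proof -
  have sn: "sin (x$2) \<noteq> 0" using chart_sin[OF x] by simp
  let ?k = "weyl_pot s h"
  have "pd c (trace2 ?k) x = (\<Sum>d\<in>UNIV. diag_inv d x * cov2 c ?k d d x)" for c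
  proof -
    have "pd c (trace2 ?k) x = pd c (\<lambda>y. \<Sum>d\<in>UNIV. diag_inv d y * ?k d d y) x"
      by (rule pd_cong[OF open_chart x trace2_eq])
    also have "\<dots> = (\<Sum>d\<in>UNIV. pd c (diag_inv d) x * ?k d d x + diag_inv d x * pd c (?k d d) x)"
      using smooth_tens2_weyl_pot unfolding smooth_tens2_def
      by (simp add: pd_sum pd_mult smooth_chart_differentiable[OF _ x] smooth_chart_intros smooth_chart_diag_inv)
    also have "\<dots> = (\<Sum>d\<in>UNIV. diag_inv d x * cov2 c ?k d d x)"
    proof -
      have ks: "?k 2 1 x = ?k 1 2 x" "?k 3 1 x = ?k 1 3 x" "?k 3 2 x = ?k 2 3 x"
        using sym_tens2_weyl_pot x by (auto simp: sym_tens2_def)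
      show ?thesis
        unfolding cov2_def sum_3 pd_diag_inv[OF x] pd_h0 ks
        using exhaust_3[of c] sn
        by (elim disjE; hypsubst)
          (simp_all add: christoffel_eq[OF x] power2_eq_square power3_eq_cube divide_simps, (simp_all add: algebra_simps)?)
    qed
    finally show ?thesis .
  qed
  \<comment> \<open>Once the trace is known to commute with the derivative, the divergence identity
    becomes a linear relation between components of \<open>cov2\<close>, the quantities in
    \<open>curl_eq\<close>.\<close>
  then have D: "(\<Sum>c\<in>UNIV. diag_inv c x * cov2 c ?k e c x) = (\<Sum>d\<in>UNIV. diag_inv d x * cov2 e ?k d d x)" for e
    using div2_eq_grad_trace[OF x, of e] unfolding div2_eq[OF x] by simp
  have ks: "cov2 c ?k 2 1 x = cov2 c ?k 1 2 x" "cov2 c ?k 3 1 x = cov2 c ?k 1 3 x" "cov2 c ?k 3 2 x = cov2 c ?k 2 3 x" for c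
    using cov2_sym[OF sym_tens2_weyl_pot x] by auto
  show ?thesis
    unfolding B2_eq curl_eq[OF x] using D[of 1] D[of 2] D[of 3] exhaust_3[of a] exhaust_3[of b] sn
    unfolding sum_3
    by (elim disjE; hypsubst; simp add: ks power2_eq_square divide_simps;
         (simp add: algebra_simps)?)
qed

lemma B2_trace:
  assumes x: "x \<in> chart"
  shows "trace2 (B2 s h) x = 0"
proof -
  have sn: "sin (x$2) \<noteq> 0" using chart_sin[OF x] by simp
  let ?k = "weyl_pot s h"
  have ks: "cov2 c ?k 2 1 x = cov2 c ?k 1 2 x" "cov2 c ?k 3 1 x = cov2 c ?k 1 3 x" "cov2 c ?k 3 2 x = cov2 c ?k 2 3 x" for c
    using cov2_sym[OF sym_tens2_weyl_pot x] by auto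
  show ?thesis
    unfolding B2_eq trace2_eq[OF x] sum_3 curl_eq[OF x] using sn
    by (simp add: ks power2_eq_square divide_simps) (simp add: algebra_simps)?
qed

end

end

subsection \<open>Dual pairs of Killing vectors\<close>

text \<open>The equation says \<open>D\<^sub>c X\<^sub>b = \<epsilon>\<^sub>c\<^sub>b\<^sub>e Y\<^sup>e\<close>.\<close>

definition killing_dual :: "(real^3 \<Rightarrow> real^3) \<Rightarrow> (real^3 \<Rightarrow> real^3) \<Rightarrow> bool" where
  "killing_dual X Y \<longleftrightarrow> (\<forall>b. smooth_chart (\<lambda>x. X x $ b)) \<and>
     (\<forall>x\<in>chart. \<forall>c b. pd c (\<lambda>y. X y $ b) x + (\<Sum>e\<in>UNIV. christoffel b c e x * X x $ e)
        = diag_inv b x * (\<Sum>e\<in>UNIV. eps c b e x * Y x $ e))"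

definition contract :: "tens2 \<Rightarrow> (real^3 \<Rightarrow> real^3) \<Rightarrow> tens1" where
  "contract t X d x = (\<Sum>a\<in>UNIV. t d a x * X x $ a)"

text \<open>The exterior derivative of a one-form, with its skew index pair labelled by the
  complementary index.\<close>

definition ext_deriv :: "tens1 \<Rightarrow> 3 \<Rightarrow> scal" where
  "ext_deriv w d x = pd (cyc d) (w (cyc (cyc d))) x - pd (cyc (cyc d)) (w (cyc d)) x"

text \<open>Product rule for the curl of the one-form \<open>t X\<close>. Where the derivative falls
  on \<open>X\<close>, duality turns it into a volume form, and the product of two volume forms
  leaves \<open>t Y\<close> and a trace term. It serves twice: for \<open>B2\<close>, whose trace
  vanishes, and for the potential, where the trace term stays.\<close>

lemma contract_curl:
  assumes t: "smooth_tens2 t" "\<And>a b. t a b x = t b a x" and X: "killing_dual X Y" and x: "x \<in> chart"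
  shows "contract (curl t) X d x = curl_fac d x * ext_deriv (contract t X) d x
     - contract t Y d x + trace2 t x * h0 d d x * Y x $ d"
proof -
  have sn: "sin (x$2) \<noteq> 0" using chart_sin[OF x] by simp
  have sm: "smooth_chart (t a b)" "smooth_chart (\<lambda>y. X y $ b)" for a b
    using t X by (auto simp: smooth_tens2_def killing_dual_def)
  have pX: "pd c (\<lambda>y. X y $ b) x = diag_inv b x * (\<Sum>e\<in>UNIV. eps c b e x * Y x $ e)
      - (\<Sum>e\<in>UNIV. christoffel b c e x * X x $ e)" for b c
    using X x unfolding killing_dual_def by (simp add: eq_diff_eq)
  have pw: "pd c (contract t X e) x = (\<Sum>a\<in>UNIV. pd c (t e a) x * X x $ a + t e a x * pd c (\<lambda>y. X y $ a) x)" for c e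
    unfolding contract_def[abs_def]
    by (simp add: pd_sum pd_mult smooth_chart_differentiable[OF _ x] smooth_chart_intros sm)
  have ts: "t 2 1 x = t 1 2 x" "t 3 1 x = t 1 3 x" "t 3 2 x = t 2 3 x" using t(2) by auto
  have cs: "christoffel a 2 1 x = christoffel a 1 2 x" "christoffel a 3 1 x = christoffel a 1 3 x"
    "christoffel a 3 2 x = christoffel a 2 3 x" for a
    using christoffel_sym[OF x] by auto
  show ?thesis
    unfolding contract_def[of "curl t"] contract_def[of t Y] curl_eq[OF x] ext_deriv_def pw pX trace2_eq[OF x] cov2_def sum_3 eps_eq
    using exhaust_3[of d] sn
    by (elim disjE; hypsubst) (simp_all add: cs ts power2_eq_square divide_simps, (simp_all add: algebra_simps)?)
qed

section \<open>Coordinate components of rotations and boosts\<close>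

lemma harm_simps:
  "harm 1 x = cos (x$2)" "harm 2 x = sin (x$2) * cos (x$3)" "harm 3 x = sin (x$2) * sin (x$3)"
  by (simp_all add: harm_def)

definition harm_th :: "3 \<Rightarrow> real^3 \<Rightarrow> real" where
  "harm_th i x = (if i = 1 then - sin (x$2) else if i = 2 then cos (x$2) * cos (x$3) else cos (x$2) * sin (x$3))"

text \<open>The \<phi>-derivative of \<open>harm i\<close> divided by \<open>sin \<theta>\<close>.
  The explicit formula, unlike the quotient, is smooth across the poles; together with
  \<open>harm_th\<close> it gives the gradient of \<open>harm i\<close> in an orthonormal frame of
  the sphere.\<close>

definition harm_ph :: "3 \<Rightarrow> real^3 \<Rightarrow> real" where
  "harm_ph i x = (if i = 1 then 0 else if i = 2 then - sin (x$3) else cos (x$3))"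

lemma harm_th_simps:
  "harm_th 1 x = - sin (x$2)" "harm_th 2 x = cos (x$2) * cos (x$3)" "harm_th 3 x = cos (x$2) * sin (x$3)"
  by (simp_all add: harm_th_def)

lemma harm_ph_simps:
  "harm_ph 1 x = 0" "harm_ph 2 x = - sin (x$3)" "harm_ph 3 x = cos (x$3)"
  by (simp_all add: harm_ph_def)

lemma fun_harm:
  "harm 1 = (\<lambda>x. cos (x$2))" "harm 2 = (\<lambda>x. sin (x$2) * cos (x$3))" "harm 3 = (\<lambda>x. sin (x$2) * sin (x$3))"
  "harm_th 1 = (\<lambda>x. - sin (x$2))" "harm_th 2 = (\<lambda>x. cos (x$2) * cos (x$3))" "harm_th 3 = (\<lambda>x. cos (x$2) * sin (x$3))"
  "harm_ph 1 = (\<lambda>x. 0)" "harm_ph 2 = (\<lambda>x. - sin (x$3))" "harm_ph 3 = (\<lambda>x. cos (x$3))"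
  by (simp_all add: fun_eq_iff harm_simps harm_th_simps harm_ph_simps)

lemma C_on_harm:
  "C_on k UNIV (harm i)" "C_on k UNIV (harm_th i)" "C_on k UNIV (harm_ph i)"
  using exhaust_3[of i] by (elim disjE; hypsubst; unfold fun_harm; intro C_on_intros open_UNIV)+

lemma pd_harm:
  "pd 1 (harm i) x = 0" "pd 2 (harm i) x = harm_th i x" "pd 3 (harm i) x = sin (x$2) * harm_ph i x"
  "pd 1 (harm_th i) x = 0" "pd 2 (harm_th i) x = - harm i x" "pd 3 (harm_th i) x = cos (x$2) * harm_ph i x"
  "pd 1 (harm_ph i) x = 0" "pd 2 (harm_ph i) x = 0"
  "pd 3 (harm_ph i) x = - (sin (x$2) * harm i x + cos (x$2) * harm_th i x)"
proof -
  have 1: "pd a (harm i) x = axis a 1 $ 2 * harm_th i x + axis a 1 $ 3 * sin (x$2) * harm_ph i x" for a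
    using exhaust_3[of i]
    by (elim disjE; hypsubst; unfold fun_harm;
        rule_tac trans, rule_tac pd_eqI) (auto intro!: derivative_eq_intros has_derivative_coord simp: algebra_simps)
  have 2: "pd a (harm_th i) x = - axis a 1 $ 2 * harm i x + axis a 1 $ 3 * cos (x$2) * harm_ph i x" for a
    using exhaust_3[of i]
    by (elim disjE; hypsubst; unfold fun_harm;
        rule_tac trans, rule_tac pd_eqI) (auto intro!: derivative_eq_intros has_derivative_coord simp: algebra_simps)
  have t: "cos (x$2) * (cos (x$2) * z) = z - sin (x$2) * (sin (x$2) * z)" for z
    using sin_cos_squared_add[of "x$2"] by algebra
  have 3: "pd a (harm_ph i) x = - axis a 1 $ 3 * (sin (x$2) * harm i x + cos (x$2) * harm_th i x)" for a
    using exhaust_3[of i]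
    by (elim disjE; hypsubst; unfold fun_harm;
        rule_tac trans, rule_tac pd_eqI) (auto intro!: derivative_eq_intros has_derivative_coord simp: algebra_simps t)
  show "pd 1 (harm i) x = 0" "pd 2 (harm i) x = harm_th i x" "pd 3 (harm i) x = sin (x$2) * harm_ph i x"
    "pd 1 (harm_th i) x = 0" "pd 2 (harm_th i) x = - harm i x" "pd 3 (harm_th i) x = cos (x$2) * harm_ph i x"
    "pd 1 (harm_ph i) x = 0" "pd 2 (harm_ph i) x = 0"
    "pd 3 (harm_ph i) x = - (sin (x$2) * harm i x + cos (x$2) * harm_th i x)"
    by (simp_all add: 1 2 3)
qed

lemma rot_nth:
  assumes "x \<in> chart"
  shows "rot i x $ 1 = 0" "rot i x $ 2 = harm_ph i x" "rot i x $ 3 = - (1 / sin (x$2)) * harm_th i x"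
  using chart_sin[OF assms] by (simp_all add: rot_def pd_harm)

lemma boost_nth:
  assumes "x \<in> chart"
  shows "boost i x $ 1 = harm i x" "boost i x $ 2 = sinh (x$1) / cosh (x$1) * harm_th i x"
    "boost i x $ 3 = sinh (x$1) / cosh (x$1) * (1 / sin (x$2)) * harm_ph i x"
  using chart_sin[OF assms]
  by (simp_all add: boost_def sum_3 h0inv_simps[OF assms] pd_harm power2_eq_square divide_simps)

lemma smooth_chart_inv_sin: "smooth_chart (\<lambda>x. 1 / sin (x$2))"
  using chart_sin by (force intro!: smooth_chart_intros)

lemma smooth_chart_tanh: "smooth_chart (\<lambda>x. sinh (x$1) / cosh (x$1))"
  by (intro smooth_chart_intros) simp

lemma smooth_chart_harm: "smooth_chart (harm i)" "smooth_chart (harm_th i)" "smooth_chart (harm_ph i)"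
  unfolding smooth_chart_def using C_on_harm C_on_subset by blast+

lemma pd_inv_sin:
  assumes x: "x \<in> chart"
  shows "pd c (\<lambda>x. 1 / sin (x$2)) x = (if c = 2 then - cos (x$2) / (sin (x$2))^2 else 0)"
proof -
  have "curl_fac 2 = (\<lambda>x. - (1 / sin (x$2)))" by (simp add: fun_eq_iff)
  moreover have "pd c (\<lambda>x. - (1 / sin (x$2))) x = - pd c (\<lambda>x. 1 / sin (x$2)) x"
    using pd_diff[of "\<lambda>x. 0" x "\<lambda>x. 1 / sin (x$2)" c] smooth_chart_differentiable[OF smooth_chart_inv_sin x] by simp
  ultimately show ?thesis using pd_curl_fac(2)[OF x, of c] by auto
qed

lemma pd_tanh:
  assumes x: "x \<in> chart"
  shows "pd c (\<lambda>x. sinh (x$1) / cosh (x$1)) x = (if c = 1 then 1 / (cosh (x$1))^2 else 0)"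
proof -
  \<comment> \<open>This quotient is a Christoffel symbol, whose derivatives are already
    computed.\<close>
  have "pd c (\<lambda>x. sinh (x$1) / cosh (x$1)) x = pd c (christoffel 2 1 2) x"
    by (rule pd_cong[OF open_chart x]) (simp add: christoffel_eq)
  then show ?thesis by (simp add: pd_christoffel[OF x])
qed

lemma smooth_chart_rot: "smooth_chart (\<lambda>x. rot i x $ b)"
proof -
  note si = smooth_chart_intros(1,4,5) smooth_chart_inv_sin smooth_chart_harm
  show ?thesis using exhaust_3[of b]
  proof (elim disjE; hypsubst)
    show "smooth_chart (\<lambda>x. rot i x $ 1)" by (rule smooth_chart_cong[OF _ rot_nth(1)[symmetric]]) (rule si)
    show "smooth_chart (\<lambda>x. rot i x $ 2)" by (rule smooth_chart_cong[OF _ rot_nth(2)[symmetric]]) (rule si)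
    show "smooth_chart (\<lambda>x. rot i x $ 3)" by (rule smooth_chart_cong[OF _ rot_nth(3)[symmetric]]) (intro si)
  qed
qed

lemma smooth_chart_boost: "smooth_chart (\<lambda>x. boost i x $ b)"
proof -
  note si = smooth_chart_intros(1,4,5) smooth_chart_inv_sin smooth_chart_tanh smooth_chart_harm
  show ?thesis using exhaust_3[of b]
  proof (elim disjE; hypsubst)
    show "smooth_chart (\<lambda>x. boost i x $ 1)" by (rule smooth_chart_cong[OF _ boost_nth(1)[symmetric]]) (rule si)
    show "smooth_chart (\<lambda>x. boost i x $ 2)" by (rule smooth_chart_cong[OF _ boost_nth(2)[symmetric]]) (intro si)
    show "smooth_chart (\<lambda>x. boost i x $ 3)" by (rule smooth_chart_cong[OF _ boost_nth(3)[symmetric]]) (intro si)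
  qed
qed

lemma pd_rot_nth:
  assumes x: "x \<in> chart"
  shows "pd c (\<lambda>y. rot i y $ 1) x = 0" "pd c (\<lambda>y. rot i y $ 2) x = pd c (harm_ph i) x"
    "pd c (\<lambda>y. rot i y $ 3) x = - (1 / sin (x$2)) * pd c (harm_th i) x - pd c (\<lambda>x. 1 / sin (x$2)) x * harm_th i x"
proof -
  note df = smooth_chart_differentiable[OF _ x] smooth_chart_intros smooth_chart_inv_sin smooth_chart_harm
  show "pd c (\<lambda>y. rot i y $ 1) x = 0" using pd_cong[OF open_chart x rot_nth(1)] by simp
  show "pd c (\<lambda>y. rot i y $ 2) x = pd c (harm_ph i) x" using pd_cong[OF open_chart x rot_nth(2)] by simp
  have "pd c (\<lambda>y. rot i y $ 3) x = pd c (\<lambda>y. 0 - (1 / sin (y$2)) * harm_th i y) x"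
    using pd_cong[OF open_chart x rot_nth(3)] by simp
  also have "\<dots> = - (1 / sin (x$2)) * pd c (harm_th i) x - pd c (\<lambda>x. 1 / sin (x$2)) x * harm_th i x"
    by (subst pd_diff; (subst pd_mult)?) (simp_all add: df del: times_divide_eq_left times_divide_eq_right)
  finally show "pd c (\<lambda>y. rot i y $ 3) x = \<dots>" .
qed

lemma pd_boost_nth:
  assumes x: "x \<in> chart"
  shows "pd c (\<lambda>y. boost i y $ 1) x = pd c (harm i) x"
    "pd c (\<lambda>y. boost i y $ 2) x = pd c (\<lambda>x. sinh (x$1) / cosh (x$1)) x * harm_th i x + sinh (x$1) / cosh (x$1) * pd c (harm_th i) x"
    "pd c (\<lambda>y. boost i y $ 3) x = pd c (\<lambda>x. sinh (x$1) / cosh (x$1)) x * (1 / sin (x$2)) * harm_ph i x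
       + sinh (x$1) / cosh (x$1) * pd c (\<lambda>x. 1 / sin (x$2)) x * harm_ph i x
       + sinh (x$1) / cosh (x$1) * (1 / sin (x$2)) * pd c (harm_ph i) x"
proof -
  note df = smooth_chart_differentiable[OF _ x] smooth_chart_intros(5) smooth_chart_inv_sin smooth_chart_tanh smooth_chart_harm
  show "pd c (\<lambda>y. boost i y $ 1) x = pd c (harm i) x" using pd_cong[OF open_chart x boost_nth(1)] by simp
  have "pd c (\<lambda>y. boost i y $ 2) x = pd c (\<lambda>x. sinh (x$1) / cosh (x$1) * harm_th i x) x"
    by (rule pd_cong[OF open_chart x boost_nth(2)])
  then show "pd c (\<lambda>y. boost i y $ 2) x = pd c (\<lambda>x. sinh (x$1) / cosh (x$1)) x * harm_th i x + sinh (x$1) / cosh (x$1) * pd c (harm_th i) x"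
    by (simp only: pd_mult df)
  have "pd c (\<lambda>y. boost i y $ 3) x = pd c (\<lambda>x. sinh (x$1) / cosh (x$1) * (1 / sin (x$2)) * harm_ph i x) x"
    by (rule pd_cong[OF open_chart x boost_nth(3)])
  then show "pd c (\<lambda>y. boost i y $ 3) x = pd c (\<lambda>x. sinh (x$1) / cosh (x$1)) x * (1 / sin (x$2)) * harm_ph i x
       + sinh (x$1) / cosh (x$1) * pd c (\<lambda>x. 1 / sin (x$2)) x * harm_ph i x
       + sinh (x$1) / cosh (x$1) * (1 / sin (x$2)) * pd c (harm_ph i) x"
    by (simp only: pd_mult df distrib_right)
qed

lemma killing_dual_rot: "killing_dual (rot i) (boost i)"
  unfolding killing_dual_def
proof (intro conjI allI ballI smooth_chart_rot)
  fix x c b assume x: "x \<in> chart"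
  have sn: "sin (x$2) \<noteq> 0" using chart_sin[OF x] by simp
  have cc: "cos (x$2) * cos (x$2) = 1 - sin (x$2) * sin (x$2)" "cos (x$2) * (cos (x$2) * z) = z - sin (x$2) * (sin (x$2) * z)" for z
    using sin_cos_squared_add[of "x$2"] by algebra+
  show "pd c (\<lambda>y. rot i y $ b) x + (\<Sum>e\<in>UNIV. christoffel b c e x * rot i x $ e)
      = diag_inv b x * (\<Sum>e\<in>UNIV. eps c b e x * boost i x $ e)"
    unfolding sum_3 eps_eq using exhaust_3[of b] exhaust_3[of c] sn
    by (elim disjE; hypsubst; simp add: pd_rot_nth[OF x] rot_nth[OF x] boost_nth[OF x] pd_harm pd_inv_sin[OF x] christoffel_eq[OF x]
       power2_eq_square divide_simps; (simp add: algebra_simps cc)?)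
qed

text \<open>Passing to the dual twice gives a minus sign (the complex structure of the Lorentz
  algebra); hence the partner of the boost is minus the rotation.\<close>

lemma killing_dual_boost: "killing_dual (boost i) (\<lambda>x. - rot i x)"
  unfolding killing_dual_def
proof (intro conjI allI ballI smooth_chart_boost)
  fix x c b assume x: "x \<in> chart"
  have sn: "sin (x$2) \<noteq> 0" using chart_sin[OF x] by simp
  have cc: "cos (x$2) * cos (x$2) = 1 - sin (x$2) * sin (x$2)" "cos (x$2) * (cos (x$2) * z) = z - sin (x$2) * (sin (x$2) * z)" for z
    using sin_cos_squared_add[of "x$2"] by algebra+
  have ch: "sinh (x$1) * sinh (x$1) = cosh (x$1) * cosh (x$1) - 1" "sinh (x$1) * (sinh (x$1) * z) = cosh (x$1) * (cosh (x$1) * z) - z" for z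
    using hyperbolic_pythagoras[of "x$1"] by algebra+
  show "pd c (\<lambda>y. boost i y $ b) x + (\<Sum>e\<in>UNIV. christoffel b c e x * boost i x $ e)
      = diag_inv b x * (\<Sum>e\<in>UNIV. eps c b e x * (- rot i x) $ e)"
    unfolding sum_3 eps_eq using exhaust_3[of b] exhaust_3[of c] sn
    by (elim disjE; hypsubst; simp add: pd_boost_nth[OF x] rot_nth[OF x] boost_nth[OF x] pd_harm pd_inv_sin[OF x] pd_tanh[OF x] christoffel_eq[OF x]
       power2_eq_square divide_simps; (simp add: algebra_simps cc ch)?)
qed

subsection \<open>Stokes' theorem on a cut\<close>

text \<open>The extension of \<open>f\<close> varies with the point but agrees with \<open>f\<close>
  on \<open>M\<close>, where \<open>g\<close> takes its values; near each point the composite is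
  therefore one of smooth functions.\<close>

lemma smooth_on_compose:
  fixes f :: "'b::euclidean_space \<Rightarrow> real" and g :: "'a::euclidean_space \<Rightarrow> 'b"
  assumes f: "smooth_on M f" and U: "open U" and g: "\<And>k. C_on k U g" and gM: "\<And>x. x \<in> U \<Longrightarrow> g x \<in> M"
  shows "C_on k U (\<lambda>x. f (g x))"
proof (rule C_on_local)
  fix x assume x: "x \<in> U"
  obtain V F where V: "open V" "g x \<in> V" "\<forall>k. C_on k V F" "\<forall>q\<in>V \<inter> M. F q = f q"
    using f gM[OF x] unfolding smooth_on_def by blast
  have o: "open (U \<inter> g -` V)"
    using continuous_open_preimage[OF C_on_continuous[OF g] U V(1)] .
  have "C_on k (U \<inter> g -` V) (\<lambda>x. F (g x))"
    by (rule C_on_compose[OF o]) (use V(3) g in \<open>auto intro: C_on_subset\<close>)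
  moreover have "\<forall>y\<in>U \<inter> g -` V. F (g y) = f (g y)" using V(4) gM by auto
  ultimately show "\<exists>W h. open W \<and> x \<in> W \<and> C_on k W h \<and> (\<forall>y\<in>W. h y = f (g y))"
    using o x V(2) by (intro exI[of _ "U \<inter> g -` V"] exI[of _ "\<lambda>x. F (g x)"]) auto
qed

section \<open>Spherical coordinates on a cut and its vector area element\<close>

definition sph :: "real \<times> real \<Rightarrow> real^3" where
  "sph y = (\<chi> i. harm i (vector [0, fst y, snd y]))"

lemma sph_nth [simp]:
  "sph y $ 1 = cos (fst y)" "sph y $ 2 = sin (fst y) * cos (snd y)" "sph y $ 3 = sin (fst y) * sin (snd y)"
  by (simp_all add: sph_def harm_simps)

lemma norm_unit_coords:
  fixes v :: "real^3"
  assumes "v $ 1 = cos u" "v $ 2 = sin u * cos w" "v $ 3 = sin u * sin w"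
  shows "norm v = 1"
proof -
  have "v \<bullet> v = cos u * cos u + sin u * sin u * (cos w * cos w + sin w * sin w)"
    unfolding inner_vec_def sum_3 assms inner_real_def by algebra
  also have "\<dots> = 1" unfolding sin_cos_squared_add3 mult_1_right ..
  finally show ?thesis by (simp add: norm_eq_sqrt_inner)
qed

lemma sph_in_sphere: "sph y \<in> sphere 0 1"
  using norm_unit_coords[of "sph y" "fst y" "snd y"] by simp

lemma C_on_sph: "C_on k UNIV sph"
proof (rule C_on_vec[OF open_UNIV])
  fix i :: 3
  show "C_on k UNIV (\<lambda>y. sph y $ i)"
    using exhaust_3[of i]
    by (elim disjE; hypsubst; unfold sph_nth; intro C_on_intros C_on_linear[OF bounded_linear_fst] C_on_linear[OF bounded_linear_snd] open_UNIV)
qed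

lemma cut_pt_nth [simp]:
  "cut_pt T y $ 1 = T (sph y)" "cut_pt T y $ 2 = fst y" "cut_pt T y $ 3 = snd y"
  by (simp_all add: cut_pt_def sph_def)

lemma cut_pt_in_chart: "y \<in> angles \<Longrightarrow> cut_pt T y \<in> chart"
  by (auto simp: angles_def chart_def)

definition cut_d :: "(real^3 \<Rightarrow> real) \<Rightarrow> real \<times> real \<Rightarrow> real \<times> real \<Rightarrow> real" where
  "cut_d T w y = frechet_derivative (\<lambda>y. T (sph y)) (at y) w"

lemma metric_eq: "metric x u v = - (u$1 * v$1) + (cosh (x$1))^2 * (u$2 * v$2) + (cosh (x$1))^2 * (sin (x$2))^2 * (u$3 * v$3)"
  by (simp add: metric_def sum_3)

context
  fixes T :: "real^3 \<Rightarrow> real"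
  assumes T: "smooth_on (sphere 0 1) T"
begin

lemma C_on_cut_height: "C_on k UNIV (\<lambda>y. T (sph y))"
  by (rule smooth_on_compose[OF T open_UNIV C_on_sph sph_in_sphere])

lemma C_on_cut_d: "C_on k UNIV (cut_d T w)"
  using C_on_cut_height[of "Suc k"] unfolding C_on.simps cut_d_def[abs_def] by blast

lemma C_on_cut_pt: "C_on k UNIV (cut_pt T)"
proof (rule C_on_vec[OF open_UNIV])
  fix i :: 3
  show "C_on k UNIV (\<lambda>y. cut_pt T y $ i)"
    using exhaust_3[of i]
    by (elim disjE; hypsubst; unfold cut_pt_nth;
        intro C_on_cut_height C_on_linear[OF bounded_linear_fst] C_on_linear[OF bounded_linear_snd] open_UNIV)
qed

lemma cut_pt_has_derivative: "(cut_pt T has_derivative cut_tan T y) (at y)"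
  using C_on_SucD[OF C_on_cut_pt, of y] by (simp add: cut_tan_def[abs_def])

lemma cut_tan_nth:
  "cut_tan T y w $ 1 = cut_d T w y" "cut_tan T y w $ 2 = fst w" "cut_tan T y w $ 3 = snd w"
proof -
  have d: "((\<lambda>y. cut_pt T y $ i) has_derivative (\<lambda>w. cut_tan T y w $ i)) (at y)" for i
    by (rule bounded_linear.has_derivative[OF bounded_linear_vec_nth cut_pt_has_derivative])
  show "cut_tan T y w $ 1 = cut_d T w y"
    using fun_cong[OF frechet_derivative_at[OF d[of 1]], of w] unfolding cut_d_def cut_pt_nth .
  have "(\<lambda>w. cut_tan T y w $ 2) = fst"
    by (rule has_derivative_unique[OF d[of 2, unfolded cut_pt_nth]]) (intro derivative_intros)
  then show "cut_tan T y w $ 2 = fst w" by metis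
  have "(\<lambda>w. cut_tan T y w $ 3) = snd"
    by (rule has_derivative_unique[OF d[of 3, unfolded cut_pt_nth]]) (intro derivative_intros)
  then show "cut_tan T y w $ 3 = snd w" by metis
qed

text \<open>The vector area element is the volume form contracted with the two coordinate tangents,
  with an index raised. Hence it contains no square root and is at most linear in the derivatives of
  \<open>T\<close>.\<close>

lemma area_density_normal:
  assumes n: "unit_future_normal T n" and y: "y \<in> angles"
  shows "area_density T y * (n y $ 1) = (cosh (T (sph y)))^2 * sin (fst y)"
    "area_density T y * (n y $ 2) = sin (fst y) * cut_d T (1,0) y"
    "area_density T y * (n y $ 3) = cut_d T (0,1) y / sin (fst y)"
proof -
  define a b c s where "a = cut_d T (1,0) y" "b = cut_d T (0,1) y" "c = (cosh (T (sph y)))^2" "s = sin (fst y)"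
  have s: "s > 0" using chart_sin[OF cut_pt_in_chart[OF y, of T]] by (simp add: a_b_c_s_def)
  have c: "c > 0" by (simp add: a_b_c_s_def)
  have N: "metric (cut_pt T y) (n y) (n y) = -1" "\<And>w. metric (cut_pt T y) (n y) (cut_tan T y w) = 0" and n1: "(n y $ 1) > 0"
    using n y by (auto simp: unit_future_normal_def)
  have e2: "c * (n y $ 2) = (n y $ 1) * a" using N(2)[of "(1,0)"] by (simp add: metric_eq cut_tan_nth a_b_c_s_def)
  have e3: "c * s^2 * (n y $ 3) = (n y $ 1) * b" using N(2)[of "(0,1)"] by (simp add: metric_eq cut_tan_nth a_b_c_s_def)
  have e1: "- ((n y $ 1)^2) + c * (n y $ 2)^2 + c * s^2 * (n y $ 3)^2 = -1"
    using N(1) by (simp add: metric_eq cut_tan_nth a_b_c_s_def power2_eq_square)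
  define q where "q = (c - a^2) * (c * s^2 - b^2) - (a * b)^2"
  have A: "area_density T y = sqrt q"
    by (simp add: area_density_def Let_def metric_eq cut_tan_nth a_b_c_s_def q_def power2_eq_square)
  \<comment> \<open>Orthogonality expresses the angular components of \<open>n\<close> by its first
    one; the normalisation then makes the Gram determinant \<open>q\<close> a perfect square, and
    \<open>n y $ 1 > 0\<close> fixes the sign of the root.\<close>
  have "(n y $ 1)^2 * q = c * (c * s^2 * (n y $ 1)^2 - s^2 * ((n y $ 1) * a)^2 - ((n y $ 1) * b)^2)"
    by (simp add: q_def algebra_simps power2_eq_square)
  also have "\<dots> = c^2 * s^2 * ((n y $ 1)^2 - c * (n y $ 2)^2 - c * s^2 * (n y $ 3)^2)"
    unfolding e2[symmetric] e3[symmetric] by (simp add: algebra_simps power2_eq_square)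
  also have "(n y $ 1)^2 - c * (n y $ 2)^2 - c * s^2 * (n y $ 3)^2 = 1" using e1 by linarith
  also have "c^2 * s^2 * 1 = (c * s)^2" by (simp add: power_mult_distrib)
  finally have "q = (c * s / (n y $ 1))^2" using n1 by (simp add: field_simps)
  then have A': "area_density T y = c * s / (n y $ 1)" unfolding A using n1 c s by (simp add: real_sqrt_unique)
  then show "area_density T y * (n y $ 1) = (cosh (T (sph y)))^2 * sin (fst y)"
    using n1 by (simp add: a_b_c_s_def)
  have "(n y $ 2) = (n y $ 1) * a / c" using e2 c by (simp add: field_simps)
  then have "area_density T y * (n y $ 2) = s * a" unfolding A' using n1 c by (simp add: field_simps)
  then show "area_density T y * (n y $ 2) = sin (fst y) * cut_d T (1,0) y" by (simp add: a_b_c_s_def)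
  have "(n y $ 3) = (n y $ 1) * b / (c * s^2)" using e3 c s by (simp add: field_simps)
  then have "area_density T y * (n y $ 3) = b / s" unfolding A' using n1 c s by (simp add: field_simps power2_eq_square)
  then show "area_density T y * (n y $ 3) = cut_d T (0,1) y / sin (fst y)" by (simp add: a_b_c_s_def)
qed

end

text \<open>By \<open>contract_curl\<close> for the traceless \<open>B2\<close>, the two integrands
  add up to the normal component of the dual of the exterior derivative of \<open>w\<close>. The
  area element cancels \<open>curl_fac\<close> and leaves the coefficients of the pullback of that
  two-form to the graph of \<open>T\<close>: one, and minus the two derivatives of
  \<open>T\<close>.\<close>

lemma flux_integrand:
  assumes s: "smooth_chart s" and h: "smooth_tens2 h" "sym_tens2 h" and vac: "asymptotic_vacuum s h"
    and X: "killing_dual X Y" and T: "smooth_on (sphere 0 1) T" and n: "unit_future_normal T n" and y: "y \<in> angles"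
  defines "w \<equiv> contract (B2 s h) X"
  shows "area_density T y * (\<Sum>a\<in>UNIV. \<Sum>b\<in>UNIV. (E2 s h a b (cut_pt T y) - s (cut_pt T y) * E1 s a b (cut_pt T y)) * X (cut_pt T y) $ a * n y $ b)
     + area_density T y * (\<Sum>a\<in>UNIV. \<Sum>b\<in>UNIV. B2 s h a b (cut_pt T y) * Y (cut_pt T y) $ a * n y $ b)
     = ext_deriv w 1 (cut_pt T y) - cut_d T (1,0) y * ext_deriv w 2 (cut_pt T y) - cut_d T (0,1) y * ext_deriv w 3 (cut_pt T y)"
proof -
  define x where "x = cut_pt T y"
  have x: "x \<in> chart" using y by (simp add: x_def cut_pt_in_chart)
  have x12: "x $ 1 = T (sph y)" "x $ 2 = fst y" by (simp_all add: x_def)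
  have sn: "sin (x$2) \<noteq> 0" using chart_sin[OF x] by simp
  let ?E = "\<lambda>a b. E2 s h a b x - s x * E1 s a b x"
  \<comment> \<open>The flux contracts the Killing vector with the first index,
    \<open>contract\<close> with the second, so both tensors must be symmetric.\<close>
  have Esym: "?E a b = ?E b a" for a b
  proof -
    have "h a b x = h b a x" using h(2) x by (auto simp: sym_tens2_def)
    then show ?thesis by (simp add: E1_def E2_def hess_sym[OF s x, of a b] h0_def)
  qed
  have V: "(\<Sum>a\<in>UNIV. ?E a b * X x $ a) + (\<Sum>a\<in>UNIV. B2 s h a b x * Y x $ a) = curl_fac b x * ext_deriv w b x" for b
  proof -
    have "(\<Sum>a\<in>UNIV. ?E a b * X x $ a) = contract (curl (B2 s h)) X b x"
      unfolding contract_def curl_B2[OF s h vac x] by (subst Esym) simp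
    also have "\<dots> = curl_fac b x * ext_deriv w b x - contract (B2 s h) Y b x"
      unfolding w_def
      using contract_curl[of "B2 s h", OF _ B2_sym[OF s h vac x] X x, of b] B2_trace[OF s h vac x]
        smooth_tens2_curl[OF smooth_tens2_weyl_pot[OF s h]] by (simp add: B2_eq)
    also have "contract (B2 s h) Y b x = (\<Sum>a\<in>UNIV. B2 s h a b x * Y x $ a)"
      unfolding contract_def by (subst B2_sym[OF s h vac x]) simp
    finally show ?thesis by simp
  qed
  note A = area_density_normal[OF T n y, folded x12]
  have "area_density T y * (\<Sum>a\<in>UNIV. \<Sum>b\<in>UNIV. ?E a b * X x $ a * n y $ b)
     + area_density T y * (\<Sum>a\<in>UNIV. \<Sum>b\<in>UNIV. B2 s h a b x * Y x $ a * n y $ b)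
     = (\<Sum>b\<in>UNIV. (area_density T y * n y $ b) * ((\<Sum>a\<in>UNIV. ?E a b * X x $ a) + (\<Sum>a\<in>UNIV. B2 s h a b x * Y x $ a)))"
    unfolding sum_3 by (simp add: algebra_simps)
  also have "\<dots> = ext_deriv w 1 x - cut_d T (1,0) y * ext_deriv w 2 x - cut_d T (0,1) y * ext_deriv w 3 x"
    unfolding V unfolding sum_3 A using sn by (simp add: divide_simps) (simp add: algebra_simps)?
  finally show ?thesis unfolding x_def .
qed

section \<open>Green's theorem on the coordinate rectangle\<close>

lemma integral_partial_derivative:
  fixes W :: "real \<times> real \<Rightarrow> real"
  assumes W: "C_on 1 UNIV W" and ab: "a \<le> b"
  shows "integral {a..b} (\<lambda>u. frechet_derivative W (at (u, v)) (1, 0)) = W (b, v) - W (a, v)"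
    "integral {a..b} (\<lambda>u. frechet_derivative W (at (v, u)) (0, 1)) = W (v, b) - W (v, a)"
proof -
  have dW: "(W has_derivative frechet_derivative W (at y)) (at y)" for y
    using C_on_SucD[of 0 UNIV W y] W by simp
  have lin: "linear (frechet_derivative W (at y))" for y
    using dW has_derivative_linear by blast
  have "((\<lambda>u. W (u, v)) has_vector_derivative frechet_derivative W (at (u, v)) (1, 0)) (at u within {a..b})" for u
  proof -
    have g: "((\<lambda>u. (u, v)) has_derivative (\<lambda>d. (d, 0))) (at u within {a..b})"
      by (intro derivative_eq_intros) auto
    have l: "frechet_derivative W (at (u, v)) (d, 0) = d * frechet_derivative W (at (u, v)) (1, 0)" for d
      using linear_scale[OF lin, of "(u, v)" d "(1, 0)"] by simp
    show ?thesis
      unfolding has_vector_derivative_def real_scaleR_def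
      by (rule has_derivative_eq_rhs[OF has_derivative_compose[OF g dW]]) (rule ext, rule l)
  qed
  from fundamental_theorem_of_calculus[OF ab this]
  show "integral {a..b} (\<lambda>u. frechet_derivative W (at (u, v)) (1, 0)) = W (b, v) - W (a, v)"
    by (rule integral_unique)
  have "((\<lambda>u. W (v, u)) has_vector_derivative frechet_derivative W (at (v, u)) (0, 1)) (at u within {a..b})" for u
  proof -
    have g: "((\<lambda>u. (v, u)) has_derivative (\<lambda>d. (0, d))) (at u within {a..b})"
      by (intro derivative_eq_intros) auto
    have l: "frechet_derivative W (at (v, u)) (0, d) = d * frechet_derivative W (at (v, u)) (0, 1)" for d
      using linear_scale[OF lin, of "(v, u)" d "(0, 1)"] by simp
    show ?thesis
      unfolding has_vector_derivative_def real_scaleR_def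
      by (rule has_derivative_eq_rhs[OF has_derivative_compose[OF g dW]]) (rule ext, rule l)
  qed
  from fundamental_theorem_of_calculus[OF ab this]
  show "integral {a..b} (\<lambda>u. frechet_derivative W (at (v, u)) (0, 1)) = W (v, b) - W (v, a)"
    by (rule integral_unique)
qed

text \<open>Green's theorem for \<open>P d\<theta> + Q d\<phi>\<close> with no boundary
  contribution: the sides \<phi> = 0 and \<phi> = 2\<pi> cancel by periodicity, and on the sides
  over the poles \<open>Q\<close> is zero.\<close>

lemma green_angles:
  fixes P Q :: "real \<times> real \<Rightarrow> real"
  assumes P: "C_on 1 UNIV P" and Q: "C_on 1 UNIV Q"
    and Pper: "\<And>u. P (u, 2 * pi) = P (u, 0)" and Q0: "\<And>v. Q (0, v) = 0" "\<And>v. Q (pi, v) = 0"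
  defines "D \<equiv> \<lambda>y. frechet_derivative Q (at y) (1, 0) - frechet_derivative P (at y) (0, 1)"
  shows "set_integrable lborel angles D" "(LINT y:angles|lborel. D y) = 0"
proof -
  let ?C = "cbox (0, 0) (pi, 2 * pi) :: (real \<times> real) set"
  have cQ: "continuous_on S (\<lambda>y. frechet_derivative Q (at y) (1, 0))" for S
    using Q unfolding One_nat_def C_on.simps by (blast intro: continuous_on_subset)
  have cP: "continuous_on S (\<lambda>y. frechet_derivative P (at y) (0, 1))" for S
    using P unfolding One_nat_def C_on.simps by (blast intro: continuous_on_subset)
  have cD: "continuous_on S D" for S unfolding D_def by (intro continuous_intros cP cQ)
  have box: "angles = box (0, 0) (pi, 2 * pi)"
    by (auto simp: angles_def mem_box Basis_prod_def)
  have "set_integrable lborel ?C D"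
    using borel_integrable_compact[OF compact_cbox cD, of "(0,0)" "(pi, 2 * pi)"]
    unfolding set_integrable_def by (simp add: indicator_def if_distrib[of "\<lambda>u. u *\<^sub>R _"] if_distribR cong: if_cong)
  then show int: "set_integrable lborel angles D"
    by (rule set_integrable_subset) (auto simp: box box_subset_cbox)
  have "(LINT y:angles|lborel. D y) = integral angles D"
    using set_borel_integral_eq_integral(2)[OF int] .
  also have "\<dots> = integral ?C D" unfolding box by (rule integral_open_interval)
  also have "\<dots> = integral ?C (\<lambda>y. frechet_derivative Q (at y) (1, 0)) - integral ?C (\<lambda>y. frechet_derivative P (at y) (0, 1))"
    unfolding D_def by (intro Henstock_Kurzweil_Integration.integral_diff integrable_continuous cP cQ)
  also have "integral ?C (\<lambda>y. frechet_derivative P (at y) (0, 1)) = 0"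
    using integral_prod_continuous[OF cP, of 0 0 pi "2 * pi"] integral_partial_derivative(2)[OF P, of 0 "2 * pi"] Pper
    by (simp add: case_prod_unfold)
  also have "integral ?C (\<lambda>y. frechet_derivative Q (at y) (1, 0)) = 0"
  proof -
    have "continuous_on (cbox (0, 0) (pi, 2 * pi)) (\<lambda>(u, v). frechet_derivative Q (at (u, v)) (1, 0))"
      using cQ by (simp add: case_prod_unfold)
    \<comment> \<open>The \<theta>-derivative has to be integrated over \<theta> first, so the order
      of integration is exchanged.\<close>
    from integral_swap_continuous[OF this]
    show ?thesis
      using integral_prod_continuous[OF cQ, of 0 0 pi "2 * pi"] integral_partial_derivative(1)[OF Q, of 0 pi] Q0
      by (simp add: case_prod_unfold)
  qed
  finally show "(LINT y:angles|lborel. D y) = 0" by simp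
qed

lemma cut_d_boundary:
  assumes T: "smooth_on (sphere 0 1) T"
  shows "cut_d T (0, 1) (0, v) = 0" "cut_d T (0, 1) (pi, v) = 0" "cut_d T w (u, 2 * pi) = cut_d T w (u, 0)"
proof -
  have d: "((\<lambda>y. T (sph y)) has_derivative (\<lambda>w. cut_d T w y)) (at y)" for y
    using C_on_SucD[OF C_on_cut_height[OF T], of y] by (simp add: cut_d_def[abs_def])
  \<comment> \<open>At a pole \<open>sph\<close> does not depend on \<phi>, so the height of the cut
    is constant along this coordinate line.\<close>
  have c: "cut_d T (0, 1) (u, v) = 0" if "\<And>v. sph (u, v) = sph (u, 0)" for u
  proof -
    have g: "((\<lambda>v. (u, v)) has_derivative (\<lambda>d. (0, d))) (at v)"
      by (intro derivative_eq_intros) auto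
    have "((\<lambda>v. T (sph (u, v))) has_derivative (\<lambda>d. cut_d T (0, d) (u, v))) (at v)"
      using has_derivative_compose[OF g d] .
    moreover have "((\<lambda>v. T (sph (u, v))) has_derivative (\<lambda>d. 0)) (at v)"
      by (subst that) simp
    ultimately show ?thesis using has_derivative_unique by metis
  qed
  show "cut_d T (0, 1) (0, v) = 0" "cut_d T (0, 1) (pi, v) = 0"
    by (rule c, simp add: vec_eq_iff forall_3)+
  have g: "((\<lambda>y. y + (0, 2 * pi)) has_derivative (\<lambda>d. d)) (at (u, 0::real))"
    by (intro derivative_eq_intros) auto
  have "((\<lambda>y. T (sph (y + (0, 2 * pi)))) has_derivative (\<lambda>w. cut_d T w ((u, 0) + (0, 2 * pi)))) (at (u, 0))"
    using has_derivative_compose[OF g d] .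
  moreover have "sph (y + (0, 2 * pi)) = sph y" for y
    by (simp add: vec_eq_iff forall_3)
  ultimately have "((\<lambda>y. T (sph y)) has_derivative (\<lambda>w. cut_d T w (u, 2 * pi))) (at (u, 0))" by simp
  then show "cut_d T w (u, 2 * pi) = cut_d T w (u, 0)" using has_derivative_unique[OF d] by metis
qed

text \<open>What Stokes' theorem on the coordinate rectangle needs of a one-form: near the poles the
  \<open>\<phi>\<close>-component of a one-form that is smooth on the sphere tends to \<open>0\<close>.\<close>

definition regular_form :: "tens1 \<Rightarrow> bool" where
  "regular_form w \<longleftrightarrow> (\<forall>a k. C_on k UNIV (w a)) \<and>
     (\<forall>a t u. w a (vector [t, u, 2 * pi]) = w a (vector [t, u, 0])) \<and>
     (\<forall>t v. w 3 (vector [t, 0, v]) = 0 \<and> w 3 (vector [t, pi, v]) = 0)"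

text \<open>\<open>P\<close> and \<open>Q\<close> are the components of the pullback of
  \<open>w\<close> to the cut, and \<open>D\<close> is the pullback of its exterior derivative. As
  these operations commute, Green's theorem applies.\<close>

lemma stokes_cut:
  assumes T: "smooth_on (sphere 0 1) T" and w: "regular_form w"
  defines "D \<equiv> \<lambda>y. ext_deriv w 1 (cut_pt T y) - cut_d T (1,0) y * ext_deriv w 2 (cut_pt T y) - cut_d T (0,1) y * ext_deriv w 3 (cut_pt T y)"
  shows "set_integrable lborel angles D" "(LINT y:angles|lborel. D y) = 0"
proof -
  define P where "P y = w 2 (cut_pt T y) + cut_d T (1,0) y * w 1 (cut_pt T y)" for y
  define Q where "Q y = w 3 (cut_pt T y) + cut_d T (0,1) y * w 1 (cut_pt T y)" for y
  have cw: "C_on k UNIV (w a)" for k a using w by (simp add: regular_form_def)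
  have wc: "C_on k UNIV (\<lambda>y. w a (cut_pt T y))" for k a
    by (rule C_on_compose[OF open_UNIV cw C_on_cut_pt[OF T]]) simp
  have CP: "C_on k UNIV P" for k unfolding P_def[abs_def] by (intro C_on_intros wc C_on_cut_d[OF T] open_UNIV)
  have CQ: "C_on k UNIV Q" for k unfolding Q_def[abs_def] by (intro C_on_intros wc C_on_cut_d[OF T] open_UNIV)
  have cp: "cut_pt T (u, 2 * pi) = vector [T (sph (u, 0)), u, 2 * pi]" "cut_pt T (u, 0) = vector [T (sph (u, 0)), u, 0]"
    "cut_pt T (u, v) = vector [T (sph (u, v)), u, v]" for u v
  proof -
    have "sph (u, 2 * pi) = sph (u, 0)" by (simp add: vec_eq_iff forall_3)
    then have "T (sph (u, 2 * pi)) = T (sph (u, 0))" by (rule arg_cong)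
    then show "cut_pt T (u, 2 * pi) = vector [T (sph (u, 0)), u, 2 * pi]" by (simp add: vec_eq_iff forall_3)
  qed (simp_all add: vec_eq_iff forall_3)
  have Pper: "P (u, 2 * pi) = P (u, 0)" for u
    unfolding P_def cut_d_boundary(3)[OF T] cp(1,2) using w by (simp add: regular_form_def)
  have Q0: "Q (0, v) = 0" "Q (pi, v) = 0" for v
    unfolding Q_def cut_d_boundary(1,2)[OF T] cp(3) using w by (simp_all add: regular_form_def)
  have dw: "((\<lambda>y. w a (cut_pt T y)) has_derivative (\<lambda>v. \<Sum>c\<in>UNIV. cut_tan T y v $ c * pd c (w a) (cut_pt T y))) (at y)" for a y
  proof -
    have f: "(w a has_derivative frechet_derivative (w a) (at (cut_pt T y))) (at (cut_pt T y))"
      using C_on_SucD[OF cw] by simp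
    have "frechet_derivative (w a) (at (cut_pt T y)) v = (\<Sum>c\<in>UNIV. v $ c * pd c (w a) (cut_pt T y))" for v
    proof -
      have l: "linear (frechet_derivative (w a) (at (cut_pt T y)))" using f has_derivative_linear by blast
      have "v = (\<Sum>c\<in>UNIV. v $ c *\<^sub>R axis c 1)" by (simp add: vec_eq_iff forall_3 sum_3)
      then have "frechet_derivative (w a) (at (cut_pt T y)) v
        = (\<Sum>c\<in>UNIV. v $ c *\<^sub>R frechet_derivative (w a) (at (cut_pt T y)) (axis c 1))"
        using linear_sum[OF l] linear_scale[OF l] by (metis (no_types, lifting) sum.cong)
      then show ?thesis by (simp add: pd_def)
    qed
    then show ?thesis using has_derivative_compose[OF cut_pt_has_derivative[OF T] f] by presburger
  qed
  have dd: "(cut_d T v has_derivative frechet_derivative (cut_d T v) (at y)) (at y)" for v y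
    using C_on_SucD[OF C_on_cut_d[OF T]] by simp
  \<comment> \<open>The second derivatives of \<open>T\<close> that enter are one mixed derivative
    from \<open>Q\<close> and one from \<open>P\<close>; they cancel.\<close>
  have mixed: "frechet_derivative (cut_d T (0,1)) (at y) (1,0) = frechet_derivative (cut_d T (1,0)) (at y) (0,1)" for y
    using frechet_derivative_symmetric[OF open_UNIV UNIV_I C_on_cut_height[OF T]] unfolding cut_d_def[abs_def] .
  have dQ: "frechet_derivative Q (at y) v = (\<Sum>c\<in>UNIV. cut_tan T y v $ c * pd c (w 3) (cut_pt T y))
     + (cut_d T (0,1) y * (\<Sum>c\<in>UNIV. cut_tan T y v $ c * pd c (w 1) (cut_pt T y))
        + frechet_derivative (cut_d T (0,1)) (at y) v * w 1 (cut_pt T y))" for y v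
    using fun_cong[OF frechet_derivative_at[OF has_derivative_add[OF dw[of 3 y] has_derivative_mult[OF dd[of "(0,1)" y] dw[of 1 y]]]], of v]
    unfolding Q_def[abs_def] by (rule sym)
  have dP: "frechet_derivative P (at y) v = (\<Sum>c\<in>UNIV. cut_tan T y v $ c * pd c (w 2) (cut_pt T y))
     + (cut_d T (1,0) y * (\<Sum>c\<in>UNIV. cut_tan T y v $ c * pd c (w 1) (cut_pt T y))
        + frechet_derivative (cut_d T (1,0)) (at y) v * w 1 (cut_pt T y))" for y v
    using fun_cong[OF frechet_derivative_at[OF has_derivative_add[OF dw[of 2 y] has_derivative_mult[OF dd[of "(1,0)" y] dw[of 1 y]]]], of v]
    unfolding P_def[abs_def] by (rule sym)
  have "frechet_derivative Q (at y) (1, 0) - frechet_derivative P (at y) (0, 1) = D y" for y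
    unfolding dP dQ mixed D_def ext_deriv_def sum_3 cut_tan_nth[OF T] by (simp add: algebra_simps)
  then show "set_integrable lborel angles D" "(LINT y:angles|lborel. D y) = 0"
    using green_angles[OF CP CQ Pper Q0] by simp_all
qed

text \<open>Integrability is available for the sum of the two flux integrands; this splits the
  integral without estimating either part.\<close>

lemma set_lebesgue_integral_eq_uminus:
  fixes f g :: "'a \<Rightarrow> real"
  assumes "set_integrable M A (\<lambda>x. f x + g x)" "(LINT x:A|M. f x + g x) = 0"
  shows "(LINT x:A|M. f x) = - (LINT x:A|M. g x)"
proof (cases "set_integrable M A f")
  case True
  then have "set_integrable M A g" using set_integral_diff(1)[OF assms(1) True] by simp
  then show ?thesis using set_integral_add(2)[OF True] assms(2) by simp
next
  \<comment> \<open>If one part is not integrable, neither is the other, and both Lebesgue integrals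
    take the default value \<open>0\<close>.\<close>
  case False
  have "\<not> set_integrable M A g" using set_integral_diff(1)[OF assms(1), of g] False by auto
  then show ?thesis using False
    unfolding set_lebesgue_integral_def set_integrable_def by (simp add: not_integrable_integral_eq)
qed

text \<open>\<open>w\<close> continues the contracted one-form over the poles. On the open set
  \<open>chart\<close> the two coincide, hence so do their exterior derivatives, and Stokes' theorem
  can be applied to \<open>w\<close>.\<close>

lemma flux_duality:
  assumes s: "smooth_chart s" and h: "smooth_tens2 h" "sym_tens2 h" and vac: "asymptotic_vacuum s h"
    and X: "killing_dual X Y" and T: "smooth_on (sphere 0 1) T" and n: "unit_future_normal T n"
    and w: "regular_form w" "\<And>a x. x \<in> chart \<Longrightarrow> contract (B2 s h) X a x = w a x"
  shows "flux T n (\<lambda>a b x. E2 s h a b x - s x * E1 s a b x) X = - flux T n (B2 s h) Y"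
proof -
  let ?D = "\<lambda>y. ext_deriv w 1 (cut_pt T y) - cut_d T (1,0) y * ext_deriv w 2 (cut_pt T y) - cut_d T (0,1) y * ext_deriv w 3 (cut_pt T y)"
  let ?f = "\<lambda>y. area_density T y * (\<Sum>a\<in>UNIV. \<Sum>b\<in>UNIV. (E2 s h a b (cut_pt T y) - s (cut_pt T y) * E1 s a b (cut_pt T y)) * X (cut_pt T y) $ a * n y $ b)"
  let ?g = "\<lambda>y. area_density T y * (\<Sum>a\<in>UNIV. \<Sum>b\<in>UNIV. B2 s h a b (cut_pt T y) * Y (cut_pt T y) $ a * n y $ b)"
  have "ext_deriv (contract (B2 s h) X) d x = ext_deriv w d x" if "x \<in> chart" for d x
    unfolding ext_deriv_def using pd_cong[OF open_chart that w(2)] by simp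
  then have fg: "?f y + ?g y = ?D y" if "y \<in> angles" for y
    using flux_integrand[OF s h vac X T n that] cut_pt_in_chart[OF that, of T] by simp
  have m: "angles \<in> sets lborel"
    unfolding angles_def by (simp add: borel_open open_Times)
  have "set_integrable lborel angles (\<lambda>y. ?f y + ?g y)"
    by (subst set_integrable_cong[OF refl refl fg]) (assumption, rule stokes_cut(1)[OF T w(1)])
  moreover have "(LINT y:angles|lborel. ?f y + ?g y) = (LINT y:angles|lborel. ?D y)"
    by (rule set_lebesgue_integral_cong[OF m]) (use fg in blast)
  then have "(LINT y:angles|lborel. ?f y + ?g y) = 0"
    unfolding stokes_cut(2)[OF T w(1)] .
  ultimately have "(LINT y:angles|lborel. ?f y) = - (LINT y:angles|lborel. ?g y)"
    by (rule set_lebesgue_integral_eq_uminus)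
  then show ?thesis unfolding flux_def .
qed

subsection \<open>Regularity at the poles\<close>

text \<open>Smoothness in the coordinates through and beyond the poles, with matching ends of the
  \<phi> range. This is weaker than coming from a smooth function on the sphere:
  \<open>harm_th\<close> and \<open>harm_ph\<close> qualify although they may depend on \<phi> at a
  pole.\<close>

definition smooth_periodic :: "scal \<Rightarrow> bool" where
  "smooth_periodic f \<longleftrightarrow> (\<forall>k. C_on k UNIV f) \<and> (\<forall>t u. f (vector [t, u, 2 * pi]) = f (vector [t, u, 0]))"

lemma smooth_periodic_intros:
  "smooth_periodic (\<lambda>x. c)"
  "smooth_periodic f \<Longrightarrow> smooth_periodic g \<Longrightarrow> smooth_periodic (\<lambda>x. f x + g x)"
  "smooth_periodic f \<Longrightarrow> smooth_periodic g \<Longrightarrow> smooth_periodic (\<lambda>x. f x - g x)"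
  "smooth_periodic f \<Longrightarrow> smooth_periodic (\<lambda>x. - f x)"
  "smooth_periodic f \<Longrightarrow> smooth_periodic g \<Longrightarrow> smooth_periodic (\<lambda>x. f x * g x)"
  "smooth_periodic f \<Longrightarrow> smooth_periodic g \<Longrightarrow> (\<And>x. g x \<noteq> 0) \<Longrightarrow> smooth_periodic (\<lambda>x. f x / g x)"
  "smooth_periodic f \<Longrightarrow> smooth_periodic (\<lambda>x. f x ^ n)"
  "(\<And>i. i \<in> I \<Longrightarrow> smooth_periodic (F i)) \<Longrightarrow> smooth_periodic (\<lambda>x. \<Sum>i\<in>I. F i x)"
  "smooth_periodic (harm i)" "smooth_periodic (harm_th i)" "smooth_periodic (harm_ph i)"
  "smooth_periodic (\<lambda>x. sin (x $ 2))" "smooth_periodic (\<lambda>x. cosh (x $ 1))" "smooth_periodic (\<lambda>x. sinh (x $ 1))"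
  unfolding smooth_periodic_def harm_th_def[of _ "vector _"] harm_ph_def[of _ "vector _"] harm_def[of _ "vector _"]
  by (auto intro!: C_on_intros C_on_divide C_on_harm)

text \<open>Ratio between the coordinate vectors and a frame that stays regular at the poles: only
  the \<phi> vector degenerates, by \<open>sin \<theta>\<close>.\<close>

definition pole_fac :: "3 \<Rightarrow> scal" where
  "pole_fac a x = (if a = 3 then sin (x $ 2) else 1)"

lemma pole_fac_simps [simp]: "pole_fac 1 x = 1" "pole_fac 2 x = 1" "pole_fac 3 x = sin (x$2)"
  by (simp_all add: pole_fac_def)

text \<open>The components in that frame extend over the poles. Only values on \<open>chart\<close>
  enter, so formulas with coordinate singularities qualify, and the factor makes the
  \<phi>-component of the extension vanish at the poles.\<close>

definition pole_regular :: "tens1 \<Rightarrow> bool" where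
  "pole_regular w \<longleftrightarrow> (\<exists>f. (\<forall>a. smooth_periodic (f a)) \<and> (\<forall>a. \<forall>x\<in>chart. w a x = pole_fac a x * f a x))"

lemma pole_regularI:
  "(\<And>a. smooth_periodic (f a)) \<Longrightarrow> (\<And>a x. x \<in> chart \<Longrightarrow> w a x = pole_fac a x * f a x) \<Longrightarrow> pole_regular w"
  unfolding pole_regular_def by blast

lemma pole_regular_add:
  assumes "pole_regular v" "pole_regular w"
  shows "pole_regular (\<lambda>a x. v a x + w a x)"
proof -
  obtain f g where f: "\<And>a. smooth_periodic (f a)" "\<And>a x. x \<in> chart \<Longrightarrow> v a x = pole_fac a x * f a x"
    and g: "\<And>a. smooth_periodic (g a)" "\<And>a x. x \<in> chart \<Longrightarrow> w a x = pole_fac a x * g a x"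
    using assms unfolding pole_regular_def by metis
  show ?thesis
    by (rule pole_regularI[of "\<lambda>a x. f a x + g a x"])
      (use f g in \<open>auto intro!: smooth_periodic_intros simp: distrib_left\<close>)
qed

lemma pole_regular_uminus:
  assumes "pole_regular v"
  shows "pole_regular (\<lambda>a x. - v a x)"
proof -
  obtain f where f: "\<And>a. smooth_periodic (f a)" "\<And>a x. x \<in> chart \<Longrightarrow> v a x = pole_fac a x * f a x"
    using assms unfolding pole_regular_def by metis
  show ?thesis
    by (rule pole_regularI[of "\<lambda>a x. - f a x"]) (use f in \<open>auto intro!: smooth_periodic_intros\<close>)
qed

lemma pole_regular_cong:
  "pole_regular v \<Longrightarrow> (\<And>a x. x \<in> chart \<Longrightarrow> w a x = v a x) \<Longrightarrow> pole_regular w"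
  unfolding pole_regular_def by simp

lemma pole_regular_imp_regular_form:
  assumes "pole_regular v"
  shows "\<exists>w. regular_form w \<and> (\<forall>a. \<forall>x\<in>chart. v a x = w a x)"
proof -
  obtain f where f: "\<And>a. smooth_periodic (f a)" "\<And>a x. x \<in> chart \<Longrightarrow> v a x = pole_fac a x * f a x"
    using assms unfolding pole_regular_def by metis
  have "smooth_periodic (pole_fac a)" for a
    unfolding pole_fac_def[abs_def] by (cases "a = 3") (auto intro: smooth_periodic_intros)
  then have "smooth_periodic (\<lambda>x. pole_fac a x * f a x)" for a
    by (intro smooth_periodic_intros f)
  then have "regular_form (\<lambda>a x. pole_fac a x * f a x)"
    unfolding regular_form_def smooth_periodic_def by auto
  then show ?thesis using f(2) by blast
qed

section \<open>The embedding, its regular frame, and pullbacks from the ambient space\<close>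

definition frame :: "3 \<Rightarrow> real^3 \<Rightarrow> real \<times> (real^3)" where
  "frame a x = (if a = 1 then (1, 0) else if a = 2 then (0, \<chi> i. harm_th i x) else (0, \<chi> i. harm_ph i x))"

lemma frame_simps: "frame 1 x = (1, 0)" "frame 2 x = (0, \<chi> i. harm_th i x)" "frame 3 x = (0, \<chi> i. harm_ph i x)"
  by (simp_all add: frame_def)

lemma smooth_periodic_frame: "smooth_periodic (\<lambda>x. frame a x \<bullet> v)"
  using exhaust_3[of a]
  by (elim disjE; hypsubst; cases v)
    (auto simp: frame_simps inner_vec_def sum_3 intro!: smooth_periodic_intros)

lemma C_on_emb: "C_on k UNIV emb"
  unfolding emb_def[abs_def]
proof (intro C_on_Pair open_UNIV C_on_vec[of _ _ "\<lambda>x. \<chi> i. harm i x"])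
  show "C_on k UNIV (\<lambda>x::real^3. x $ 1)" by (intro C_on_intros open_UNIV)
  show "C_on k UNIV (\<lambda>x. (\<chi> i. harm i x) $ i)" for i by (simp add: C_on_harm)
qed

lemma emb_has_derivative: "(emb has_derivative frechet_derivative emb (at x)) (at x)"
  using C_on_SucD[OF C_on_emb] by simp

lemma pd_emb_inner: "pd a (\<lambda>x. emb x \<bullet> v) x = pd a emb x \<bullet> v"
  using pd_eqI[OF bounded_linear.has_derivative[OF bounded_linear_inner_left emb_has_derivative]] by (simp add: pd_def)

lemma pd_emb: "pd a emb x = pole_fac a x *\<^sub>R frame a x"
proof -
  have d: "((\<lambda>x. \<chi> i. harm i x) has_derivative (\<lambda>v. \<chi> i. frechet_derivative (harm i) (at x) v)) (at x)"
  proof (subst has_derivative_componentwise_within, rule ballI)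
    fix b :: "real^3" assume "b \<in> Basis"
    then obtain i where b: "b = axis i 1" by (auto simp: Basis_vec_def)
    show "((\<lambda>x. (\<chi> i. harm i x) \<bullet> b) has_derivative (\<lambda>v. (\<chi> i. frechet_derivative (harm i) (at x) v) \<bullet> b)) (at x)"
      using C_on_SucD[OF C_on_harm(1)] by (simp add: b inner_axis)
  qed
  have "pd a emb x = (axis a 1 $ 1, \<chi> i. pd a (harm i) x)"
    unfolding emb_def[abs_def] pd_def[of a "harm _"]
    by (rule pd_eqI) (intro has_derivative_Pair has_derivative_coord d)
  then show ?thesis
    using exhaust_3[of a]
    by (elim disjE; hypsubst) (simp_all add: frame_simps pd_harm vec_eq_iff)
qed

lemma emb_nth: "fst (emb x) = x $ 1" "snd (emb x) $ i = harm i x" "snd (emb x) = (\<chi> i. harm i x)"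
  by (simp_all add: emb_def)

lemma norm_snd_emb: "norm (snd (emb x)) = 1"
  by (rule norm_unit_coords) (simp_all add: emb_nth harm_simps)

lemma emb_in_hyp: "emb x \<in> hyp"
  using norm_snd_emb[of x] unfolding hyp_def by (metis UNIV_I dist_0_norm mem_Times_iff mem_sphere)

definition off_axis :: "(real \<times> (real^3)) set" where
  "off_axis = {p. snd p \<noteq> 0}"

lemma open_off_axis: "open off_axis"
  unfolding off_axis_def by (intro open_Collect_neq continuous_intros)

lemma emb_off_axis: "emb x \<in> off_axis"
  using norm_snd_emb[of x] unfolding off_axis_def by auto

text \<open>Radial retraction onto \<open>hyp\<close>. Composition with it turns a field that is
  smooth on \<open>hyp\<close> into one smooth function on the open set \<open>off_axis\<close>,
  with unchanged values on \<open>hyp\<close>.\<close>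

definition rad :: "real \<times> (real^3) \<Rightarrow> real \<times> (real^3)" where
  "rad p = (fst p, sgn (snd p))"

lemma rad_emb: "rad (emb x) = emb x"
  using norm_snd_emb[of x] by (simp add: rad_def sgn_div_norm prod_eq_iff)

lemma C_on_rad: "C_on k off_axis rad"
  unfolding rad_def[abs_def]
  by (intro C_on_Pair C_on_sgn C_on_linear bounded_linear_fst bounded_linear_snd open_off_axis) (simp add: off_axis_def)

lemma rad_in_hyp: "p \<in> off_axis \<Longrightarrow> rad p \<in> hyp"
  by (simp add: rad_def hyp_def off_axis_def norm_sgn)

lemma smooth_periodic_emb:
  assumes "\<And>k. C_on k off_axis f"
  shows "smooth_periodic (\<lambda>x. f (emb x))"
proof -
  have "harm i (vector [t, u, 2 * pi]) = harm i (vector [t, u, 0])" for i t u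
    by (simp add: harm_def)
  then have "emb (vector [t, u, 2 * pi]) = emb (vector [t, u, 0])" for t u
    by (simp add: emb_def)
  moreover have "C_on k UNIV (\<lambda>x. f (emb x))" for k
    by (rule C_on_compose[OF open_UNIV assms C_on_emb emb_off_axis])
  ultimately show ?thesis unfolding smooth_periodic_def by simp
qed

text \<open>Pullback along \<open>emb\<close> of the ambient one-form with components
  \<open>\<mu> v\<close>.\<close>

definition amb_form :: "(real \<times> (real^3) \<Rightarrow> real \<times> (real^3) \<Rightarrow> real) \<Rightarrow> tens1" where
  "amb_form \<mu> a x = (\<Sum>v\<in>Basis. (pd a emb x \<bullet> v) * \<mu> v (emb x))"

lemma pole_regular_amb_form:
  assumes "\<And>v k. v \<in> Basis \<Longrightarrow> C_on k off_axis (\<mu> v)"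
  shows "pole_regular (amb_form \<mu>)"
proof (rule pole_regularI)
  show "smooth_periodic (\<lambda>x. \<Sum>v\<in>Basis. (frame a x \<bullet> v) * \<mu> v (emb x))" for a
    by (intro smooth_periodic_intros smooth_periodic_frame smooth_periodic_emb assms)
  show "amb_form \<mu> a x = pole_fac a x * (\<Sum>v\<in>Basis. (frame a x \<bullet> v) * \<mu> v (emb x))" for a x
    unfolding amb_form_def pd_emb by (simp add: sum_distrib_left mult.assoc)
qed

text \<open>The exterior derivative commutes with pullback, so it is the ambient one evaluated on
  two coordinate vectors and carries both of their pole factors. After multiplication by
  \<open>curl_fac\<close> exactly the factor demanded by \<open>pole_regular\<close> is
  left.\<close>

lemma pole_regular_curl_amb_form:
  assumes \<mu>: "\<And>v k. v \<in> Basis \<Longrightarrow> C_on k off_axis (\<mu> v)"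
  shows "pole_regular (\<lambda>d x. curl_fac d x * ext_deriv (amb_form \<mu>) d x)"
proof -
  define D where "D u v p = frechet_derivative (\<mu> v) (at p) u" for u v p
  \<comment> \<open>The ambient exterior derivative on two frame vectors, with the pole factors
    split off.\<close>
  define A where "A b c x = (\<Sum>v\<in>Basis. \<Sum>u\<in>Basis.
      ((frame b x \<bullet> u) * (frame c x \<bullet> v) - (frame c x \<bullet> u) * (frame b x \<bullet> v)) * D u v (emb x))" for b c x
  have D: "C_on k off_axis (D u v)" if "v \<in> Basis" for k u v
    using \<mu>[OF that, of "Suc k"] unfolding C_on.simps D_def[abs_def] by blast
  have smA: "smooth_periodic (A b c)" for b c
    unfolding A_def[abs_def] by (intro smooth_periodic_intros smooth_periodic_frame smooth_periodic_emb D)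
  have pdmu: "pd c (\<lambda>x. \<mu> v (emb x)) x = (\<Sum>u\<in>Basis. (pd c emb x \<bullet> u) * D u v (emb x))" if v: "v \<in> Basis" for c v x
  proof -
    have f: "(\<mu> v has_derivative frechet_derivative (\<mu> v) (at (emb x))) (at (emb x))"
      using C_on_SucD[OF \<mu>[OF v] emb_off_axis] .
    have "pd c (\<lambda>x. \<mu> v (emb x)) x = frechet_derivative (\<mu> v) (at (emb x)) (pd c emb x)"
      using pd_compose[of "\<mu> v" _ emb x, OF f] emb_has_derivative by (auto simp: differentiable_def)
    also have "\<dots> = (\<Sum>u\<in>Basis. (pd c emb x \<bullet> u) * D u v (emb x))"
      using Linear_Algebra.linear_componentwise[OF has_derivative_linear[OF f], of "pd c emb x" 1] by (simp add: D_def)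
    finally show ?thesis .
  qed
  have smE: "C_on k UNIV (\<lambda>x. emb x \<bullet> v)" for k v
    by (rule C_on_blinear[OF bounded_linear_inner_left open_UNIV C_on_emb])
  have dE: "pd e (\<lambda>x. emb x \<bullet> v) differentiable at x" for e v x
    by (rule C_on_differentiable[of UNIV]) (use C_on_pd[OF smE] in auto)
  have dM: "(\<lambda>x. \<mu> v (emb x)) differentiable at x" if "v \<in> Basis" for v x
    by (rule C_on_differentiable[of UNIV]) (use smooth_periodic_emb[OF \<mu>[OF that]] in \<open>auto simp: smooth_periodic_def\<close>)
  have pdw: "pd c (amb_form \<mu> e) x = (\<Sum>v\<in>Basis. pd c (pd e (\<lambda>x. emb x \<bullet> v)) x * \<mu> v (emb x)
      + (pd e emb x \<bullet> v) * (\<Sum>u\<in>Basis. (pd c emb x \<bullet> u) * D u v (emb x)))" for c e x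
  proof -
    have "amb_form \<mu> e = (\<lambda>x. \<Sum>v\<in>Basis. pd e (\<lambda>x. emb x \<bullet> v) x * \<mu> v (emb x))"
      by (simp add: fun_eq_iff amb_form_def pd_emb_inner)
    then have "pd c (amb_form \<mu> e) x = (\<Sum>v\<in>Basis. pd c (\<lambda>x. pd e (\<lambda>x. emb x \<bullet> v) x * \<mu> v (emb x)) x)"
      by (simp add: pd_sum differentiable_mult dE dM)
    also have "\<dots> = (\<Sum>v\<in>Basis. pd c (pd e (\<lambda>x. emb x \<bullet> v)) x * \<mu> v (emb x)
      + (pd e emb x \<bullet> v) * (\<Sum>u\<in>Basis. (pd c emb x \<bullet> u) * D u v (emb x)))"
      by (intro sum.cong refl, subst pd_mult[OF dE dM]) (simp_all add: pdmu pd_emb_inner)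
    finally show ?thesis .
  qed
  have ext: "pd b (amb_form \<mu> c) x - pd c (amb_form \<mu> b) x = pole_fac b x * pole_fac c x * A b c x" for b c x
  proof -
    \<comment> \<open>Second derivatives of the embedding are symmetric and drop out of the skew
      combination.\<close>
    have "pd b (pd c (\<lambda>x. emb x \<bullet> v)) x = pd c (pd b (\<lambda>x. emb x \<bullet> v)) x" for v
      by (rule pd_comm[OF open_UNIV UNIV_I smE])
    then show ?thesis
      unfolding pdw A_def pd_emb
      by (simp add: sum_subtractf[symmetric] sum_distrib_left algebra_simps)
  qed
  show ?thesis
  proof (rule pole_regularI)
    fix a :: 3
    \<comment> \<open>\<open>curl_fac a\<close> times the pole factors of the other two indices:
      \<open>sin \<theta>\<close> cancels in the first two components and survives as the pole
      factor of the third.\<close>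
    show "smooth_periodic (if a = 1 then (\<lambda>x. 1 / (cosh (x$1))^2 * A 2 3 x) else if a = 2 then (\<lambda>x. - A 3 1 x) else (\<lambda>x. - A 1 2 x))"
      by (auto intro!: smooth_periodic_intros smA)
    fix x assume x: "x \<in> chart"
    show "curl_fac a x * ext_deriv (amb_form \<mu>) a x = pole_fac a x *
      (if a = 1 then (\<lambda>x. 1 / (cosh (x$1))^2 * A 2 3 x) else if a = 2 then (\<lambda>x. - A 3 1 x) else (\<lambda>x. - A 1 2 x)) x"
      unfolding ext_deriv_def ext
      using exhaust_3[of a] chart_sin[OF x] by (elim disjE; hypsubst) simp_all
  qed
qed

section \<open>Ambient extensions of the Killing vectors and of the potential\<close>

definition rot_amb :: "3 \<Rightarrow> real \<times> (real^3) \<Rightarrow> real \<times> (real^3)" where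
  "rot_amb i p = (0, \<chi> j. cross3 (axis i 1) (snd p) $ j)"

text \<open>On \<open>hyp\<close> the spatial part is \<open>tanh \<tau>\<close> times the
  projection of the axis to the tangent plane of the sphere, the gradient of the height function;
  \<open>tanh\<close> is \<open>cosh \<tau> sinh \<tau>\<close> divided by the
  \<open>cosh^2 \<tau>\<close> of the metric.\<close>

definition boost_amb :: "3 \<Rightarrow> real \<times> (real^3) \<Rightarrow> real \<times> (real^3)" where
  "boost_amb i p = (snd p $ i, \<chi> j. tanh (fst p) * (axis i 1 $ j - snd p $ i * snd p $ j))"

lemma C_on_rot_amb: "open U \<Longrightarrow> C_on k U (rot_amb i)"
  unfolding rot_amb_def[abs_def]
proof (intro C_on_Pair C_on_const C_on_vec[where f = "\<lambda>p. \<chi> j. _ p j"])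
  fix j :: 3 assume "open U"
  then show "C_on k U (\<lambda>p. (\<chi> j. cross3 (axis i 1) (snd p) $ j) $ j)"
    using exhaust_3[of j]
    by (elim disjE; hypsubst) (auto simp: cross3_def intro!: C_on_intros)
qed

lemma C_on_boost_amb:
  assumes U: "open U"
  shows "C_on k U (boost_amb i)"
  unfolding boost_amb_def[abs_def]
proof (intro C_on_Pair C_on_vec[where f = "\<lambda>p. \<chi> j. _ p j"] U)
  fix j :: 3
  show "C_on k U (\<lambda>p. (\<chi> j. tanh (fst p) * (axis i 1 $ j - snd p $ i * snd p $ j)) $ j)"
    unfolding vec_lambda_beta by (intro C_on_intros U)
next
  show "C_on k U (\<lambda>p. snd p $ i)" using U by (intro C_on_intros)
qed

text \<open>The push-forward removes the coordinate singularity: the \<open>1 / sin \<theta>\<close>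
  of the component meets the vanishing \<phi> vector, and a linear ambient field remains.\<close>

lemma sum_rot_emb:
  assumes x: "x \<in> chart"
  shows "(\<Sum>a\<in>UNIV. rot i x $ a *\<^sub>R pd a emb x) = rot_amb i (emb x)"
proof -
  have sn: "sin (x$2) \<noteq> 0" using chart_sin[OF x] by simp
  have cc: "cos u * (cos u * z) = z - sin u * (sin u * z)" "cos u * cos u = 1 - sin u * sin u" for u z :: real
    using sin_cos_squared_add[of u] by algebra+
  show ?thesis
    unfolding sum_3 pd_emb rot_nth[OF x] using exhaust_3[of i] sn
    by (elim disjE; hypsubst)
      (simp_all add: frame_simps rot_amb_def cross3_def emb_nth prod_eq_iff vec_eq_iff forall_3
        harm_simps harm_th_simps harm_ph_simps, (simp_all add: algebra_simps cc)?)
qed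

lemma sum_boost_emb:
  assumes x: "x \<in> chart"
  shows "(\<Sum>a\<in>UNIV. boost i x $ a *\<^sub>R pd a emb x) = boost_amb i (emb x)"
proof -
  have sn: "sin (x$2) \<noteq> 0" using chart_sin[OF x] by simp
  have cc: "cos u * (cos u * z) = z - sin u * (sin u * z)" "cos u * cos u = 1 - sin u * sin u" for u z :: real
    using sin_cos_squared_add[of u] by algebra+
  show ?thesis
    unfolding sum_3 pd_emb boost_nth[OF x] tanh_def[symmetric] using exhaust_3[of i] sn
    by (elim disjE; hypsubst)
      (simp_all add: frame_simps boost_amb_def emb_nth prod_eq_iff vec_eq_iff forall_3 tanh_def
        harm_simps harm_th_simps harm_ph_simps, (simp_all add: algebra_simps cc add_divide_distrib diff_divide_distrib)?)
qed

lemma bilinear_basis_expansion: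
  fixes B :: "'a::euclidean_space \<Rightarrow> 'b::euclidean_space \<Rightarrow> real"
  assumes "bilinear B"
  shows "B x y = (\<Sum>u\<in>Basis. \<Sum>v\<in>Basis. (x \<bullet> u) * (y \<bullet> v) * B u v)"
proof -
  have l: "linear (\<lambda>x. B x y)" for y using assms by (simp add: bilinear_def)
  have r: "linear (B x)" for x using assms by (simp add: bilinear_def)
  have "B x y = (\<Sum>u\<in>Basis. (x \<bullet> u) * B u y)"
    using Linear_Algebra.linear_componentwise[OF l, of x y 1] by simp
  also have "\<dots> = (\<Sum>u\<in>Basis. (x \<bullet> u) * (\<Sum>v\<in>Basis. (y \<bullet> v) * B u v))"
    using Linear_Algebra.linear_componentwise[OF r, of _ y 1] by simp
  finally show ?thesis by (simp add: sum_distrib_left mult.assoc)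
qed

context
  fixes \<sigma> :: "real \<times> (real^3) \<Rightarrow> real"
    and h2 :: "real \<times> (real^3) \<Rightarrow> real \<times> (real^3) \<Rightarrow> real \<times> (real^3) \<Rightarrow> real"
  assumes \<sigma>: "smooth_on hyp \<sigma>" and h2: "smooth_sym_tensor h2"
begin

lemma h2_props:
  "p \<in> hyp \<Longrightarrow> bilinear (h2 p)" "p \<in> hyp \<Longrightarrow> h2 p u v = h2 p v u" "smooth_on hyp (\<lambda>p. h2 p u v)"
  using h2 unfolding smooth_sym_tensor_def by blast+

lemma smooth_chart_pull0: "smooth_chart (pull0 \<sigma>)"
  unfolding smooth_chart_def pull0_def[abs_def]
  using smooth_on_compose[OF \<sigma> open_UNIV C_on_emb emb_in_hyp] C_on_subset by blast

lemma pull2_expansion: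
  "pull2 h2 a b x = (\<Sum>u\<in>Basis. \<Sum>v\<in>Basis. (pd a emb x \<bullet> u) * (pd b emb x \<bullet> v) * h2 (emb x) u v)"
  unfolding pull2_def
  by (rule bilinear_basis_expansion[OF h2_props(1)[OF emb_in_hyp]])

lemma smooth_tens2_pull2: "smooth_tens2 (pull2 h2)"
  unfolding smooth_tens2_def smooth_chart_def
proof (intro allI)
  fix a b k
  have 1: "C_on k UNIV (\<lambda>x. h2 (emb x) u v)" for u v
    by (rule smooth_on_compose[OF h2_props(3) open_UNIV C_on_emb emb_in_hyp])
  have 2: "C_on k UNIV (\<lambda>x. pd a emb x \<bullet> v)" for a v
    by (rule C_on_blinear[OF bounded_linear_inner_left open_UNIV C_on_pd[OF C_on_emb]])
  have "C_on k UNIV (pull2 h2 a b)"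
    unfolding pull2_expansion[abs_def] by (intro C_on_intros open_UNIV 1 2)
  then show "C_on k chart (pull2 h2 a b)" by (rule C_on_subset) simp
qed

lemma sym_tens2_pull2: "sym_tens2 (pull2 h2)"
  unfolding sym_tens2_def pull2_def using h2_props(2)[OF emb_in_hyp] by blast

text \<open>The potential as a bilinear form on the ambient space. The fields are extended by
  \<open>rad\<close>, and the metric is written as \<open>- d\<tau>^2\<close> plus
  \<open>cosh^2 \<tau>\<close> times the flat inner product, which induces the round metric on the
  sphere.\<close>

definition pot_amb :: "real \<times> (real^3) \<Rightarrow> real \<times> (real^3) \<Rightarrow> real \<times> (real^3) \<Rightarrow> real" where
  "pot_amb u v p = h2 (rad p) u v - 2 * (\<sigma> (rad p))\<^sup>2 * (- (fst u * fst v) + (cosh (fst p))\<^sup>2 * (snd u \<bullet> snd v))"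

lemma C_on_pot_amb: "C_on k off_axis (pot_amb u v)"
proof -
  have 1: "C_on k off_axis (\<lambda>p. h2 (rad p) u v)"
    by (rule smooth_on_compose[OF h2_props(3) open_off_axis C_on_rad rad_in_hyp])
  have 2: "C_on k off_axis (\<lambda>p. \<sigma> (rad p))"
    by (rule smooth_on_compose[OF \<sigma> open_off_axis C_on_rad rad_in_hyp])
  show ?thesis unfolding pot_amb_def[abs_def] by (intro C_on_intros 1 2 open_off_axis)
qed

lemma bilinear_pot_amb: "bilinear (\<lambda>u v. pot_amb u v (emb x))"
proof -
  note b = h2_props(1)[OF emb_in_hyp[of x]]
  show ?thesis
    unfolding bilinear_def pot_amb_def rad_emb
    by (intro conjI allI linearI)
      (simp_all add: bilinear_ladd[OF b] bilinear_radd[OF b] bilinear_lmul[OF b] bilinear_rmul[OF b]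
        algebra_simps inner_add_left inner_add_right)
qed

lemma frame_orthonormal:
  "snd (frame 2 x) \<bullet> snd (frame 2 x) = 1" "snd (frame 3 x) \<bullet> snd (frame 3 x) = 1" "snd (frame 2 x) \<bullet> snd (frame 3 x) = 0"
  "snd (frame 3 x) \<bullet> snd (frame 2 x) = 0"
proof -
  have cc: "cos u * (cos u * z) = z - sin u * (sin u * z)" "cos u * cos u = 1 - sin u * sin u" for u z :: real
    using sin_cos_squared_add[of u] by algebra+
  show "snd (frame 2 x) \<bullet> snd (frame 2 x) = 1" "snd (frame 3 x) \<bullet> snd (frame 3 x) = 1" "snd (frame 2 x) \<bullet> snd (frame 3 x) = 0"
    "snd (frame 3 x) \<bullet> snd (frame 2 x) = 0"
    by (simp_all add: frame_simps inner_vec_def sum_3 harm_th_simps harm_ph_simps, (simp_all add: algebra_simps cc)?)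
qed

lemma weyl_pot_eq: "weyl_pot (pull0 \<sigma>) (pull2 h2) a b x = pot_amb (pd a emb x) (pd b emb x) (emb x)"
proof -
  have "h0 a b x = - (fst (pd a emb x) * fst (pd b emb x)) + (cosh (fst (emb x)))\<^sup>2 * (snd (pd a emb x) \<bullet> snd (pd b emb x))"
    unfolding pd_emb emb_nth using exhaust_3[of a] exhaust_3[of b]
    by (elim disjE; hypsubst) (simp_all add: frame_orthonormal, simp_all add: frame_simps power2_eq_square)
  then show ?thesis unfolding weyl_pot_def pot_amb_def pull0_def pull2_def rad_emb by simp
qed

definition contract_amb where
  "contract_amb Z v p = (\<Sum>u\<in>Basis. (Z p \<bullet> u) * pot_amb v u p)"

text \<open>Linearity in the second slot gathers the components of \<open>X\<close>, which may be
  singular one by one, into the push-forward \<open>Z\<close>; the contraction thereby becomes a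
  pullback from the ambient space.\<close>

lemma contract_weyl_pot:
  assumes "(\<Sum>a\<in>UNIV. X x $ a *\<^sub>R pd a emb x) = Z (emb x)"
  shows "contract (weyl_pot (pull0 \<sigma>) (pull2 h2)) X d x = amb_form (contract_amb Z) d x"
proof -
  have l: "linear (\<lambda>v. pot_amb u v (emb x))" for u
    using bilinear_pot_amb[of x] unfolding bilinear_def by blast
  have "contract (weyl_pot (pull0 \<sigma>) (pull2 h2)) X d x = pot_amb (pd d emb x) (\<Sum>a\<in>UNIV. X x $ a *\<^sub>R pd a emb x) (emb x)"
    unfolding contract_def weyl_pot_eq by (simp add: linear_sum[OF l] linear_scale[OF l] mult.commute)
  also have "\<dots> = amb_form (contract_amb Z) d x"
    unfolding assms amb_form_def contract_amb_def
    by (subst bilinear_basis_expansion[OF bilinear_pot_amb]) (simp add: sum_distrib_left mult.assoc)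
  finally show ?thesis .
qed

lemma C_on_contract_amb:
  assumes "C_on k off_axis Z"
  shows "C_on k off_axis (contract_amb Z v)"
  unfolding contract_amb_def[abs_def]
  by (intro C_on_intros open_off_axis C_on_pot_amb C_on_blinear[OF bounded_linear_inner_left] assms)

text \<open>Computed in the frame, where the squared pole factor of the \<phi>\<phi> component
  cancels the \<open>sin^2 \<theta>\<close> of the inverse metric.\<close>

lemma trace2_weyl_pot_regular:
  "\<exists>f. smooth_periodic f \<and> (\<forall>x\<in>chart. trace2 (weyl_pot (pull0 \<sigma>) (pull2 h2)) x = f x)"
proof -
  define K where "K a x = (\<Sum>u\<in>Basis. \<Sum>v\<in>Basis. (frame a x \<bullet> u) * (frame a x \<bullet> v) * pot_amb u v (emb x))" for a x
  have sm: "smooth_periodic (K a)" for a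
    unfolding K_def[abs_def] by (intro smooth_periodic_intros smooth_periodic_frame smooth_periodic_emb C_on_pot_amb)
  have k: "weyl_pot (pull0 \<sigma>) (pull2 h2) a a x = (pole_fac a x)^2 * K a x" for a x
  proof -
    have "weyl_pot (pull0 \<sigma>) (pull2 h2) a a x = (pole_fac a x)^2 * pot_amb (frame a x) (frame a x) (emb x)"
      unfolding weyl_pot_eq pd_emb using bilinear_pot_amb[of x]
      by (simp add: bilinear_lmul[of "\<lambda>u v. pot_amb u v (emb x)"] bilinear_rmul[of "\<lambda>u v. pot_amb u v (emb x)"] power2_eq_square)
    then show ?thesis
      unfolding K_def bilinear_basis_expansion[OF bilinear_pot_amb[of x], of "frame a x" "frame a x"] .
  qed
  have "smooth_periodic (\<lambda>x. - K 1 x + K 2 x / (cosh (x$1))\<^sup>2 + K 3 x / (cosh (x$1))\<^sup>2)"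
    by (intro smooth_periodic_intros sm) simp_all
  moreover have "trace2 (weyl_pot (pull0 \<sigma>) (pull2 h2)) x = - K 1 x + K 2 x / (cosh (x$1))\<^sup>2 + K 3 x / (cosh (x$1))\<^sup>2"
    if x: "x \<in> chart" for x
    unfolding trace2_eq[OF x] k sum_3 using chart_sin[OF x] by simp
  ultimately show ?thesis by blast
qed

text \<open>\<open>contract_curl\<close> for the potential rewrites \<open>B X\<close> as the dual
  exterior derivative of \<open>k X\<close>, minus \<open>k Y\<close>, plus the trace times the
  lowered \<open>Y\<close>. The first two come from ambient one-forms, and the hypotheses on
  \<open>g\<close> take care of the third.\<close>

lemma regular_contract_B2:
  assumes XY: "killing_dual X Y"
    and X: "\<And>x. x \<in> chart \<Longrightarrow> (\<Sum>a\<in>UNIV. X x $ a *\<^sub>R pd a emb x) = Z (emb x)" "\<And>k. C_on k off_axis Z"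
    and Y: "\<And>x. x \<in> chart \<Longrightarrow> (\<Sum>a\<in>UNIV. Y x $ a *\<^sub>R pd a emb x) = Z' (emb x)" "\<And>k. C_on k off_axis Z'"
    and g: "\<And>a. smooth_periodic (g a)" "\<And>a x. x \<in> chart \<Longrightarrow> h0 a a x * Y x $ a = pole_fac a x * g a x"
  shows "\<exists>w. regular_form w \<and> (\<forall>a. \<forall>x\<in>chart. contract (B2 (pull0 \<sigma>) (pull2 h2)) X a x = w a x)"
proof (rule pole_regular_imp_regular_form)
  let ?k = "weyl_pot (pull0 \<sigma>) (pull2 h2)"
  note sm = smooth_chart_pull0 smooth_tens2_pull2 sym_tens2_pull2
  obtain f where f: "smooth_periodic f" "\<And>x. x \<in> chart \<Longrightarrow> trace2 ?k x = f x"
    using trace2_weyl_pot_regular by blast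
  have 1: "pole_regular (\<lambda>d x. curl_fac d x * ext_deriv (amb_form (contract_amb Z)) d x)"
    by (rule pole_regular_curl_amb_form) (rule C_on_contract_amb[OF X(2)])
  have 2: "pole_regular (amb_form (contract_amb Z'))"
    by (rule pole_regular_amb_form) (rule C_on_contract_amb[OF Y(2)])
  have 3: "pole_regular (\<lambda>a x. f x * (h0 a a x * Y x $ a))"
    by (rule pole_regularI[where f = "\<lambda>a x. f x * g a x"]) (simp_all add: g f smooth_periodic_intros)
  show "pole_regular (contract (B2 (pull0 \<sigma>) (pull2 h2)) X)"
  proof (rule pole_regular_cong[OF pole_regular_add[OF pole_regular_add[OF 1 pole_regular_uminus[OF 2]] 3]])
    fix d x assume x: "x \<in> chart"
    have "ext_deriv (contract ?k X) d x = ext_deriv (amb_form (contract_amb Z)) d x"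
      unfolding ext_deriv_def using pd_cong[OF open_chart x contract_weyl_pot[of X _ Z, OF X(1)]] by simp
    moreover have "?k a b x = ?k b a x" for a b
      using sym_tens2_weyl_pot[OF sm] x by (auto simp: sym_tens2_def)
    ultimately show "contract (B2 (pull0 \<sigma>) (pull2 h2)) X d x
       = curl_fac d x * ext_deriv (amb_form (contract_amb Z)) d x + - amb_form (contract_amb Z') d x + f x * (h0 d d x * Y x $ d)"
      using contract_curl[OF smooth_tens2_weyl_pot[OF sm] _ XY x, of d] contract_weyl_pot[of Y x Z', OF Y(1)[OF x], of d] f(2)[OF x]
      by (simp add: B2_eq)
  qed
qed

end

lemma flux_uminus: "flux T n t (\<lambda>x. - X x) = - flux T n t X"
  unfolding flux_def set_lebesgue_integral_def
  by (simp add: sum_negf flip: integral_minus)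

theorem mainTheorem4:
  fixes \<sigma> :: "real \<times> (real^3) \<Rightarrow> real"
    and h2 :: "real \<times> (real^3) \<Rightarrow> real \<times> (real^3) \<Rightarrow> real \<times> (real^3) \<Rightarrow> real"
    and T :: "real^3 \<Rightarrow> real"
    and n :: "real \<times> real \<Rightarrow> real^3"
    and G :: real
    and i :: 3
  assumes "G > 0"
    and "smooth_on hyp \<sigma>"
    and "smooth_sym_tensor h2"
    and "asymptotic_vacuum (pull0 \<sigma>) (pull2 h2)"
    and "cauchy_cut T"
    and "unit_future_normal T n"
  shows
    "1 / (8 * pi * G) * flux T n
        (\<lambda>a b x. E2 (pull0 \<sigma>) (pull2 h2) a b x - pull0 \<sigma> x * E1 (pull0 \<sigma>) a b x) (rot i)
     = - (1 / (8 * pi * G)) * flux T n (B2 (pull0 \<sigma>) (pull2 h2)) (boost i)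
     \<and> 1 / (8 * pi * G) * flux T n
        (\<lambda>a b x. E2 (pull0 \<sigma>) (pull2 h2) a b x - pull0 \<sigma> x * E1 (pull0 \<sigma>) a b x) (boost i)
     = 1 / (8 * pi * G) * flux T n (B2 (pull0 \<sigma>) (pull2 h2)) (rot i)"
proof -
  note \<sigma> = assms(2) and h2 = assms(3)
  have T: "smooth_on (sphere 0 1) T" using assms(5) by (simp add: cauchy_cut_def)
  note sm = smooth_chart_pull0[OF \<sigma> h2] smooth_tens2_pull2[OF \<sigma> h2] sym_tens2_pull2[OF \<sigma> h2] assms(4)
  note rotZ = sum_rot_emb C_on_rot_amb[OF open_off_axis]
  note boostZ = sum_boost_emb C_on_boost_amb[OF open_off_axis]
  have "\<exists>w. regular_form w \<and> (\<forall>a. \<forall>x\<in>chart. contract (B2 (pull0 \<sigma>) (pull2 h2)) (rot i) a x = w a x)"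
  proof (rule regular_contract_B2[OF \<sigma> h2 killing_dual_rot rotZ boostZ])
    \<comment> \<open>Components of the boost with lowered index, pole factor removed.\<close>
    let ?g = "\<lambda>(a::3) x. if a = 1 then - harm i x else cosh (x$1) * sinh (x$1) * (if a = 2 then harm_th i x else harm_ph i x)"
    show "smooth_periodic (?g a)" for a
      using exhaust_3[of a] by (elim disjE; hypsubst) (simp_all add: smooth_periodic_intros)
    show "h0 a a x * boost i x $ a = pole_fac a x * ?g a x" if x: "x \<in> chart" for a x
      using exhaust_3[of a] chart_sin[OF x]
      by (elim disjE; hypsubst) (simp_all add: boost_nth[OF x] power2_eq_square)
  qed
  then obtain w where w: "regular_form w" "\<And>a x. x \<in> chart \<Longrightarrow> contract (B2 (pull0 \<sigma>) (pull2 h2)) (rot i) a x = w a x"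
    by blast
  have "\<exists>w. regular_form w \<and> (\<forall>a. \<forall>x\<in>chart. contract (B2 (pull0 \<sigma>) (pull2 h2)) (boost i) a x = w a x)"
  proof (rule regular_contract_B2[OF \<sigma> h2 killing_dual_boost boostZ])
    show "(\<Sum>a\<in>UNIV. (- rot i x) $ a *\<^sub>R pd a emb x) = - rot_amb i (emb x)" if "x \<in> chart" for x
      using rotZ(1)[OF that, of i] by (simp add: sum_negf)
    show "C_on k off_axis (\<lambda>p. - rot_amb i p)" for k by (intro C_on_intros rotZ open_off_axis)
    \<comment> \<open>The same for minus the rotation, the dual of the boost.\<close>
    let ?g = "\<lambda>(a::3) x. if a = 1 then 0 else (cosh (x$1))\<^sup>2 * (if a = 2 then - harm_ph i x else harm_th i x)"
    show "smooth_periodic (?g a)" for a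
      using exhaust_3[of a] by (elim disjE; hypsubst) (simp_all add: smooth_periodic_intros)
    show "h0 a a x * (- rot i x) $ a = pole_fac a x * ?g a x" if x: "x \<in> chart" for a x
      using exhaust_3[of a] chart_sin[OF x]
      by (elim disjE; hypsubst) (simp_all add: rot_nth[OF x] power2_eq_square)
  qed
  then obtain v where v: "regular_form v" "\<And>a x. x \<in> chart \<Longrightarrow> contract (B2 (pull0 \<sigma>) (pull2 h2)) (boost i) a x = v a x"
    by blast
  show ?thesis
    \<comment> \<open>In the second instance \<open>Y\<close> is minus the rotation; linearity of
      the flux turns this into the sign by which the two identities differ.\<close>
    using flux_duality[OF sm killing_dual_rot T assms(6) w] flux_duality[OF sm killing_dual_boost T assms(6) v]
    by (simp add: flux_uminus)
qed

end
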